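(* For each dimension $d\ge1$ let $A\subset\mathbb{R}^d$ be measurable, and assume that $\inf_d p_f(A)>0$. For each $d$ consider any $r=r(d)\in\{1,\dots,d\}$ and any orthonormal family $(d_1,\dots,d_r)$ of $\mathbb{R}^d$. Then $g_{\mathrm{proj}}$ is efficient in high dimension for $A$. If in addition $n_g\gg rd$ and $(d_1,\dots,d_r)$ (which may be random) is independent from the sample $(Y_{A,i})_i$, then $\hat g_{\mathrm{proj}}$ is efficient in high dimension for $A$.
   Context: All objects are indexed by the dimension $d\ge1$; the dependence on $d$ is suppressed and limits are as $d\to\infty$. For sequences, $u\gg v$ means $u/v\to\infty$. $f$ is the standard Gaussian density on $\mathbb{R}^d$, $p_f(A)=\int_A f$, $f|_A=f1_A/p_f(A)$. $N(\mu,\Sigma)$ denotes the Gaussian law with mean $\mu$ and covariance $\Sigma$, identified with its density. Let $\mu_A$ and $\Sigma_A$ be the mean vector and covariance matrix of $f|_A$. $g_{\mathrm{proj}}=N(\mu_A,\Sigma_{\mathrm{proj}})$ with $\Sigma_{\mathrm{proj}}=\sum_{k=1}^r(v_k-1)d_kd_k^\top+I$, $v_k=d_k^\top\Sigma_Ad_k$. Let $(Y_{A,i})_i$ be i.i.d. with density $f|_A$, and $\hat\mu_A=\frac1{n_g}\sum_{k=1}^{n_g}Y_{A,k}$, $\hat\Sigma_A=\frac1{n_g}\sum_{k=1}^{n_g}Y_{A,k}Y_{A,k}^\top-\hat\mu_A\hat\mu_A^\top$, where $n_g=n_g(d)$. Then $\hat g_{\mathrm{proj}}=N(\hat\mu_A,\hat\Sigma_{\mathrm{proj}})$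 with $\hat\Sigma_{\mathrm{proj}}=\sum_{k=1}^r(\hat v_k-1)d_kd_k^\top+I$, $\hat v_k=d_k^\top\hat\Sigma_Ad_k$ (by convention $\hat g_{\mathrm{proj}}=f$ if $\hat\Sigma_{\mathrm{proj}}$ is singular). Efficiency. A sequence (in $d$) of possibly random densities $g$ is efficient in high dimension for $A$ if for any sequence of integers $n_p=n_p(d)\to\infty$, with $\ell=f/g$ and $Y_1,Y_2,\dots$ i.i.d. with density $g$ conditionally on $g$, the following two convergences in distribution hold as $d\to\infty$: $$\mathbb{E}\Big(\frac{\max_{i\le n_p}\ell(Y_i)}{\sum_{i\le n_p}\ell(Y_i)}\,\Big|\,g\Big)\Rightarrow 0,\qquad \mathbb{E}\Big(\Big|\frac{1}{p_f(A)\,n_p}\sum_{i=1}^{n_p}\ell(Y_i)1_A(Y_i)-1\Big|\,\Big|\,g\Big)\Rightarrow 0 .$$ *)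

theory Defs
  imports "HOL-Probability.Probability" "Jordan_Normal_Form.Gauss_Jordan_Elimination"
    "Jordan_Normal_Form.Determinant"
begin

(* Since the dimension d varies along a sequence, a point of R^d is a function x :: nat => real
   which is extensional on {..<d} (coordinates are numbered from 0, and x i = undefined for
   i >= d). Matrices are those of Jordan_Normal_Form. *)
definition Rd :: "nat \<Rightarrow> (nat \<Rightarrow> real) measure" where
  "Rd d = Pi\<^sub>M {..<d} (\<lambda>_. lborel)"

definition std_gauss :: "nat \<Rightarrow> (nat \<Rightarrow> real) \<Rightarrow> real" where
  "std_gauss d x = (\<Prod>i<d. std_normal_density (x i))"

definition p_f :: "nat \<Rightarrow> (nat \<Rightarrow> real) set \<Rightarrow> real" where
  "p_f d A = (LINT x:A|Rd d. std_gauss d x)"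

definition f_cond :: "nat \<Rightarrow> (nat \<Rightarrow> real) set \<Rightarrow> (nat \<Rightarrow> real) \<Rightarrow> real" where
  "f_cond d A x = std_gauss d x * indicator A x / p_f d A"

definition quad_form :: "nat \<Rightarrow> real mat \<Rightarrow> (nat \<Rightarrow> real) \<Rightarrow> real" where
  "quad_form d S u = vec d u \<bullet> (S *\<^sub>v vec d u)"

(* The density of N(m, S); it is meaningful for S symmetric positive definite only. *)
definition gauss_density ::
    "nat \<Rightarrow> (nat \<Rightarrow> real) \<Rightarrow> real mat \<Rightarrow> (nat \<Rightarrow> real) \<Rightarrow> real" where
  "gauss_density d m S x =
     exp (- quad_form d (the (mat_inverse S)) (\<lambda>i. x i - m i) / 2)
       / sqrt ((2 * pi) ^ d * Determinant.det S)"

definition mean_A :: "nat \<Rightarrow> (nat \<Rightarrow> real) set \<Rightarrow> nat \<Rightarrow> real" where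
  "mean_A d A i = (LINT x|Rd d. x i * f_cond d A x)"

definition cov_A :: "nat \<Rightarrow> (nat \<Rightarrow> real) set \<Rightarrow> real mat" where
  "cov_A d A = mat d d (\<lambda>(i, j).
     LINT x|Rd d. (x i - mean_A d A i) * (x j - mean_A d A j) * f_cond d A x)"

definition orthonormal_family :: "nat \<Rightarrow> nat \<Rightarrow> (nat \<Rightarrow> nat \<Rightarrow> real) \<Rightarrow> bool" where
  "orthonormal_family d r D \<longleftrightarrow>
     (\<forall>k<r. \<forall>l<r. vec d (D k) \<bullet> vec d (D l) = (if k = l then 1 else 0))"

(* The matrix (sum_k (v_k - 1) d_k d_k^T) + I with v_k = d_k^T S d_k. *)
definition proj_cov :: "nat \<Rightarrow> nat \<Rightarrow> (nat \<Rightarrow> nat \<Rightarrow> real) \<Rightarrow> real mat \<Rightarrow> real mat" where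
  "proj_cov d r D S =
     mat d d (\<lambda>(i, j). \<Sum>k<r. (quad_form d S (D k) - 1) * D k i * D k j) + 1\<^sub>m d"

definition g_proj ::
    "nat \<Rightarrow> (nat \<Rightarrow> real) set \<Rightarrow> nat \<Rightarrow> (nat \<Rightarrow> nat \<Rightarrow> real) \<Rightarrow> (nat \<Rightarrow> real) \<Rightarrow> real" where
  "g_proj d A r D = gauss_density d (mean_A d A) (proj_cov d r D (cov_A d A))"

definition emp_mean :: "nat \<Rightarrow> (nat \<Rightarrow> nat \<Rightarrow> real) \<Rightarrow> nat \<Rightarrow> real" where
  "emp_mean n Y i = (\<Sum>k<n. Y k i) / real n"

definition emp_cov :: "nat \<Rightarrow> nat \<Rightarrow> (nat \<Rightarrow> nat \<Rightarrow> real) \<Rightarrow> real mat" where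
  "emp_cov d n Y = mat d d (\<lambda>(i, j).
     (\<Sum>k<n. Y k i * Y k j) / real n - emp_mean n Y i * emp_mean n Y j)"

definition g_proj_hat ::
    "nat \<Rightarrow> nat \<Rightarrow> (nat \<Rightarrow> nat \<Rightarrow> real) \<Rightarrow> nat \<Rightarrow> (nat \<Rightarrow> nat \<Rightarrow> real)
      \<Rightarrow> (nat \<Rightarrow> real) \<Rightarrow> real" where
  "g_proj_hat d r D n Y =
     (let S = proj_cov d r D (emp_cov d n Y)
      in if invertible_mat S then gauss_density d (emp_mean n Y) S else std_gauss d)"

definition lik_ratio :: "nat \<Rightarrow> ((nat \<Rightarrow> real) \<Rightarrow> real) \<Rightarrow> (nat \<Rightarrow> real) \<Rightarrow> real" where
  "lik_ratio d g y = std_gauss d y / g y"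

(* The law of a sample (y 0, ..., y (n - 1)) which is i.i.d. with density g. *)
definition iid_law :: "nat \<Rightarrow> nat \<Rightarrow> ((nat \<Rightarrow> real) \<Rightarrow> real) \<Rightarrow> (nat \<Rightarrow> nat \<Rightarrow> real) measure" where
  "iid_law d n g = Pi\<^sub>M {..<n} (\<lambda>_. density (Rd d) (\<lambda>x. ennreal (g x)))"

definition conv_distr_0 :: "(nat \<Rightarrow> 'w measure) \<Rightarrow> (nat \<Rightarrow> 'w \<Rightarrow> real) \<Rightarrow> bool" where
  "conv_distr_0 M X \<longleftrightarrow> weak_conv_m (\<lambda>d. distr (M d) borel (X d)) (return borel 0)"

(* The random density g d lives on the probability space M d. As the sample is i.i.d. with
   density g conditionally on g, its conditional law is iid_law, and the conditional expectation
   given g is the integral against that law, evaluated at the realisation g d w. Both integrands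
   are integrable when g d w is a probability density: the first is bounded by 1, the second has
   expectation at most 2. *)
definition efficient ::
    "(nat \<Rightarrow> 'w measure) \<Rightarrow> (nat \<Rightarrow> 'w \<Rightarrow> (nat \<Rightarrow> real) \<Rightarrow> real) \<Rightarrow> (nat \<Rightarrow> (nat \<Rightarrow> real) set) \<Rightarrow> bool"
  where
  "efficient M g A \<longleftrightarrow>
     (\<forall>n_p :: nat \<Rightarrow> nat. filterlim n_p at_top sequentially \<longrightarrow>
        conv_distr_0 M (\<lambda>d w.
          LINT y|iid_law d (n_p d) (g d w).
            (MAX i\<in>{..<n_p d}. lik_ratio d (g d w) (y i))
              / (\<Sum>i<n_p d. lik_ratio d (g d w) (y i))) \<and>
        conv_distr_0 M (\<lambda>d w.
          LINT y|iid_law d (n_p d) (g d w).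
            \<bar>1 / (p_f d (A d) * real (n_p d))
               * (\<Sum>i<n_p d. lik_ratio d (g d w) (y i) * indicator (A d) (y i)) - 1\<bar>))"

end

theory Submission
  imports Defs
begin

text \<open>
  Write \<open>l = f / g\<close>. If the law of \<open>l\<close> under \<open>f\<close> is tight uniformly in the dimension, then truncating \<open>l\<close>
  at a large constant gives an L1 law of large numbers for any number of samples tending to infinity,
  and hence efficiency. Since the negative part of \<open>log l\<close> has expectation at most 1 under \<open>f\<close>, a
  bound on the relative entropy of \<open>f\<close> with respect to \<open>g\<close> is enough. For \<open>g = N(m, S)\<close> with \<open>S\<close> equal to
  \<open>v k\<close> along \<open>d_k\<close> and to the identity orthogonally, the relative entropy is bounded in terms of a
  lower bound on the \<open>v k\<close>, the sum of the \<open>(v k - 1)^2\<close> and the norm of \<open>m\<close>.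

  For the exact mean and variances of \<open>f\<close> conditioned on \<open>A\<close>, Jensen's inequality applied to \<open>log (g / f)\<close>
  bounds the sum of the \<open>v k - 1 - log (v k)\<close> plus the squared norm of the mean by \<open>- 2 log (p_f A)\<close>, which
  controls all three quantities. The empirical versions are close to the exact ones with high
  probability: given the directions, the summed squared errors have expectation of
  order \<open>r / n_g\<close> for the variances (by fourth moments) and \<open>d / n_g\<close> for the mean.
\<close>

section \<open>Low-rank updates of the identity matrix\<close>

text \<open>The part of the \<open>g\<close>-integral of l where l > K is exactly the
  \<open>f\<close>-probability of l > K. This is why tightness under \<open>f\<close> is the right
  condition, why no second moment of l is needed, and why \<open>n_p\<close> may grow arbitrarily
  slowly. The other obstacle is that r may be as large as d, so no bound may lose a constant per
  direction. In the relative entropy, ln v + 1 / v - 1 vanishes to second order at v = 1; hence the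
  sum of the (v k - 1)^2 has to stay bounded, while the sum of the |v k - 1| is then controlled only
  up to a factor sqrt r. The exact parameters comply because the Jensen bound is itself a comparison
  of entropies: N(mu_A, Sigma_proj) is no further from \<open>f\<close> than the conditioned law,
  whose relative entropy with respect to \<open>f\<close> is - log (p_f A) in every dimension.
  Random directions are handled by freezing them, which is where their independence from the sample
  enters.\<close>

definition dot :: "nat \<Rightarrow> (nat \<Rightarrow> real) \<Rightarrow> (nat \<Rightarrow> real) \<Rightarrow> real" where
  "dot d x y = (\<Sum>i<d. x i * y i)"

text \<open>Parametrised by the excess over the identity: for orthonormal directions the eigenvalue
  along \<open>D k\<close> is 1 + \<open>c k\<close>, and the orthogonal complement is
  fixed.\<close>

definition rank_update :: "nat \<Rightarrow> nat \<Rightarrow> (nat \<Rightarrow> nat \<Rightarrow> real) \<Rightarrow> (nat \<Rightarrow> real) \<Rightarrow> real mat" where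
  "rank_update d r D c = mat d d (\<lambda>(i, j). \<Sum>k<r. c k * D k i * D k j) + 1\<^sub>m d"

lemma rank_update_carrier [simp]: "rank_update d r D c \<in> carrier_mat d d"
  by (simp add: rank_update_def)

lemma rank_update_index:
  "i < d \<Longrightarrow> j < d \<Longrightarrow>
     rank_update d r D c $$ (i, j) = (\<Sum>k<r. c k * D k i * D k j) + (if i = j then 1 else 0)"
  by (simp add: rank_update_def)

lemma proj_cov_eq_rank_update:
  "proj_cov d r D S = rank_update d r D (\<lambda>k. quad_form d S (D k) - 1)"
  by (simp add: proj_cov_def rank_update_def)

lemma orthonormal_family_dot:
  "orthonormal_family d r D \<longleftrightarrow> (\<forall>k<r. \<forall>l<r. dot d (D k) (D l) = (if k = l then 1 else 0))"
  by (simp add: orthonormal_family_def dot_def scalar_prod_def lessThan_atLeast0)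

lemma dot_commute: "dot d x y = dot d y x"
  by (simp add: dot_def mult.commute)

lemma quad_form_eq_sum:
  assumes "S \<in> carrier_mat d d"
  shows "quad_form d S u = (\<Sum>i<d. \<Sum>j<d. u i * S $$ (i, j) * u j)"
  using assms
  by (auto simp: quad_form_def scalar_prod_def lessThan_atLeast0 sum_distrib_left mult.assoc
      intro!: sum.cong)

lemma quad_form_rank_update:
  "quad_form d (rank_update d r D c) u = dot d u u + (\<Sum>k<r. c k * (dot d u (D k))\<^sup>2)"
proof -
  have "quad_form d (rank_update d r D c) u =
     (\<Sum>i<d. \<Sum>j<d. u i * ((\<Sum>k<r. c k * D k i * D k j) + (if i = j then 1 else 0)) * u j)"
    by (subst quad_form_eq_sum) (auto simp: rank_update_index intro!: sum.cong)
  also have "\<dots> = (\<Sum>i<d. \<Sum>j<d. \<Sum>k<r. c k * (u i * D k i) * (u j * D k j))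
      + (\<Sum>i<d. \<Sum>j<d. if i = j then u i * u j else 0)"
    unfolding sum.distrib[symmetric]
    by (intro sum.cong refl) (auto simp: algebra_simps sum_distrib_left sum_distrib_right)
  also have "(\<Sum>i<d. \<Sum>j<d. if i = j then u i * u j else 0) = dot d u u"
    by (simp add: dot_def sum.delta)
  also have "(\<Sum>i<d. \<Sum>j<d. \<Sum>k<r. c k * (u i * D k i) * (u j * D k j))
    = (\<Sum>i<d. \<Sum>k<r. \<Sum>j<d. c k * (u i * D k i) * (u j * D k j))"
    by (intro sum.cong refl sum.swap)
  also have "\<dots> = (\<Sum>k<r. \<Sum>i<d. \<Sum>j<d. c k * (u i * D k i) * (u j * D k j))"
    by (rule sum.swap)
  also have "\<dots> = (\<Sum>k<r. c k * (dot d u (D k))\<^sup>2)"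
    unfolding dot_def power2_eq_square sum_product by (simp add: sum_distrib_left mult.assoc)
  finally show ?thesis by simp
qed

section \<open>Determinant, products and invertibility of low-rank updates\<close>

lemma rank_update_eq_product:
  "rank_update d r D c = 1\<^sub>m d + mat d r (\<lambda>(i, k). c k * D k i) * mat r d (\<lambda>(k, j). D k j)"
  by (intro eq_matI) (auto simp: rank_update_def scalar_prod_def lessThan_atLeast0)

text \<open>Sylvester's identity. The block matrix \<open>?L\<close> is unit lower triangular and
  intertwines \<open>?M1\<close> and \<open>?M2\<close>, which are block upper triangular and have
  the two sides as determinants.\<close>

lemma det_one_plus_mult_commute:
  fixes U V :: "real mat"
  assumes U: "U \<in> carrier_mat n m" and V: "V \<in> carrier_mat m n"
  shows "Determinant.det (1\<^sub>m n + U * V) = Determinant.det (1\<^sub>m m + V * U)"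
proof -
  let ?L = "four_block_mat (1\<^sub>m n) (0\<^sub>m n m) V (1\<^sub>m m)"
  let ?M1 = "four_block_mat (1\<^sub>m n + U * V) U (0\<^sub>m m n) (1\<^sub>m m)"
  let ?M2 = "four_block_mat (1\<^sub>m n) U (0\<^sub>m m n) (1\<^sub>m m + V * U)"
  have UV: "U * V \<in> carrier_mat n n" and VU: "V * U \<in> carrier_mat m m" using U V by auto
  have "?L * ?M1 = four_block_mat (1\<^sub>m n + U * V) U (V * (1\<^sub>m n + U * V)) (V * U + 1\<^sub>m m)"
    using U V UV VU by (subst mult_four_block_mat[where ?n2.0=m and ?nc1.0=n]) auto
  moreover have "?M2 * ?L = four_block_mat (1\<^sub>m n + U * V) U ((1\<^sub>m m + V * U) * V) (1\<^sub>m m + V * U)"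
    using U V UV VU by (subst mult_four_block_mat[where ?n2.0=m and ?nc1.0=n]) auto
  moreover have "V * (1\<^sub>m n + U * V) = (1\<^sub>m m + V * U) * V"
    using U V UV VU
    by (subst mult_add_distrib_mat[of _ m n _ n], simp_all,
        subst add_mult_distrib_mat[of _ m m _ _ n], simp_all add: assoc_mult_mat[of _ m n _ m _ n])
  moreover have "V * U + 1\<^sub>m m = 1\<^sub>m m + V * U"
    using VU by (intro comm_add_mat) auto
  ultimately have eq: "?L * ?M1 = ?M2 * ?L" by simp
  have dL: "Determinant.det ?L = 1"
    using V by (subst det_four_block_mat_upper_right_zero[of _ n _ m]) auto
  have d1: "Determinant.det ?M1 = Determinant.det (1\<^sub>m n + U * V)"
    using U V UV by (subst det_four_block_mat_lower_left_zero[of _ n _ m]) auto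
  have d2: "Determinant.det ?M2 = Determinant.det (1\<^sub>m m + V * U)"
    using U V VU by (subst det_four_block_mat_lower_left_zero[of _ n _ m]) auto
  have "Determinant.det (?L * ?M1) = Determinant.det ?L * Determinant.det ?M1"
    using U V UV VU by (intro det_mult[of _ "n + m"]) auto
  moreover have "Determinant.det (?M2 * ?L) = Determinant.det ?M2 * Determinant.det ?L"
    using U V UV VU by (intro det_mult[of _ "n + m"]) auto
  ultimately show ?thesis using eq dL d1 d2 by simp
qed

text \<open>Sylvester's identity reduces the d by d determinant to an r by r one, and orthonormality
  makes that matrix diagonal with entries 1 + \<open>c k\<close>.\<close>

lemma det_rank_update:
  assumes "orthonormal_family d r D"
  shows "Determinant.det (rank_update d r D c) = (\<Prod>k<r. 1 + c k)"
proof -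
  let ?U = "mat d r (\<lambda>(i, k). c k * D k i)" and ?V = "mat r d (\<lambda>(k, j). D k j)"
  have VU: "(?V * ?U) $$ (k, l) = (if k = l then c k else 0)" if "k < r" "l < r" for k l
  proof -
    have "(?V * ?U) $$ (k, l) = c l * dot d (D k) (D l)"
      using that by (simp add: scalar_prod_def lessThan_atLeast0 dot_def sum_distrib_left
          mult.assoc mult.left_commute)
    then show ?thesis using assms that by (auto simp: orthonormal_family_dot)
  qed
  let ?W = "1\<^sub>m r + ?V * ?U"
  have ut: "upper_triangular ?W"
    by (intro upper_triangularI) (subst index_add_mat, auto simp: VU simp del: index_mult_mat(1))
  have "Determinant.det (rank_update d r D c) = Determinant.det ?W"
    unfolding rank_update_eq_product by (rule det_one_plus_mult_commute) auto
  also have "\<dots> = prod_list (diag_mat ?W)"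
    by (rule det_upper_triangular[OF ut, of r]) auto
  also have "\<dots> = (\<Prod>k<r. ?W $$ (k, k))"
    unfolding prod_list_diag_prod by (simp add: lessThan_atLeast0)
  also have "\<dots> = (\<Prod>k<r. 1 + c k)"
    by (intro prod.cong refl) (subst index_add_mat, auto simp: VU simp del: index_mult_mat(1))
  finally show ?thesis .
qed

text \<open>Both factors are diagonal in the same orthonormal directions, so eigenvalues multiply:
  (1 + b)(1 + c) = 1 + (b + c + b c). In coordinates, the double sum over directions collapses by
  orthonormality.\<close>

lemma rank_update_mult:
  assumes on: "orthonormal_family d r D"
  shows "rank_update d r D b * rank_update d r D c = rank_update d r D (\<lambda>k. b k + c k + b k * c k)"
proof (intro eq_matI)
  fix i j assume "i < dim_row (rank_update d r D (\<lambda>k. b k + c k + b k * c k))"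
    "j < dim_col (rank_update d r D (\<lambda>k. b k + c k + b k * c k))"
  then have ij: "i < d" "j < d" by (auto simp: rank_update_def)
  let ?e = "\<lambda>i j. if i = j then 1 else (0::real)"
  have "(rank_update d r D b * rank_update d r D c) $$ (i, j) =
    (\<Sum>l<d. rank_update d r D b $$ (i, l) * rank_update d r D c $$ (l, j))"
    using ij by (simp add: scalar_prod_def lessThan_atLeast0 carrier_matD[OF rank_update_carrier])
  also have "\<dots> = (\<Sum>l<d. ((\<Sum>k<r. b k * D k i * D k l) + ?e i l) *
      ((\<Sum>k<r. c k * D k l * D k j) + ?e l j))"
    using ij by (intro sum.cong refl) (simp add: rank_update_index)
  also have "\<dots> = (\<Sum>l<d. (\<Sum>k<r. b k * D k i * D k l) * (\<Sum>k<r. c k * D k l * D k j))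
     + (\<Sum>l<d. if l = j then (\<Sum>k<r. b k * D k i * D k l) else 0)
     + (\<Sum>l<d. if i = l then (\<Sum>k<r. c k * D k l * D k j) else 0)
     + (\<Sum>l<d. if i = l then ?e l j else 0)"
    unfolding sum.distrib[symmetric] by (intro sum.cong refl) (auto simp: algebra_simps)
  also have "\<dots> = (\<Sum>l<d. (\<Sum>k<r. b k * D k i * D k l) * (\<Sum>k<r. c k * D k l * D k j))
     + (\<Sum>k<r. b k * D k i * D k j) + (\<Sum>k<r. c k * D k i * D k j) + ?e i j"
    using ij by (simp add: sum.delta)
  also have "(\<Sum>l<d. (\<Sum>k<r. b k * D k i * D k l) * (\<Sum>k<r. c k * D k l * D k j))
     = (\<Sum>l<d. \<Sum>k<r. \<Sum>m<r. b k * D k i * (c m * D m j) * (D k l * D m l))"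
    by (simp add: sum_product mult_ac)
  also have "\<dots> = (\<Sum>k<r. \<Sum>l<d. \<Sum>m<r. b k * D k i * (c m * D m j) * (D k l * D m l))"
    by (rule sum.swap)
  also have "\<dots> = (\<Sum>k<r. \<Sum>m<r. \<Sum>l<d. b k * D k i * (c m * D m j) * (D k l * D m l))"
    by (intro sum.cong refl sum.swap)
  also have "\<dots> = (\<Sum>k<r. \<Sum>m<r. b k * D k i * (c m * D m j) * dot d (D k) (D m))"
    by (simp add: dot_def sum_distrib_left)
  also have "\<dots> = (\<Sum>k<r. \<Sum>m<r. if k = m then b k * D k i * (c m * D m j) else 0)"
    using on by (intro sum.cong refl) (auto simp: orthonormal_family_dot)
  also have "\<dots> = (\<Sum>k<r. b k * c k * D k i * D k j)"
    by (simp add: sum.delta mult_ac)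
  finally show "(rank_update d r D b * rank_update d r D c) $$ (i, j)
      = rank_update d r D (\<lambda>k. b k + c k + b k * c k) $$ (i, j)"
    using ij by (simp add: rank_update_index algebra_simps sum.distrib)
qed (auto simp: rank_update_def)

lemma rank_update_inverse:
  assumes "orthonormal_family d r D" "\<And>k. k < r \<Longrightarrow> v k \<noteq> 0"
  shows "rank_update d r D (\<lambda>k. v k - 1) * rank_update d r D (\<lambda>k. 1 / v k - 1) = 1\<^sub>m d"
    and "rank_update d r D (\<lambda>k. 1 / v k - 1) * rank_update d r D (\<lambda>k. v k - 1) = 1\<^sub>m d"
  unfolding rank_update_mult[OF assms(1)]
  by (intro eq_matI; auto simp: rank_update_index field_simps assms(2) intro!: sum.neutral;
      simp add: rank_update_def)+

text \<open>Turns the singular case in \<open>g_proj_hat\<close> into the vanishing of some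
  empirical variance, which is visibly a measurable event.\<close>

lemma invertible_rank_update_iff:
  assumes "orthonormal_family d r D"
  shows "invertible_mat (rank_update d r D (\<lambda>k. v k - 1)) \<longleftrightarrow> (\<forall>k<r. v k \<noteq> 0)"
proof
  let ?S = "rank_update d r D (\<lambda>k. v k - 1)"
  assume "invertible_mat ?S"
  then obtain B where B: "inverts_mat ?S B" "inverts_mat B ?S" unfolding invertible_mat_def by blast
  \<comment> \<open>\<open>invertible_mat\<close> does not fix the dimensions of its witness; they
    are read off from the two products.\<close>
  have "?S * B = 1\<^sub>m d" using B(1) by (simp add: inverts_mat_def rank_update_def)
  moreover have "B * ?S = 1\<^sub>m (dim_row B)" using B(2) by (simp add: inverts_mat_def)
  ultimately have carr: "B \<in> carrier_mat d d"
    by (metis carrier_matI index_mult_mat(2,3) index_one_mat(2,3) rank_update_carrier carrier_matD)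
  have "Determinant.det ?S * Determinant.det B = 1"
    using det_mult[OF rank_update_carrier carr, of r D "\<lambda>k. v k - 1"] \<open>?S * B = 1\<^sub>m d\<close> by simp
  then have "(\<Prod>k<r. v k) * Determinant.det B = 1" by (simp add: det_rank_update[OF assms])
  then have "(\<Prod>k<r. v k) \<noteq> 0" by (metis mult_zero_left zero_neq_one)
  then show "\<forall>k<r. v k \<noteq> 0" by simp
next
  assume "\<forall>k<r. v k \<noteq> 0"
  then show "invertible_mat (rank_update d r D (\<lambda>k. v k - 1))"
    using rank_update_inverse[OF assms, of v]
    unfolding invertible_mat_def inverts_mat_def
    by (auto simp: rank_update_def intro!: exI[of _ "rank_update d r D (\<lambda>k. 1 / v k - 1)"])
qed

section \<open>The Gaussian density expressed through directions instead of matrices\<close>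

lemma the_mat_inverse_eqI:
  fixes S T :: "real mat"
  assumes S: "S \<in> carrier_mat n n" and T: "T \<in> carrier_mat n n"
    and ST: "S * T = 1\<^sub>m n" and TS: "T * S = 1\<^sub>m n"
  shows "the (mat_inverse S) = T"
proof (cases "mat_inverse S")
  case None
  then have "S \<notin> Units (ring_mat TYPE(real) n undefined)"
    by (rule mat_inverse(1)[OF S])
  then have False using assms by (auto simp: Units_def ring_mat_simps)
  then show ?thesis ..
next
  case (Some B)
  note B = mat_inverse(2)[OF S Some]
  have "B = B * (S * T)" using right_mult_one_mat[of B n n] B ST by simp
  also have "\<dots> = (B * S) * T" using B S T by (subst assoc_mult_mat[of _ n n _ n _ n]) auto
  also have "\<dots> = T" using B T by simp
  finally show ?thesis using Some by simp
qed

text \<open>Without determinants and inverses of matrices, joint measurability in the point, the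
  mean, the variances and the directions is a matter of finite sums and products. It integrates to 1
  once the \<open>D k\<close> are orthonormal and the \<open>v k\<close> positive.\<close>

definition proj_gauss_density ::
    "nat \<Rightarrow> nat \<Rightarrow> (nat \<Rightarrow> nat \<Rightarrow> real) \<Rightarrow> (nat \<Rightarrow> real) \<Rightarrow> (nat \<Rightarrow> real) \<Rightarrow> (nat \<Rightarrow> real) \<Rightarrow> real" where
  "proj_gauss_density d r D m v x =
     exp (- (dot d (\<lambda>i. x i - m i) (\<lambda>i. x i - m i)
             + (\<Sum>k<r. (1 / v k - 1) * (dot d (\<lambda>i. x i - m i) (D k))\<^sup>2)) / 2)
       / sqrt ((2 * pi) ^ d * (\<Prod>k<r. v k))"

lemma gauss_density_rank_update:
  assumes "orthonormal_family d r D" "\<And>k. k < r \<Longrightarrow> v k \<noteq> 0"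
  shows "gauss_density d m (rank_update d r D (\<lambda>k. v k - 1)) = proj_gauss_density d r D m v"
proof
  fix x
  have inv: "the (mat_inverse (rank_update d r D (\<lambda>k. v k - 1))) = rank_update d r D (\<lambda>k. 1 / v k - 1)"
    by (rule the_mat_inverse_eqI[OF _ _ rank_update_inverse[OF assms]]) auto
  show "gauss_density d m (rank_update d r D (\<lambda>k. v k - 1)) x = proj_gauss_density d r D m v x"
    by (simp add: gauss_density_def proj_gauss_density_def inv quad_form_rank_update
        det_rank_update[OF assms(1)])
qed

text \<open>With unit variances the directions drop out, so the fallback to \<open>f\<close> in the
  singular case stays in the same family, whatever the random directions are.\<close>

lemma std_gauss_eq_proj_gauss_density:
  "std_gauss d = proj_gauss_density d r D (\<lambda>_. 0) (\<lambda>_. 1)"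
proof
  fix x
  have "std_gauss d x = (\<Prod>i<d. exp (- (x i)\<^sup>2 / 2) * (1 / sqrt (2 * pi)))"
    by (simp add: std_gauss_def std_normal_density_def mult.commute)
  also have "\<dots> = exp (\<Sum>i<d. - (x i)\<^sup>2 / 2) * (1 / sqrt (2 * pi)) ^ d"
    by (subst prod.distrib) (simp add: exp_sum)
  also have "(\<Sum>i<d. - (x i)\<^sup>2 / 2) = - dot d x x / 2"
    by (simp add: dot_def power2_eq_square sum_divide_distrib sum_negf)
  finally show "std_gauss d x = proj_gauss_density d r D (\<lambda>_. 0) (\<lambda>_. 1) x"
    by (simp add: proj_gauss_density_def power_one_over real_sqrt_mult real_sqrt_power power_mult_distrib)
qed

section \<open>Volume scaling and normalisation of the projected Gaussian density\<close>

lemma product_sigma_finite_lborel: "product_sigma_finite (\<lambda>_. lborel :: real measure)"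
  by (simp add: product_sigma_finite_def sigma_finite_lborel)

lemma space_Rd: "space (Rd d) = extensional {..<d}"
  by (simp add: Rd_def space_PiM PiE_UNIV_domain) (simp add: PiE_def)

lemma measurable_Rd_component [measurable]: "i < d \<Longrightarrow> (\<lambda>x. x i) \<in> borel_measurable (Rd d)"
  unfolding Rd_def by measurable

lemma measurable_RdI:
  assumes "\<And>i. i < d \<Longrightarrow> (\<lambda>w. f w i) \<in> borel_measurable N"
    and "\<And>w i. w \<in> space N \<Longrightarrow> \<not> i < d \<Longrightarrow> f w i = undefined"
  shows "f \<in> measurable N (Rd d)"
  unfolding Rd_def
  by (rule measurable_PiM_single') (use assms in \<open>auto simp: PiE_def extensional_def\<close>)

lemma measurable_dot [measurable]:
  assumes "\<And>i. i < d \<Longrightarrow> (\<lambda>w. f w i) \<in> borel_measurable N"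
    and "\<And>i. i < d \<Longrightarrow> (\<lambda>w. g w i) \<in> borel_measurable N"
  shows "(\<lambda>w. dot d (f w) (g w)) \<in> borel_measurable N"
  unfolding dot_def using assms by (intro borel_measurable_sum borel_measurable_times) auto

lemma sigma_finite_Rd: "sigma_finite_measure (Rd d)"
proof -
  interpret product_sigma_finite "\<lambda>_. lborel :: real measure" by (rule product_sigma_finite_lborel)
  show ?thesis unfolding Rd_def by (rule sigma_finite) simp
qed

text \<open>A change of variables whose Jacobian is the constant c in absolute value, recorded
  through its effect on nonnegative integrals, so that no matrix of the map is needed and factors
  simply multiply under composition.\<close>

definition scales_volume :: "nat \<Rightarrow> real \<Rightarrow> ((nat \<Rightarrow> real) \<Rightarrow> nat \<Rightarrow> real) \<Rightarrow> bool" where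
  "scales_volume d c T \<longleftrightarrow> T \<in> measurable (Rd d) (Rd d) \<and>
     (\<forall>F \<in> borel_measurable (Rd d). (\<integral>\<^sup>+x. F x \<partial>Rd d) = ennreal c * (\<integral>\<^sup>+x. F (T x) \<partial>Rd d))"

lemma scales_volume_measurable: "scales_volume d c T \<Longrightarrow> T \<in> measurable (Rd d) (Rd d)"
  by (simp add: scales_volume_def)

lemma nn_integral_scales_volume:
  "scales_volume d c T \<Longrightarrow> F \<in> borel_measurable (Rd d) \<Longrightarrow>
     (\<integral>\<^sup>+x. F x \<partial>Rd d) = ennreal c * (\<integral>\<^sup>+x. F (T x) \<partial>Rd d)"
  by (simp add: scales_volume_def)

lemma scales_volume_comp:
  assumes T: "scales_volume d b T" and U: "scales_volume d c U" and "0 \<le> b"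
  shows "scales_volume d (b * c) (\<lambda>x. T (U x))"
  unfolding scales_volume_def
proof (intro conjI ballI)
  have [measurable]: "T \<in> measurable (Rd d) (Rd d)" "U \<in> measurable (Rd d) (Rd d)"
    using T U by (auto simp: scales_volume_def)
  show "(\<lambda>x. T (U x)) \<in> measurable (Rd d) (Rd d)" by measurable
  fix F :: "_ \<Rightarrow> ennreal" assume [measurable]: "F \<in> borel_measurable (Rd d)"
  have "(\<integral>\<^sup>+x. F x \<partial>Rd d) = ennreal b * (\<integral>\<^sup>+x. F (T x) \<partial>Rd d)"
    by (rule nn_integral_scales_volume[OF T]) fact
  also have "(\<integral>\<^sup>+x. F (T x) \<partial>Rd d) = ennreal c * (\<integral>\<^sup>+x. F (T (U x)) \<partial>Rd d)"
    by (rule nn_integral_scales_volume[OF U]) measurable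
  finally show "(\<integral>\<^sup>+x. F x \<partial>Rd d) = ennreal (b * c) * (\<integral>\<^sup>+x. F (T (U x)) \<partial>Rd d)"
    using \<open>0 \<le> b\<close> by (simp add: ennreal_mult' mult.assoc)
qed

text \<open>Integrate over coordinate j first: with the other coordinates frozen, \<open>h x\<close>
  is a constant and the map is affine on the line with slope a.\<close>

lemma scales_volume_coordinate:
  assumes j: "j < d" and a: "a \<noteq> 0" and h: "h \<in> borel_measurable (Rd d)"
    and indep: "\<And>x y. h (x(j := y)) = h x"
  shows "scales_volume d \<bar>a\<bar> (\<lambda>x. x(j := h x + a * x j))"
  unfolding scales_volume_def
proof (intro conjI ballI)
  note [measurable] = h
  show meas[measurable]: "(\<lambda>x. x(j := h x + a * x j)) \<in> measurable (Rd d) (Rd d)"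
  proof (rule measurable_RdI)
    show "(\<lambda>x. (x(j := h x + a * x j)) i) \<in> borel_measurable (Rd d)" if "i < d" for i
      using that j by (cases "i = j") simp_all
  qed (use j in \<open>auto simp: space_Rd extensional_def\<close>)
  fix F :: "_ \<Rightarrow> ennreal" assume F[measurable]: "F \<in> borel_measurable (Rd d)"
  interpret product_sigma_finite "\<lambda>_. lborel :: real measure" by (rule product_sigma_finite_lborel)
  let ?J = "{..<d} - {j}"
  have I: "insert j ?J = {..<d}" using j by auto
  have Fub: "(\<integral>\<^sup>+x. F' x \<partial>Rd d) = (\<integral>\<^sup>+x. \<integral>\<^sup>+y. F' (x(j := y)) \<partial>lborel \<partial>Pi\<^sub>M ?J (\<lambda>_. lborel))"
    if "F' \<in> borel_measurable (Rd d)" for F' :: "_ \<Rightarrow> ennreal"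
    using product_nn_integral_insert[of ?J j F'] that I by (simp add: Rd_def)
  have upd: "(\<lambda>y. x(j := y)) \<in> measurable lborel (Rd d)" if "x \<in> space (Pi\<^sub>M ?J (\<lambda>_. lborel))" for x
    by (rule measurable_RdI) (use that j in \<open>auto simp: space_PiM PiE_def extensional_def\<close>)
  have "(\<integral>\<^sup>+x. F x \<partial>Rd d) = (\<integral>\<^sup>+x. \<integral>\<^sup>+y. F (x(j := y)) \<partial>lborel \<partial>Pi\<^sub>M ?J (\<lambda>_. lborel))"
    by (rule Fub) fact
  also have "\<dots> = (\<integral>\<^sup>+x. ennreal \<bar>a\<bar> * (\<integral>\<^sup>+y. F (x(j := h x + a * y)) \<partial>lborel) \<partial>Pi\<^sub>M ?J (\<lambda>_. lborel))"
  proof (rule nn_integral_cong)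
    fix x assume "x \<in> space (Pi\<^sub>M ?J (\<lambda>_. lborel :: real measure))"
    from measurable_compose[OF upd[OF this] F]
    show "(\<integral>\<^sup>+y. F (x(j := y)) \<partial>lborel) = ennreal \<bar>a\<bar> * (\<integral>\<^sup>+y. F (x(j := h x + a * y)) \<partial>lborel)"
      by (intro nn_integral_real_affine a) simp
  qed
  also have "\<dots> = ennreal \<bar>a\<bar> * (\<integral>\<^sup>+x. \<integral>\<^sup>+y. F (x(j := h x + a * y)) \<partial>lborel \<partial>Pi\<^sub>M ?J (\<lambda>_. lborel))"
  proof (rule nn_integral_cmult)
    have "(\<lambda>(x, y). x(j := y)) \<in> measurable (Pi\<^sub>M ?J (\<lambda>_. lborel) \<Otimes>\<^sub>M (lborel :: real measure)) (Rd d)"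
      using measurable_add_dim[of j ?J "\<lambda>_. lborel :: real measure"] unfolding I Rd_def by simp
    from measurable_compose[OF this, of "\<lambda>x. F (x(j := h x + a * x j))"]
    have [measurable]: "(\<lambda>(x, y). F (x(j := h x + a * y)))
        \<in> borel_measurable (Pi\<^sub>M ?J (\<lambda>_. lborel) \<Otimes>\<^sub>M (lborel :: real measure))"
      by (simp add: split_beta indep)
    show "(\<lambda>x. \<integral>\<^sup>+y. F (x(j := h x + a * y)) \<partial>lborel) \<in> borel_measurable (Pi\<^sub>M ?J (\<lambda>_. lborel))"
      by measurable
  qed
  also have "(\<integral>\<^sup>+x. \<integral>\<^sup>+y. F (x(j := h x + a * y)) \<partial>lborel \<partial>Pi\<^sub>M ?J (\<lambda>_. lborel))
      = (\<integral>\<^sup>+x. F (x(j := h x + a * x j)) \<partial>Rd d)"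
    by (subst Fub) (simp_all add: indep)
  finally show "(\<integral>\<^sup>+x. F x \<partial>Rd d) = ennreal \<bar>a\<bar> * (\<integral>\<^sup>+x. F (x(j := h x + a * x j)) \<partial>Rd d)" .
qed

text \<open>Coordinates are shifted one at a time. No \<open>h i\<close> depends on a coordinate in
  J, so earlier shifts do not disturb later ones. It covers shears along one coordinate as well as
  translations.\<close>

lemma scales_volume_shift:
  assumes "finite J" "J \<subseteq> {..<d}" and h: "\<And>i. i \<in> J \<Longrightarrow> h i \<in> borel_measurable (Rd d)"
    and indep: "\<And>i j x y. i \<in> J \<Longrightarrow> j \<in> J \<Longrightarrow> h i (x(j := y)) = h i x"
  shows "scales_volume d 1 (\<lambda>x i. if i \<in> J then x i + h i x else x i)"
  using assms
proof (induction J rule: finite_induct)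
  case empty
  then show ?case by (simp add: scales_volume_def)
next
  case (insert k J)
  have 1: "scales_volume d 1 (\<lambda>x i. if i \<in> J then x i + h i x else x i)"
    using insert by auto
  have 2: "scales_volume d \<bar>1\<bar> (\<lambda>x. x(k := h k x + 1 * x k))"
    using insert.prems(1) by (intro scales_volume_coordinate insert.prems) auto
  have eq: "(\<lambda>i. if i \<in> J then (x(k := h k x + 1 * x k)) i + h i (x(k := h k x + 1 * x k))
        else (x(k := h k x + 1 * x k)) i) = (\<lambda>i. if i \<in> insert k J then x i + h i x else x i)" for x
  proof
    have "h i (x(k := h k x + 1 * x k)) = h i x" if "i \<in> J" for i
      using that by (intro insert.prems(3)) auto
    then show "(if i \<in> J then (x(k := h k x + 1 * x k)) i + h i (x(k := h k x + 1 * x k))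
        else (x(k := h k x + 1 * x k)) i) = (if i \<in> insert k J then x i + h i x else x i)" for i
      using insert.hyps by (cases "i = k") auto
  qed
  show ?case using scales_volume_comp[OF 1 2] unfolding eq by simp
qed

(* With u j \<noteq> 0, the stretch along u is conjugate to the map x \<mapsto> x(j := ...) under P, which fixes
   the basis vectors other than the j-th and sends the j-th one to u; the factor of P cancels. *)
lemma scales_volume_stretch:
  assumes u: "dot d u u = 1" and s: "s > 0"
  shows "scales_volume d s (\<lambda>x i. if i < d then x i + (s - 1) * dot d x u * u i else x i)"
    (is "scales_volume d s ?S")
proof -
  obtain j where j: "j < d" "u j \<noteq> 0"
  proof (rule ccontr)
    assume "\<not> thesis"
    then have "u i = 0" if "i < d" for i using \<open>\<And>j. \<lbrakk>j < d; u j \<noteq> 0\<rbrakk> \<Longrightarrow> thesis\<close> that by blast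
    then have "dot d u u = 0" by (simp add: dot_def)
    with u show False by simp
  qed
  let ?J = "{..<d} - {j}"
  let ?P1 = "\<lambda>x i. if i \<in> ?J then x i + u i * x j else x i"
  let ?P2 = "\<lambda>x. x(j := 0 + u j * x j)"
  let ?P = "\<lambda>x. ?P2 (?P1 x)"
  define h where "h x = (s - 1) * (\<Sum>i\<in>?J. u i * x i)" for x
  let ?Q = "\<lambda>x. x(j := h x + s * x j)"
  have [measurable]: "h \<in> borel_measurable (Rd d)"
    unfolding h_def by (intro borel_measurable_times borel_measurable_sum) auto
  have P1: "scales_volume d 1 ?P1"
    using j by (intro scales_volume_shift) auto
  have P2: "scales_volume d \<bar>u j\<bar> ?P2"
    using j by (intro scales_volume_coordinate) auto
  have P: "scales_volume d (\<bar>u j\<bar> * 1) ?P"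
    by (rule scales_volume_comp[OF P2 P1]) simp
  have Q: "scales_volume d \<bar>s\<bar> ?Q"
    using j s by (intro scales_volume_coordinate) (auto simp: h_def)
  have PQ: "scales_volume d (\<bar>u j\<bar> * s) (\<lambda>x. ?P (?Q x))"
    using scales_volume_comp[OF P Q] s by simp
  have split: "(\<Sum>i<d. f i) = f j + (\<Sum>i\<in>?J. f i)" for f :: "nat \<Rightarrow> real"
    using j by (intro sum.remove) auto
  have SP: "?S (?P x) = ?P (?Q x)" for x
  proof -
    define y where "y = ?P x"
    have "dot d y u = u j * x j * u j + (\<Sum>i\<in>?J. (x i + u i * x j) * u i)"
      unfolding dot_def split by (simp add: y_def)
    also have "(\<Sum>i\<in>?J. (x i + u i * x j) * u i) = (\<Sum>i\<in>?J. u i * x i) + x j * (\<Sum>i\<in>?J. u i * u i)"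
      by (simp add: algebra_simps sum.distrib sum_distrib_left)
    also have "(\<Sum>i\<in>?J. u i * u i) = 1 - u j * u j"
      using u unfolding dot_def split by simp
    finally have "dot d y u = (\<Sum>i\<in>?J. u i * x i) + x j" by (simp add: algebra_simps)
    then have *: "(s - 1) * dot d y u = h x + s * x j - x j"
      by (simp add: h_def algebra_simps)
    have hP: "h x + s * x j = x j + (s - 1) * dot d y u" using * by simp
    show ?thesis
      unfolding y_def[symmetric] using j unfolding hP
      by (auto simp: fun_eq_iff y_def algebra_simps)
  qed
  have S[measurable]: "?S \<in> measurable (Rd d) (Rd d)"
    by (rule measurable_RdI) (auto simp: space_Rd extensional_def)
  show ?thesis unfolding scales_volume_def
  proof (intro conjI ballI S)
    fix F :: "_ \<Rightarrow> ennreal" assume [measurable]: "F \<in> borel_measurable (Rd d)"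
    have "(\<integral>\<^sup>+x. F x \<partial>Rd d) = ennreal (\<bar>u j\<bar> * s) * (\<integral>\<^sup>+x. F (?S (?P x)) \<partial>Rd d)"
      using PQ unfolding scales_volume_def SP by simp
    also have "\<dots> = ennreal s * (ennreal \<bar>u j\<bar> * (\<integral>\<^sup>+x. F (?S (?P x)) \<partial>Rd d))"
      using s by (simp add: ennreal_mult' mult_ac)
    \<comment> \<open>The scaling rule of \<open>?P\<close> read backwards, for the function F
      composed with \<open>?S\<close>; this removes the factor of \<open>?P\<close> without
      inverting it.\<close>
    also have "ennreal \<bar>u j\<bar> * (\<integral>\<^sup>+x. F (?S (?P x)) \<partial>Rd d) = (\<integral>\<^sup>+x. F (?S x) \<partial>Rd d)"
    proof -
      have "(\<lambda>x. F (?S x)) \<in> borel_measurable (Rd d)" by measurable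
      from nn_integral_scales_volume[OF P this] show ?thesis by simp
    qed
    finally show "(\<integral>\<^sup>+x. F x \<partial>Rd d) = ennreal s * (\<integral>\<^sup>+x. F (?S x) \<partial>Rd d)" .
  qed
qed

section \<open>Normalisation of the Gaussian densities\<close>

lemma std_gauss_nonneg: "0 \<le> std_gauss d x"
  by (simp add: std_gauss_def prod_nonneg)

lemma borel_measurable_std_gauss [measurable]: "std_gauss d \<in> borel_measurable (Rd d)"
  unfolding std_gauss_def by (intro borel_measurable_prod) auto

lemma nn_integral_std_gauss: "(\<integral>\<^sup>+x. ennreal (std_gauss d x) \<partial>Rd d) = 1"
proof -
  interpret product_sigma_finite "\<lambda>_. lborel :: real measure" by (rule product_sigma_finite_lborel)
  have "(\<integral>\<^sup>+x. ennreal (std_gauss d x) \<partial>Rd d)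
      = (\<integral>\<^sup>+x. (\<Prod>i\<in>{..<d}. ennreal (std_normal_density (x i))) \<partial>Rd d)"
    by (simp add: std_gauss_def prod_ennreal)
  also have "\<dots> = (\<Prod>i\<in>{..<d}. \<integral>\<^sup>+t. ennreal (std_normal_density t) \<partial>lborel)"
    unfolding Rd_def by (rule product_nn_integral_prod) auto
  also have "(\<integral>\<^sup>+t. ennreal (std_normal_density t) \<partial>lborel) = 1"
    using prob_space.emeasure_space_1[OF prob_space_normal_density[of 1 0]]
    by (simp add: emeasure_density)
  finally show ?thesis by simp
qed

lemma dot_cong: "(\<And>i. i < d \<Longrightarrow> x i = x' i) \<Longrightarrow> (\<And>i. i < d \<Longrightarrow> y i = y' i) \<Longrightarrow> dot d x y = dot d x' y'"
  by (simp add: dot_def)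

lemma dot_add_scale: "dot d (\<lambda>i. x i + c * u i) y = dot d x y + c * dot d u y"
  by (simp add: dot_def algebra_simps sum.distrib sum_distrib_left)

lemma proj_gauss_density_pos:
  assumes "\<And>k. k < r \<Longrightarrow> v k > 0"
  shows "proj_gauss_density d r D m v x > 0"
  using assms by (auto simp: proj_gauss_density_def intro!: divide_pos_pos mult_pos_pos prod_pos)

lemma borel_measurable_proj_gauss_density_comp [measurable]:
  assumes "\<And>i. i < d \<Longrightarrow> (\<lambda>w. m w i) \<in> borel_measurable N"
    and "\<And>i. i < d \<Longrightarrow> (\<lambda>w. x w i) \<in> borel_measurable N"
    and "\<And>k. k < r \<Longrightarrow> (\<lambda>w. v w k) \<in> borel_measurable N"
    and "\<And>k i. k < r \<Longrightarrow> i < d \<Longrightarrow> (\<lambda>w. D w k i) \<in> borel_measurable N"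
  shows "(\<lambda>w. proj_gauss_density d r (D w) (m w) (v w) (x w)) \<in> borel_measurable N"
proof -
  have 1: "(\<lambda>w. dot d (\<lambda>i. x w i - m w i) (\<lambda>i. x w i - m w i)) \<in> borel_measurable N"
    using assms by (intro measurable_dot borel_measurable_diff) auto
  have 2: "(\<lambda>w. \<Sum>k<r. (1 / v w k - 1) * (dot d (\<lambda>i. x w i - m w i) (D w k))\<^sup>2) \<in> borel_measurable N"
    using assms by (intro borel_measurable_sum borel_measurable_times borel_measurable_power measurable_dot
      borel_measurable_diff borel_measurable_divide) auto
  have 3: "(\<lambda>w. \<Prod>k<r. v w k) \<in> borel_measurable N"
    using assms by (intro borel_measurable_prod) auto
  show ?thesis unfolding proj_gauss_density_def using 1 2 3 by measurable
qed

lemma borel_measurable_proj_gauss_density [measurable]: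
  "proj_gauss_density d r D m v \<in> borel_measurable (Rd d)"
  by (rule borel_measurable_proj_gauss_density_comp) auto

text \<open>Directions are removed one at a time: the stretch by sqrt (v r) along \<open>D r\<close>
  carries the density with r + 1 directions to the one with r, and its volume factor accounts for
  the factor v r under the root. Without directions, the density is \<open>f\<close>.\<close>

lemma nn_integral_proj_gauss_density_0:
  assumes "orthonormal_family d r D" "\<And>k. k < r \<Longrightarrow> v k > 0"
  shows "(\<integral>\<^sup>+x. ennreal (proj_gauss_density d r D (\<lambda>_. 0) v x) \<partial>Rd d) = 1"
  using assms
proof (induction r)
  case 0
  have "proj_gauss_density d 0 D (\<lambda>_. 0) v = std_gauss d"
    by (subst std_gauss_eq_proj_gauss_density[of d 0 D]) (simp add: proj_gauss_density_def fun_eq_iff)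
  then show ?case by (simp add: nn_integral_std_gauss)
next
  case (Suc r)
  define s where "s = sqrt (v r)"
  have s: "s > 0" "s\<^sup>2 = v r" using Suc.prems(2)[of r] by (auto simp: s_def)
  let ?u = "D r"
  let ?S = "\<lambda>x i. if i < d then x i + (s - 1) * dot d x ?u * ?u i else x i"
  have on: "dot d (D k) (D l) = (if k = l then 1 else 0)" if "k < Suc r" "l < Suc r" for k l
    using Suc.prems(1) that by (auto simp: orthonormal_family_dot)
  have S: "scales_volume d s ?S"
    by (rule scales_volume_stretch) (use on s in auto)
  have dotS: "dot d (?S x) y = dot d x y + (s - 1) * dot d x ?u * dot d ?u y" for x y
  proof -
    have "dot d (?S x) y = dot d (\<lambda>i. x i + ((s - 1) * dot d x ?u) * ?u i) y"
      by (rule dot_cong) auto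
    then show ?thesis by (simp add: dot_add_scale)
  qed
  have uS: "dot d (?S x) ?u = s * dot d x ?u" for x
    unfolding dotS using on[of r r] by (simp add: algebra_simps)
  have kS: "dot d (?S x) (D k) = dot d x (D k)" if "k < r" for x k
    unfolding dotS using on[of r k] that by simp
  have SS: "dot d (?S x) (?S x) = dot d x x + (v r - 1) * (dot d x ?u)\<^sup>2" for x
  proof -
    have "dot d (?S x) (?S x) = dot d x (?S x) + (s - 1) * dot d x ?u * (s * dot d x ?u)"
      by (subst dotS) (simp only: dot_commute[of d ?u] uS)
    also have "dot d x (?S x) = dot d x x + (s - 1) * dot d x ?u * dot d x ?u"
      by (subst dot_commute, subst dotS) (simp add: dot_commute[of d ?u])
    finally show ?thesis by (simp add: s(2)[symmetric] power2_eq_square algebra_simps)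
  qed
  have dens: "proj_gauss_density d r D (\<lambda>_. 0) v x = s * proj_gauss_density d (Suc r) D (\<lambda>_. 0) v (?S x)" for x
  proof -
    have "dot d (?S x) (?S x) + (\<Sum>k<Suc r. (1 / v k - 1) * (dot d (?S x) (D k))\<^sup>2)
        = dot d x x + (v r - 1) * (dot d x ?u)\<^sup>2 + (\<Sum>k<r. (1 / v k - 1) * (dot d x (D k))\<^sup>2)
          + (1 / v r - 1) * (s * dot d x ?u)\<^sup>2"
      unfolding SS by (simp add: kS uS)
    \<comment> \<open>The stretch adds (v r - 1) times this square to the squared norm, and the last
      summand of the exponent takes exactly that away again.\<close>
    also have "(1 / v r - 1) * (s * dot d x ?u)\<^sup>2 = (1 - v r) * (dot d x ?u)\<^sup>2"
      using s Suc.prems(2)[of r] by (simp add: power_mult_distrib field_simps)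
    finally have *: "dot d (?S x) (?S x) + (\<Sum>k<Suc r. (1 / v k - 1) * (dot d (?S x) (D k))\<^sup>2)
        = dot d x x + (\<Sum>k<r. (1 / v k - 1) * (dot d x (D k))\<^sup>2)" by (simp add: algebra_simps)
    have "sqrt ((2 * pi) ^ d * (\<Prod>k<Suc r. v k)) = sqrt ((2 * pi) ^ d * (\<Prod>k<r. v k)) * s"
      by (simp add: s_def real_sqrt_mult)
    with * s(1) show ?thesis by (simp add: proj_gauss_density_def)
  qed
  have "(\<integral>\<^sup>+x. ennreal (proj_gauss_density d (Suc r) D (\<lambda>_. 0) v x) \<partial>Rd d)
     = ennreal s * (\<integral>\<^sup>+x. ennreal (proj_gauss_density d (Suc r) D (\<lambda>_. 0) v (?S x)) \<partial>Rd d)"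
    by (rule nn_integral_scales_volume[OF S]) measurable
  also have "\<dots> = (\<integral>\<^sup>+x. ennreal s * ennreal (proj_gauss_density d (Suc r) D (\<lambda>_. 0) v (?S x)) \<partial>Rd d)"
  proof (rule nn_integral_cmult[symmetric])
    have [measurable]: "?S \<in> measurable (Rd d) (Rd d)" by (rule scales_volume_measurable[OF S])
    show "(\<lambda>x. ennreal (proj_gauss_density d (Suc r) D (\<lambda>_. 0) v (?S x))) \<in> borel_measurable (Rd d)"
      by measurable
  qed
  also have "\<dots> = (\<integral>\<^sup>+x. ennreal (proj_gauss_density d r D (\<lambda>_. 0) v x) \<partial>Rd d)"
    using s(1) by (simp add: dens ennreal_mult')
  also have "\<dots> = 1" using Suc by (auto simp: orthonormal_family_dot)
  finally show ?case .
qed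

lemma nn_integral_proj_gauss_density:
  assumes "orthonormal_family d r D" "\<And>k. k < r \<Longrightarrow> v k > 0"
  shows "(\<integral>\<^sup>+x. ennreal (proj_gauss_density d r D m v x) \<partial>Rd d) = 1"
proof -
  let ?T = "\<lambda>x i. if i \<in> {..<d} then x i + m i else x i"
  have T: "scales_volume d 1 ?T" by (rule scales_volume_shift) auto
  have eq: "proj_gauss_density d r D m v (?T x) = proj_gauss_density d r D (\<lambda>_. 0) v x" for x
  proof -
    have "dot d (\<lambda>i. ?T x i - m i) y = dot d (\<lambda>i. x i - 0) y"
      "dot d y (\<lambda>i. ?T x i - m i) = dot d y (\<lambda>i. x i - 0)" for y
      by (intro dot_cong; simp)+
    then show ?thesis by (simp only: proj_gauss_density_def)
  qed
  have "(\<integral>\<^sup>+x. ennreal (proj_gauss_density d r D m v x) \<partial>Rd d)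
     = (\<integral>\<^sup>+x. ennreal (proj_gauss_density d r D m v (?T x)) \<partial>Rd d)"
    by (subst nn_integral_scales_volume[OF T]) simp_all
  then show ?thesis unfolding eq using nn_integral_proj_gauss_density_0[OF assms] by simp
qed

section \<open>Product measures and Gaussian moments\<close>

text \<open>Moves the density out of the product, so that a sampling law depending on a parameter
  becomes a parameter-dependent density over one fixed measure. It also identifies the standard
  Gaussian law with a product of one-dimensional ones.\<close>

lemma PiM_density:
  assumes "finite I" and M: "sigma_finite_measure M" and g [measurable]: "g \<in> borel_measurable M"
    and P: "prob_space (density M g)"
  shows "Pi\<^sub>M I (\<lambda>_. density M g) = density (Pi\<^sub>M I (\<lambda>_. M)) (\<lambda>x. \<Prod>i\<in>I. g (x i))"
proof -
  interpret M: product_sigma_finite "\<lambda>_. M" using M by (simp add: product_sigma_finite_def)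
  interpret P: prob_space "density M g" by fact
  interpret P: product_sigma_finite "\<lambda>_. density M g" by standard
  have [measurable]: "(\<lambda>x. \<Prod>i\<in>I. g (x i)) \<in> borel_measurable (Pi\<^sub>M I (\<lambda>_. M))"
    by (intro borel_measurable_prod_ennreal) measurable
  have "density (Pi\<^sub>M I (\<lambda>_. M)) (\<lambda>x. \<Prod>i\<in>I. g (x i)) = Pi\<^sub>M I (\<lambda>_. density M g)"
  proof (rule P.PiM_eqI)
    show "sets (density (Pi\<^sub>M I (\<lambda>_. M)) (\<lambda>x. \<Prod>i\<in>I. g (x i))) = sets (Pi\<^sub>M I (\<lambda>_. density M g))"
      by (simp cong: sets_PiM_cong)
    fix A assume "\<And>i. i \<in> I \<Longrightarrow> A i \<in> sets (density M g)"
    then have A [measurable]: "\<And>i. i \<in> I \<Longrightarrow> A i \<in> sets M" by simp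
    have "emeasure (density (Pi\<^sub>M I (\<lambda>_. M)) (\<lambda>x. \<Prod>i\<in>I. g (x i))) (Pi\<^sub>E I A)
      = (\<integral>\<^sup>+x. (\<Prod>i\<in>I. g (x i)) * indicator (Pi\<^sub>E I A) x \<partial>Pi\<^sub>M I (\<lambda>_. M))"
      using \<open>finite I\<close> by (intro emeasure_density sets_PiM_I_finite) auto
    also have "\<dots> = (\<integral>\<^sup>+x. (\<Prod>i\<in>I. g (x i) * indicator (A i) (x i)) \<partial>Pi\<^sub>M I (\<lambda>_. M))"
    proof (rule nn_integral_cong)
      fix x assume "x \<in> space (Pi\<^sub>M I (\<lambda>_. M))"
      then have "x \<in> extensional I" by (auto simp: space_PiM PiE_def)
      \<comment> \<open>The box indicator factorises only for extensional points, which is what the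
        preceding fact supplies.\<close>
      then have "(indicator (Pi\<^sub>E I A) x :: ennreal) = (\<Prod>i\<in>I. indicator (A i) (x i))"
        using \<open>finite I\<close> by (auto simp: indicator_def PiE_def Pi_iff prod_zero intro!: prod.neutral)
      then show "(\<Prod>i\<in>I. g (x i)) * indicator (Pi\<^sub>E I A) x = (\<Prod>i\<in>I. g (x i) * indicator (A i) (x i))"
        by (simp add: prod.distrib)
    qed
    also have "\<dots> = (\<Prod>i\<in>I. \<integral>\<^sup>+t. g t * indicator (A i) t \<partial>M)"
      by (rule M.product_nn_integral_prod) (use \<open>finite I\<close> in measurable)
    also have "\<dots> = (\<Prod>i\<in>I. emeasure (density M g) (A i))"
      by (intro prod.cong refl emeasure_density[symmetric]) auto
    finally show "emeasure (density (Pi\<^sub>M I (\<lambda>_. M)) (\<lambda>x. \<Prod>i\<in>I. g (x i))) (Pi\<^sub>E I A)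
       = (\<Prod>i\<in>I. emeasure (density M g) (A i))" .
  qed fact
  then show ?thesis by simp
qed

lemma integral_PiM_component:
  fixes g :: "'a \<Rightarrow> real"
  assumes "prob_space Q" "i \<in> I" "integrable Q g"
  shows "integrable (Pi\<^sub>M I (\<lambda>_. Q)) (\<lambda>y. g (y i))"
    and "(LINT y|Pi\<^sub>M I (\<lambda>_. Q). g (y i)) = (LINT t|Q. g t)"
proof -
  have *: "distr (Pi\<^sub>M I (\<lambda>_. Q)) Q (\<lambda>y. y i) = Q"
    using assms by (intro distr_PiM_component) auto
  have m: "(\<lambda>y. y i) \<in> measurable (Pi\<^sub>M I (\<lambda>_. Q)) Q" using assms by measurable
  show "integrable (Pi\<^sub>M I (\<lambda>_. Q)) (\<lambda>y. g (y i))"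
    using integrable_distr[OF m, of g] assms by (simp add: *)
  show "(LINT y|Pi\<^sub>M I (\<lambda>_. Q). g (y i)) = (LINT t|Q. g t)"
    using integral_distr[OF m, of g] assms by (simp add: *)
qed

lemma integral_PiM_two_components:
  fixes g h :: "'a \<Rightarrow> real"
  assumes Q: "prob_space Q" and I: "finite I" "i \<in> I" "j \<in> I" "i \<noteq> j" and "integrable Q g" "integrable Q h"
  shows "integrable (Pi\<^sub>M I (\<lambda>_. Q)) (\<lambda>y. g (y i) * h (y j))"
    and "(LINT y|Pi\<^sub>M I (\<lambda>_. Q). g (y i) * h (y j)) = (LINT t|Q. g t) * (LINT t|Q. h t)"
proof -
  interpret Q: prob_space Q by fact
  interpret product_sigma_finite "\<lambda>_. Q" by standard
  let ?f = "\<lambda>k t. if k = i then g t else if k = j then h t else 1"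
  have split: "(\<Prod>k\<in>I. c k) = c i * (c j * (\<Prod>k\<in>I - {i} - {j}. c k))" for c :: "'b \<Rightarrow> real"
    using I by (simp add: prod.remove)
  have int: "integrable Q (?f k)" for k using assms by (cases "k = i"; cases "k = j"; simp)
  have eq: "(\<lambda>y. \<Prod>k\<in>I. ?f k (y k)) = (\<lambda>y. g (y i) * h (y j))"
    using I by (auto simp: split fun_eq_iff intro!: prod.neutral)
  show "integrable (Pi\<^sub>M I (\<lambda>_. Q)) (\<lambda>y. g (y i) * h (y j))"
    using product_integrable_prod[OF I(1), of ?f] int unfolding eq by simp
  have "(LINT y|Pi\<^sub>M I (\<lambda>_. Q). g (y i) * h (y j)) = (\<Prod>k\<in>I. LINT t|Q. ?f k t)"
    using product_integral_prod[OF I(1), of ?f] int unfolding eq by simp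
  also have "\<dots> = (LINT t|Q. g t) * (LINT t|Q. h t)"
    using I by (simp add: split Q.prob_space)
  finally show "(LINT y|Pi\<^sub>M I (\<lambda>_. Q). g (y i) * h (y j)) = (LINT t|Q. g t) * (LINT t|Q. h t)" .
qed

text \<open>Phrased with orthogonality rather than independence, so that it serves both the
  coordinates of a product measure and random variables on an arbitrary probability space.\<close>

lemma (in prob_space) second_moment_uncorrelated_sum:
  fixes X :: "nat \<Rightarrow> 'a \<Rightarrow> real"
  assumes int: "\<And>i j. i < n \<Longrightarrow> j < n \<Longrightarrow> integrable M (\<lambda>w. X i w * X j w)"
    and orth: "\<And>i j. i < n \<Longrightarrow> j < n \<Longrightarrow> i \<noteq> j \<Longrightarrow> (LINT w|M. X i w * X j w) = 0"
    and bound: "\<And>i. i < n \<Longrightarrow> (LINT w|M. X i w * X i w) \<le> C"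
  shows "integrable M (\<lambda>w. (\<Sum>i<n. X i w)\<^sup>2)"
    and "(LINT w|M. (\<Sum>i<n. X i w)\<^sup>2) \<le> real n * C"
proof -
  have eq: "(\<lambda>w. (\<Sum>i<n. X i w)\<^sup>2) = (\<lambda>w. \<Sum>i<n. \<Sum>j<n. X i w * X j w)"
    by (simp add: power2_eq_square sum_product)
  show "integrable M (\<lambda>w. (\<Sum>i<n. X i w)\<^sup>2)"
    unfolding eq using int by (intro Bochner_Integration.integrable_sum) auto
  have "(LINT w|M. (\<Sum>i<n. X i w)\<^sup>2) = (\<Sum>i<n. \<Sum>j<n. LINT w|M. X i w * X j w)"
    unfolding eq using int by (subst Bochner_Integration.integral_sum; (intro Bochner_Integration.integrable_sum)?; simp)
  also have "\<dots> = (\<Sum>i<n. \<Sum>j<n. if i = j then LINT w|M. X i w * X i w else 0)"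
    using orth by (intro sum.cong refl) auto
  also have "\<dots> = (\<Sum>i<n. LINT w|M. X i w * X i w)" by simp
  also have "\<dots> \<le> real n * C" using sum_bounded_above[of "{..<n}" _ C] bound by simp
  finally show "(LINT w|M. (\<Sum>i<n. X i w)\<^sup>2) \<le> real n * C" .
qed

section \<open>Moments of the standard Gaussian law along a direction\<close>

abbreviation std_gauss_measure :: "nat \<Rightarrow> (nat \<Rightarrow> real) measure" where
  "std_gauss_measure d \<equiv> density (Rd d) (\<lambda>x. ennreal (std_gauss d x))"

lemma std_gauss_measure_eq_PiM: "std_gauss_measure d = Pi\<^sub>M {..<d} (\<lambda>_. std_normal_distribution)"
  by (subst PiM_density)
     (auto simp: Rd_def std_gauss_def prod_ennreal sigma_finite_lborel prob_space_normal_density)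

lemma prob_space_std_gauss_measure: "prob_space (std_gauss_measure d)"
  by (rule prob_spaceI) (simp add: emeasure_density nn_integral_std_gauss)

lemma prob_space_std_normal: "prob_space std_normal_distribution"
  by (simp add: prob_space_normal_density)

lemma std_gauss_moments:
  assumes i: "i < d" and j: "j < d"
  shows "integrable (std_gauss_measure d) (\<lambda>x. x i)" "(LINT x|std_gauss_measure d. x i) = 0"
    and "integrable (std_gauss_measure d) (\<lambda>x. x i * x j)"
    and "(LINT x|std_gauss_measure d. x i * x j) = (if i = j then 1 else 0)"
proof -
  have int: "integrable std_normal_distribution (\<lambda>t. t)" "integrable std_normal_distribution (\<lambda>t. t * t)"
    using integrable_std_normal_distribution_moment[of 1] integrable_std_normal_distribution_moment[of 2]
    by (simp_all add: power2_eq_square)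
  have vals: "(LINT t|std_normal_distribution. t) = 0" "(LINT t|std_normal_distribution. t * t) = 1"
    using integral_std_normal_distribution_moment_odd[of 1] std_normal_distribution_even_moments(1)[of 1]
    by (simp_all add: power2_eq_square fact_numeral)
  show "integrable (std_gauss_measure d) (\<lambda>x. x i)" "(LINT x|std_gauss_measure d. x i) = 0"
    unfolding std_gauss_measure_eq_PiM
    using integral_PiM_component[OF prob_space_std_normal, of i "{..<d}" "\<lambda>t. t"] i int vals by simp_all
  show "integrable (std_gauss_measure d) (\<lambda>x. x i * x j)"
    unfolding std_gauss_measure_eq_PiM
    using integral_PiM_component[OF prob_space_std_normal, of i "{..<d}" "\<lambda>t. t * t"]
      integral_PiM_two_components[OF prob_space_std_normal, of "{..<d}" i j "\<lambda>t. t" "\<lambda>t. t"]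
      i j int vals by (cases "i = j") simp_all
  show "(LINT x|std_gauss_measure d. x i * x j) = (if i = j then 1 else 0)"
    unfolding std_gauss_measure_eq_PiM
    using integral_PiM_component[OF prob_space_std_normal, of i "{..<d}" "\<lambda>t. t * t"]
      integral_PiM_two_components[OF prob_space_std_normal, of "{..<d}" i j "\<lambda>t. t" "\<lambda>t. t"]
      i j int vals by (cases "i = j") simp_all
qed

lemma dot_square: "(dot d x u)\<^sup>2 = (\<Sum>i<d. \<Sum>j<d. u i * u j * (x i * x j))"
  by (simp add: dot_def power2_eq_square sum_product mult_ac)

lemma std_gauss_linear:
  "integrable (std_gauss_measure d) (\<lambda>x. dot d x u)" "(LINT x|std_gauss_measure d. dot d x u) = 0"
proof -
  have int: "integrable (std_gauss_measure d) (\<lambda>x. x i * u i)" if "i < d" for i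
    using that std_gauss_moments(1)[of i d] by simp
  show "integrable (std_gauss_measure d) (\<lambda>x. dot d x u)"
    unfolding dot_def using int by (intro Bochner_Integration.integrable_sum) auto
  show "(LINT x|std_gauss_measure d. dot d x u) = 0"
    unfolding dot_def using int
    by (subst Bochner_Integration.integral_sum) (auto simp: std_gauss_moments(2) intro!: sum.neutral)
qed

lemma std_gauss_square:
  "integrable (std_gauss_measure d) (\<lambda>x. (dot d x u)\<^sup>2)"
  "(LINT x|std_gauss_measure d. (dot d x u)\<^sup>2) = dot d u u"
proof -
  have int: "integrable (std_gauss_measure d) (\<lambda>x. u i * u j * (x i * x j))" if "i < d" "j < d" for i j
    using that std_gauss_moments(3)[of i d j] by simp
  show "integrable (std_gauss_measure d) (\<lambda>x. (dot d x u)\<^sup>2)"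
    unfolding dot_square using int by (intro Bochner_Integration.integrable_sum) auto
  have "(LINT x|std_gauss_measure d. (dot d x u)\<^sup>2)
      = (\<Sum>i<d. \<Sum>j<d. LINT x|std_gauss_measure d. u i * u j * (x i * x j))"
    unfolding dot_square using int
    by (subst Bochner_Integration.integral_sum; (intro Bochner_Integration.integrable_sum)?; simp)
  also have "\<dots> = (\<Sum>i<d. \<Sum>j<d. if i = j then u i * u i else 0)"
    by (intro sum.cong refl) (auto simp: std_gauss_moments(4))
  also have "\<dots> = dot d u u" by (simp add: dot_def)
  finally show "(LINT x|std_gauss_measure d. (dot d x u)\<^sup>2) = dot d u u" .
qed

lemma nn_integral_std_normal_exp:
  "(\<integral>\<^sup>+t. ennreal (exp (a * t)) \<partial>std_normal_distribution) = ennreal (exp (a\<^sup>2 / 2))"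
proof -
  have "std_normal_density t * exp (a * t) = exp (a\<^sup>2 / 2) * normal_density a 1 t" for t
  proof -
    have "- t\<^sup>2 / 2 + a * t = a\<^sup>2 / 2 + (- (t - a)\<^sup>2 / 2)" by (simp add: power2_eq_square field_simps)
    then have "exp (- t\<^sup>2 / 2) * exp (a * t) = exp (a\<^sup>2 / 2) * exp (- (t - a)\<^sup>2 / 2)"
      by (simp only: exp_add[symmetric])
    then show ?thesis by (simp add: normal_density_def)
  qed
  then have "(\<integral>\<^sup>+t. ennreal (exp (a * t)) \<partial>std_normal_distribution)
     = (\<integral>\<^sup>+t. ennreal (exp (a\<^sup>2 / 2)) * ennreal (normal_density a 1 t) \<partial>lborel)"
    by (simp add: nn_integral_density ennreal_mult'[symmetric])
  also have "\<dots> = ennreal (exp (a\<^sup>2 / 2)) * (\<integral>\<^sup>+t. ennreal (normal_density a 1 t) \<partial>lborel)"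
    by (rule nn_integral_cmult) simp
  also have "(\<integral>\<^sup>+t. ennreal (normal_density a 1 t) \<partial>lborel) = 1"
    using prob_space.emeasure_space_1[OF prob_space_normal_density[of 1 a]] by (simp add: emeasure_density)
  finally show ?thesis by simp
qed

lemma nn_integral_std_gauss_exp:
  "(\<integral>\<^sup>+x. ennreal (exp (dot d a x)) \<partial>std_gauss_measure d) = ennreal (exp (dot d a a / 2))"
proof -
  interpret N: prob_space std_normal_distribution by (rule prob_space_std_normal)
  interpret product_sigma_finite "\<lambda>_. std_normal_distribution" by standard
  have "(\<integral>\<^sup>+x. ennreal (exp (dot d a x)) \<partial>std_gauss_measure d)
      = (\<integral>\<^sup>+x. (\<Prod>i\<in>{..<d}. ennreal (exp (a i * x i))) \<partial>Pi\<^sub>M {..<d} (\<lambda>_. std_normal_distribution))"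
    unfolding std_gauss_measure_eq_PiM by (simp add: dot_def exp_sum prod_ennreal)
  also have "\<dots> = (\<Prod>i\<in>{..<d}. \<integral>\<^sup>+t. ennreal (exp (a i * t)) \<partial>std_normal_distribution)"
    by (rule product_nn_integral_prod) auto
  also have "\<dots> = ennreal (exp (dot d a a / 2))"
    by (simp add: nn_integral_std_normal_exp prod_ennreal exp_sum[symmetric] dot_def sum_divide_distrib power2_eq_square)
  finally show ?thesis .
qed

text \<open>Raise t / 4 <= exp (t / 4) to the fourth power; 256 is 4^4, and the two exponentials
  cover the two signs of t.\<close>

lemma power4_le_exp: "t ^ 4 \<le> 256 * (exp t + exp (- t))" for t :: real
proof -
  have *: "t ^ 4 \<le> 256 * exp t" if "t \<ge> 0" for t :: real
  proof -
    have "t / 4 \<le> exp (t / 4)" using exp_ge_add_one_self[of "t / 4"] by linarith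
    then have "(t / 4) ^ 4 \<le> exp (t / 4) ^ 4" using that by (intro power_mono) auto
    also have "exp (t / 4) ^ 4 = exp t" by (simp flip: exp_of_nat_mult)
    finally show ?thesis by (simp add: power_divide)
  qed
  show ?thesis
  proof (cases "t \<ge> 0")
    case True
    then show ?thesis using *[of t] by (simp add: add_increasing2)
  next
    case False
    then show ?thesis using *[of "- t"] exp_gt_zero[of t] by (simp add: distrib_left add_increasing)
  qed
qed

text \<open>Domination by exponentials reduces the fourth moment to the moment generating function,
  which factorises over the coordinates. The bound 256 * 2 * exp (1 / 2) is crude but does not
  depend on the dimension.\<close>

lemma std_gauss_fourth_moment:
  assumes u: "dot d u u = 1"
  shows "integrable (std_gauss_measure d) (\<lambda>x. (dot d x u) ^ 4)"
    and "(LINT x|std_gauss_measure d. (dot d x u) ^ 4) \<le> 512 * exp (1 / 2)"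
proof -
  let ?G = "std_gauss_measure d"
  have exps: "integrable ?G (\<lambda>x. exp (dot d a x))" "(LINT x|?G. exp (dot d a x)) = exp (dot d a a / 2)" for a
  proof -
    have "has_bochner_integral ?G (\<lambda>x. exp (dot d a x)) (exp (dot d a a / 2))"
      by (rule has_bochner_integral_nn_integral) (auto simp: nn_integral_std_gauss_exp)
    then show "integrable ?G (\<lambda>x. exp (dot d a x))" "(LINT x|?G. exp (dot d a x)) = exp (dot d a a / 2)"
      by (auto simp: has_bochner_integral_iff)
  qed
  let ?E = "\<lambda>x. 256 * (exp (dot d u x) + exp (dot d (\<lambda>i. - u i) x))"
  have neg: "dot d (\<lambda>i. - u i) x = - dot d u x" for x by (simp add: dot_def sum_negf)
  have intE: "integrable ?G ?E" using exps(1)[of u] exps(1)[of "\<lambda>i. - u i"] by simp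
  have le: "(dot d x u) ^ 4 \<le> ?E x" for x
    using power4_le_exp[of "dot d u x"] by (simp add: neg dot_commute[of d x])
  show int: "integrable ?G (\<lambda>x. (dot d x u) ^ 4)"
    by (rule Bochner_Integration.integrable_bound[OF intE]) (use le in \<open>auto intro!: AE_I2\<close>)
  have "(LINT x|?G. (dot d x u) ^ 4) \<le> (LINT x|?G. ?E x)"
    by (rule integral_mono[OF int intE]) (rule le)
  also have "\<dots> = 512 * exp (1 / 2)"
    using exps[of u] exps[of "\<lambda>i. - u i"] u by (simp add: neg dot_def sum_negf)
  finally show "(LINT x|?G. (dot d x u) ^ 4) \<le> 512 * exp (1 / 2)" .
qed

section \<open>The Gaussian law conditioned on a set\<close>

definition cond_law :: "nat \<Rightarrow> (nat \<Rightarrow> real) set \<Rightarrow> (nat \<Rightarrow> real) measure" where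
  "cond_law d A = density (Rd d) (\<lambda>x. ennreal (f_cond d A x))"

text \<open>The logarithm of f / g for g = \<open>proj_gauss_density\<close>. The squared norm of x
  has cancelled, which leaves a linear term and r squares, so all integrals of it are finite sums of
  second moments.\<close>

definition log_lik_ratio ::
    "nat \<Rightarrow> nat \<Rightarrow> (nat \<Rightarrow> nat \<Rightarrow> real) \<Rightarrow> (nat \<Rightarrow> real) \<Rightarrow> (nat \<Rightarrow> real) \<Rightarrow> (nat \<Rightarrow> real) \<Rightarrow> real" where
  "log_lik_ratio d r D m v x =
     ((\<Sum>k<r. ln (v k)) - 2 * dot d x m + dot d m m
       + (\<Sum>k<r. (1 / v k - 1) * (dot d x (D k) - dot d m (D k))\<^sup>2)) / 2"

lemma dot_diff_left: "dot d (\<lambda>i. x i - m i) y = dot d x y - dot d m y"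
  by (simp add: dot_def algebra_simps sum_subtractf)

lemma dot_diff_self: "dot d (\<lambda>i. x i - m i) (\<lambda>i. x i - m i) = dot d x x - 2 * dot d x m + dot d m m"
  by (simp add: dot_def algebra_simps sum_subtractf sum.distrib sum_distrib_left)

lemma dot_self_nonneg: "0 \<le> dot d x x"
  by (simp add: dot_def sum_nonneg)

lemma std_gauss_eq_exp_mult_proj:
  assumes "\<And>k. k < r \<Longrightarrow> v k > 0"
  shows "std_gauss d x = exp (log_lik_ratio d r D m v x) * proj_gauss_density d r D m v x"
proof -
  let ?c = "sqrt ((2 * pi) ^ d)"
  let ?q = "\<Sum>k<r. (1 / v k - 1) * (dot d x (D k) - dot d m (D k))\<^sup>2"
  have sv: "sqrt (\<Prod>k<r. v k) = exp ((\<Sum>k<r. ln (v k)) / 2)"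
  proof -
    have "(\<Prod>k<r. v k) = exp (\<Sum>k<r. ln (v k))"
      using assms by (simp add: exp_sum)
    also have "\<dots> = (exp ((\<Sum>k<r. ln (v k)) / 2))\<^sup>2"
      by (simp flip: exp_double)
    finally show ?thesis by (simp add: real_sqrt_unique)
  qed
  have std: "std_gauss d x = exp (- dot d x x / 2) / ?c"
    by (subst std_gauss_eq_proj_gauss_density[of d 0 D]) (simp add: proj_gauss_density_def)
  have "proj_gauss_density d r D m v x = exp (- (dot d x x - 2 * dot d x m + dot d m m + ?q) / 2) / (?c * sqrt (\<Prod>k<r. v k))"
    unfolding proj_gauss_density_def dot_diff_self dot_diff_left by (simp add: real_sqrt_mult)
  also have "\<dots> = exp (- (dot d x x - 2 * dot d x m + dot d m m + ?q) / 2 - (\<Sum>k<r. ln (v k)) / 2) / ?c"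
    unfolding sv by (simp add: exp_diff)
  finally have "exp (log_lik_ratio d r D m v x) * proj_gauss_density d r D m v x
    = exp (log_lik_ratio d r D m v x + (- (dot d x x - 2 * dot d x m + dot d m m + ?q) / 2 - (\<Sum>k<r. ln (v k)) / 2)) / ?c"
    by (simp add: exp_add)
  also have "log_lik_ratio d r D m v x + (- (dot d x x - 2 * dot d x m + dot d m m + ?q) / 2 - (\<Sum>k<r. ln (v k)) / 2)
    = - dot d x x / 2" by (simp add: log_lik_ratio_def field_simps)
  finally show ?thesis using std by simp
qed

lemma borel_measurable_log_lik_ratio [measurable]: "log_lik_ratio d r D m v \<in> borel_measurable (Rd d)"
  unfolding log_lik_ratio_def by (measurable; simp)

lemma integrable_std_gauss: "integrable (Rd d) (std_gauss d)"
  by (rule integrableI_nonneg) (auto simp: std_gauss_nonneg nn_integral_std_gauss)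

lemma integral_proj_gauss_density:
  assumes "orthonormal_family d r D" "\<And>k. k < r \<Longrightarrow> v k > 0"
  shows "integrable (Rd d) (proj_gauss_density d r D m v)"
    and "(LINT x|Rd d. proj_gauss_density d r D m v x) = 1"
proof -
  have "has_bochner_integral (Rd d) (proj_gauss_density d r D m v) 1"
    by (rule has_bochner_integral_nn_integral)
      (use assms in \<open>auto simp: nn_integral_proj_gauss_density intro!: less_imp_le proj_gauss_density_pos\<close>)
  then show "integrable (Rd d) (proj_gauss_density d r D m v)"
    "(LINT x|Rd d. proj_gauss_density d r D m v x) = 1" by (auto simp: has_bochner_integral_iff)
qed

locale conditioned_gauss =
  fixes d :: nat and A :: "(nat \<Rightarrow> real) set"
  assumes A [measurable]: "A \<in> sets (Rd d)" and p_pos: "p_f d A > 0"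
begin

abbreviation "p \<equiv> p_f d A"
abbreviation "\<mu> \<equiv> mean_A d A"

lemma f_cond_nonneg: "0 \<le> f_cond d A x"
  using p_pos by (simp add: f_cond_def std_gauss_nonneg)

lemma borel_measurable_f_cond [measurable]: "f_cond d A \<in> borel_measurable (Rd d)"
  unfolding f_cond_def by measurable

lemma integrable_f_cond: "integrable (Rd d) (f_cond d A)"
  unfolding f_cond_def
  using integrable_real_mult_indicator[OF A integrable_std_gauss] by simp

lemma integral_f_cond: "(LINT x|Rd d. f_cond d A x) = 1"
proof -
  have "p = (LINT x|Rd d. std_gauss d x * indicator A x)"
    by (simp add: p_f_def set_lebesgue_integral_def mult.commute)
  then show ?thesis unfolding f_cond_def using p_pos by simp
qed

lemma prob_space_cond_law: "prob_space (cond_law d A)"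
proof (rule prob_spaceI)
  have "(\<integral>\<^sup>+x. ennreal (f_cond d A x) \<partial>Rd d) = ennreal (LINT x|Rd d. f_cond d A x)"
    by (rule nn_integral_eq_integral) (auto simp: integrable_f_cond f_cond_nonneg)
  then show "emeasure (cond_law d A) (space (cond_law d A)) = 1"
    by (simp add: cond_law_def emeasure_density integral_f_cond)
qed

lemma sets_cond_law [measurable_cong]: "sets (cond_law d A) = sets (Rd d)"
  by (simp add: cond_law_def)

lemma integral_cond_law:
  fixes h :: "(nat \<Rightarrow> real) \<Rightarrow> real"
  assumes "h \<in> borel_measurable (Rd d)"
  shows "(LINT x|cond_law d A. h x) = (LINT x|Rd d. f_cond d A x * h x)"
  unfolding cond_law_def by (rule integral_real_density) (use assms f_cond_nonneg in auto)

lemma integrable_cond_law_iff: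
  fixes h :: "(nat \<Rightarrow> real) \<Rightarrow> real"
  assumes "h \<in> borel_measurable (Rd d)"
  shows "integrable (cond_law d A) h \<longleftrightarrow> integrable (Rd d) (\<lambda>x. f_cond d A x * h x)"
  unfolding cond_law_def by (rule integrable_real_density) (use assms f_cond_nonneg in auto)

lemma integrable_cond_law:
  fixes h :: "(nat \<Rightarrow> real) \<Rightarrow> real"
  assumes h: "integrable (std_gauss_measure d) h"
  shows "integrable (cond_law d A) h"
proof -
  have m [measurable]: "h \<in> borel_measurable (Rd d)" using borel_measurable_integrable[OF h] by simp
  have "integrable (Rd d) (\<lambda>x. std_gauss d x * h x)"
    using h by (subst (asm) integrable_real_density) (auto simp: std_gauss_nonneg)
  from integrable_real_mult_indicator[OF A this]
  have "integrable (Rd d) (\<lambda>x. std_gauss d x * h x * indicator A x / p)" by simp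
  then show ?thesis by (subst integrable_cond_law_iff) (auto simp: f_cond_def mult_ac)
qed

text \<open>Pointwise, the conditioned density is at most f / p: conditioning costs a factor 1 / p
  on nonnegative integrands.\<close>

lemma integral_cond_law_le:
  fixes h :: "(nat \<Rightarrow> real) \<Rightarrow> real"
  assumes h: "integrable (std_gauss_measure d) h" and nonneg: "\<And>x. 0 \<le> h x"
  shows "(LINT x|cond_law d A. h x) \<le> (LINT x|std_gauss_measure d. h x) / p"
proof -
  have m [measurable]: "h \<in> borel_measurable (Rd d)" using borel_measurable_integrable[OF h] by simp
  have int: "integrable (Rd d) (\<lambda>x. std_gauss d x * h x)"
    using h by (subst (asm) integrable_real_density) (auto simp: std_gauss_nonneg)
  have "(LINT x|cond_law d A. h x) = (LINT x|Rd d. f_cond d A x * h x)"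
    by (rule integral_cond_law) fact
  also have "\<dots> \<le> (LINT x|Rd d. std_gauss d x * h x / p)"
  proof (rule integral_mono)
    show "integrable (Rd d) (\<lambda>x. f_cond d A x * h x)"
      using integrable_cond_law[OF h] by (simp add: integrable_cond_law_iff)
    show "f_cond d A x * h x \<le> std_gauss d x * h x / p" for x
      using p_pos nonneg[of x] std_gauss_nonneg[of d x]
      by (auto simp: f_cond_def indicator_def divide_simps)
  qed (use int in simp)
  also have "\<dots> = (LINT x|std_gauss_measure d. h x) / p"
    by (subst integral_real_density) (auto simp: std_gauss_nonneg)
  finally show ?thesis .
qed

lemma integrable_cond_dot: "integrable (cond_law d A) (\<lambda>x. dot d x u)"
  by (intro integrable_cond_law std_gauss_linear)

lemma integrable_cond_coordinates:
  assumes "i < d" "j < d"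
  shows "integrable (cond_law d A) (\<lambda>x. x i)" "integrable (cond_law d A) (\<lambda>x. x i * x j)"
  using assms std_gauss_moments by (auto intro!: integrable_cond_law)

lemma mean_A_eq: "i < d \<Longrightarrow> \<mu> i = (LINT x|cond_law d A. x i)"
  by (subst integral_cond_law) (auto simp: mean_A_def mult.commute)

lemma integral_cond_dot: "(LINT x|cond_law d A. dot d x u) = dot d \<mu> u"
proof -
  have int: "integrable (cond_law d A) (\<lambda>x. x i * u i)" if "i < d" for i
    using integrable_cond_coordinates(1)[OF that that] by simp
  show ?thesis unfolding dot_def using int
    by (subst Bochner_Integration.integral_sum) (auto simp: mean_A_eq)
qed

lemma integrable_cond_dot_square: "integrable (cond_law d A) (\<lambda>x. (dot d x u - c)\<^sup>2)"
proof -
  interpret prob_space "cond_law d A" by (rule prob_space_cond_law)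
  have "(\<lambda>x. (dot d x u - c)\<^sup>2) = (\<lambda>x. (dot d x u)\<^sup>2 - 2 * c * dot d x u + c\<^sup>2)"
    by (simp add: power2_eq_square algebra_simps)
  then show ?thesis using integrable_cond_law[OF std_gauss_square(1)[of d u]] integrable_cond_dot[of u] by simp
qed

lemma quad_form_cov_A:
  "quad_form d (cov_A d A) u = (LINT x|cond_law d A. (dot d x u - dot d \<mu> u)\<^sup>2)"
proof -
  interpret prob_space "cond_law d A" by (rule prob_space_cond_law)
  have int: "integrable (cond_law d A) (\<lambda>x. (x i - \<mu> i) * (x j - \<mu> j))" if "i < d" "j < d" for i j
    using integrable_cond_coordinates(1)[OF that] integrable_cond_coordinates(1)[OF that(2,1)]
      integrable_cond_coordinates(2)[OF that]
    by (simp add: algebra_simps)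
  have "quad_form d (cov_A d A) u = (\<Sum>i<d. \<Sum>j<d. u i * cov_A d A $$ (i, j) * u j)"
    by (rule quad_form_eq_sum) (simp add: cov_A_def)
  also have "\<dots> = (\<Sum>i<d. \<Sum>j<d. LINT x|cond_law d A. u i * u j * ((x i - \<mu> i) * (x j - \<mu> j)))"
    by (intro sum.cong refl) (simp add: cov_A_def integral_cond_law mult_ac)
  also have "\<dots> = (LINT x|cond_law d A. (\<Sum>i<d. \<Sum>j<d. u i * u j * ((x i - \<mu> i) * (x j - \<mu> j))))"
    using int by (subst Bochner_Integration.integral_sum; (intro Bochner_Integration.integrable_sum)?; simp)
  also have "\<dots> = (LINT x|cond_law d A. (dot d x u - dot d \<mu> u)\<^sup>2)"
    unfolding dot_diff_left[symmetric] dot_square by simp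
  finally show ?thesis .
qed

(* Jensen's inequality for the density of the projected Gaussian relative to f:
   p exp (E_A log (g / f)) is at most the integral of g. *)
lemma ln_p_le_integral_log_lik_ratio:
  assumes on: "orthonormal_family d r D" and v: "\<And>k. k < r \<Longrightarrow> v k > 0"
  shows "integrable (cond_law d A) (log_lik_ratio d r D m v)"
    and "ln p \<le> (LINT x|cond_law d A. log_lik_ratio d r D m v x)"
proof -
  interpret prob_space "cond_law d A" by (rule prob_space_cond_law)
  let ?L = "log_lik_ratio d r D m v" and ?g = "proj_gauss_density d r D m v"
  show intL: "integrable (cond_law d A) ?L"
    unfolding log_lik_ratio_def
    using integrable_cond_dot integrable_cond_dot_square
    by (intro integrable_divide Bochner_Integration.integrable_add Bochner_Integration.integrable_diff
        Bochner_Integration.integrable_sum integrable_mult_right integrable_const) auto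
  define c where "c = (LINT x|cond_law d A. ?L x)"
  \<comment> \<open>The tangent to t -> exp (- t) at the mean c, evaluated at \<open>?L x\<close>.
    It lies below the exponential, and its conditional mean is exp (- c).\<close>
  let ?h = "\<lambda>x. exp (- c) * (1 + c - ?L x)"
  have intg: "integrable (Rd d) ?g" "(LINT x|Rd d. ?g x) = 1"
    using integral_proj_gauss_density[of d r D v] on v by auto
  have inth: "integrable (cond_law d A) ?h" using intL by simp
  have meash: "?h \<in> borel_measurable (Rd d)" by measurable
  have "exp (- c) = (LINT x|cond_law d A. ?h x)"
    using intL by (simp add: c_def[symmetric] prob_space)
  also have "\<dots> = (LINT x|Rd d. f_cond d A x * ?h x)"
    by (rule integral_cond_law[OF meash])
  also have "\<dots> \<le> (LINT x|Rd d. ?g x / p)"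
  proof (rule integral_mono)
    show "integrable (Rd d) (\<lambda>x. f_cond d A x * ?h x)"
      using inth integrable_cond_law_iff[OF meash] by simp
    show "integrable (Rd d) (\<lambda>x. ?g x / p)" using intg by simp
    fix x
    have g: "?g x > 0" using v by (rule proj_gauss_density_pos)
    show "f_cond d A x * ?h x \<le> ?g x / p"
    proof (cases "x \<in> A")
      case True
      have "1 + (c - ?L x) \<le> exp (c - ?L x)" by (rule exp_ge_add_one_self)
      then have "exp (- c) * (1 + (c - ?L x)) \<le> exp (- c) * exp (c - ?L x)"
        by (intro mult_left_mono) auto
      also have "\<dots> = exp (- ?L x)" by (simp flip: exp_add)
      finally have le: "?h x \<le> exp (- ?L x)" by (simp add: algebra_simps)
      have "std_gauss d x * ?h x \<le> std_gauss d x * exp (- ?L x)"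
        by (rule mult_left_mono[OF le std_gauss_nonneg])
      also have "\<dots> = ?g x"
        by (subst std_gauss_eq_exp_mult_proj[where r=r and D=D and v=v and m=m])
           (use v in \<open>auto simp: exp_minus\<close>)
      finally show ?thesis using True p_pos by (simp add: f_cond_def divide_right_mono)
    next
      case False
      then show ?thesis using g p_pos by (simp add: f_cond_def)
    qed
  qed
  also have "\<dots> = 1 / p" using intg by simp
  finally have "ln (exp (- c)) \<le> ln (1 / p)" using p_pos by (intro ln_mono) auto
  then show "ln p \<le> (LINT x|cond_law d A. ?L x)" using p_pos by (simp add: ln_div c_def)
qed

text \<open>The Gaussian is centred at the true mean while its variances \<open>v k\<close> stay
  free. This freedom is exploited twice: a very small variance rules out degenerate directions, and
  the true variances give the entropy bound.\<close>

lemma cond_moments_inequality: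
  assumes on: "orthonormal_family d r D" and v: "\<And>k. k < r \<Longrightarrow> v k > 0"
  shows "dot d \<mu> \<mu> - (\<Sum>k<r. ln (v k)) - (\<Sum>k<r. (1 / v k - 1) * quad_form d (cov_A d A) (D k))
    \<le> - 2 * ln p"
proof -
  interpret prob_space "cond_law d A" by (rule prob_space_cond_law)
  have int2: "integrable (cond_law d A) (\<lambda>x. (1 / v k - 1) * (dot d x (D k) - dot d \<mu> (D k))\<^sup>2)" for k
    using integrable_cond_dot_square by simp
  have "(LINT x|cond_law d A. log_lik_ratio d r D \<mu> v x)
    = ((\<Sum>k<r. ln (v k)) - 2 * dot d \<mu> \<mu> + dot d \<mu> \<mu>
        + (\<Sum>k<r. (1 / v k - 1) * quad_form d (cov_A d A) (D k))) / 2"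
    unfolding log_lik_ratio_def quad_form_cov_A
    using integrable_cond_dot[of \<mu>] int2
    by (simp add: integral_cond_dot prob_space Bochner_Integration.integral_sum
        Bochner_Integration.integrable_sum Bochner_Integration.integral_add
        Bochner_Integration.integral_diff)
  then show ?thesis using ln_p_le_integral_log_lik_ratio(2)[of r D v \<mu>] on v by simp
qed

lemma cond_variance_pos:
  assumes u: "dot d u u = 1"
  shows "quad_form d (cov_A d A) u > 0"
proof -
  have "quad_form d (cov_A d A) u \<ge> 0" unfolding quad_form_cov_A by simp
  moreover have "quad_form d (cov_A d A) u \<noteq> 0"
  proof
    assume 0: "quad_form d (cov_A d A) u = 0"
    have "orthonormal_family d 1 (\<lambda>_. u)" using u by (simp add: orthonormal_family_dot)
    \<comment> \<open>With zero variance the inequality reads |mu|^2 - ln v <= - 2 ln p for every v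
      > 0; this v makes the left side exceed the right one by at least 1.\<close>
    from cond_moments_inequality[OF this, of "\<lambda>_. exp (2 * ln p - 1)"] 0 dot_self_nonneg[of d \<mu>]
    show False by simp
  qed
  ultimately show ?thesis by simp
qed

text \<open>The choice of \<open>v k\<close> as the true variance maximises the left side of the
  previous inequality. What results is twice the relative entropy of the projected Gaussian with
  respect to \<open>f\<close>, against twice that of the conditioned law.\<close>

lemma cond_moments_entropy_bound:
  assumes on: "orthonormal_family d r D"
  shows "dot d \<mu> \<mu> + (\<Sum>k<r. quad_form d (cov_A d A) (D k) - 1 - ln (quad_form d (cov_A d A) (D k)))
    \<le> - 2 * ln p"
proof -
  let ?V = "\<lambda>k. quad_form d (cov_A d A) (D k)"
  have pos: "?V k > 0" if "k < r" for k
    using on that by (intro cond_variance_pos) (auto simp: orthonormal_family_dot)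
  have "(\<Sum>k<r. (1 / ?V k - 1) * ?V k) = (\<Sum>k<r. 1 - ?V k)"
  proof (rule sum.cong)
    fix k assume "k \<in> {..<r}"
    then show "(1 / ?V k - 1) * ?V k = 1 - ?V k" using pos[of k] by (simp add: field_simps)
  qed simp
  then show ?thesis using cond_moments_inequality[OF on, of ?V] pos
    by (simp add: sum_subtractf)
qed

lemma cond_fourth_moment:
  assumes u: "dot d u u = 1"
  shows "integrable (cond_law d A) (\<lambda>x. (dot d x u) ^ 4)"
    and "(LINT x|cond_law d A. (dot d x u) ^ 4) \<le> 512 * exp (1 / 2) / p"
proof -
  show "integrable (cond_law d A) (\<lambda>x. (dot d x u) ^ 4)"
    by (intro integrable_cond_law std_gauss_fourth_moment u)
  have "(LINT x|cond_law d A. (dot d x u) ^ 4) \<le> (LINT x|std_gauss_measure d. (dot d x u) ^ 4) / p"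
    by (intro integral_cond_law_le std_gauss_fourth_moment u) simp
  also have "\<dots> \<le> 512 * exp (1 / 2) / p"
    using std_gauss_fourth_moment(2)[OF u] p_pos by (intro divide_right_mono) auto
  finally show "(LINT x|cond_law d A. (dot d x u) ^ 4) \<le> 512 * exp (1 / 2) / p" .
qed

end

section \<open>Relative entropy and tails of the likelihood ratio\<close>

text \<open>The function x - 1 - ln x grows only linearly, so no multiple of (x - 1)^2 lies below it
  everywhere; the square of sqrt x - 1 does. Apply ln y <= y - 1 at y = sqrt x.\<close>

lemma sqrt_minus_one_square_le:
  fixes x :: real
  assumes "x > 0"
  shows "(sqrt x - 1)\<^sup>2 \<le> x - 1 - ln x"
proof -
  have "ln x = 2 * ln (sqrt x)" using assms by (simp add: ln_sqrt)
  also have "\<dots> \<le> 2 * (sqrt x - 1)" using ln_le_minus_one[of "sqrt x"] assms by simp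
  finally show ?thesis using assms by (simp add: power2_diff)
qed

text \<open>All summands are nonnegative, so each is at most C. Then sqrt (V k) - 1 <= sqrt C, and
  (V k - 1)^2 = (sqrt (V k) + 1)^2 (sqrt (V k) - 1)^2 costs at most the factor (2 + sqrt C)^2 over
  the summand.\<close>

lemma entropy_bound_imp_parameter_bounds:
  fixes V :: "nat \<Rightarrow> real"
  assumes pos: "\<And>k. k < r \<Longrightarrow> V k > 0" and S: "S \<ge> 0"
    and le: "S + (\<Sum>k<r. V k - 1 - ln (V k)) \<le> C"
  shows "S \<le> C" "\<And>k. k < r \<Longrightarrow> exp (- (C + 1)) \<le> V k" "(\<Sum>k<r. (V k - 1)\<^sup>2) \<le> (2 + sqrt C)\<^sup>2 * C"
proof -
  let ?\<psi> = "\<lambda>k. V k - 1 - ln (V k)"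
  have nonneg: "?\<psi> k \<ge> 0" if "k < r" for k using ln_le_minus_one[OF pos[OF that]] by simp
  then have sum_nonneg: "(\<Sum>k<r. ?\<psi> k) \<ge> 0" by (intro sum_nonneg) auto
  then show "S \<le> C" using le by simp
  then have C: "C \<ge> 0" using S by simp
  have single: "?\<psi> k \<le> C" if "k < r" for k
  proof -
    have "?\<psi> k \<le> (\<Sum>k<r. ?\<psi> k)" using that nonneg by (intro member_le_sum) auto
    then show ?thesis using le S by simp
  qed
  show "exp (- (C + 1)) \<le> V k" if "k < r" for k
  proof -
    \<comment> \<open>Dropping the positive term \<open>V k\<close> from the summand leaves - 1 - ln
      (V k) <= C.\<close>
    have "- (C + 1) \<le> ln (V k)" using single[OF that] pos[OF that] by simp
    then show ?thesis using pos[OF that] by (metis exp_le_cancel_iff exp_ln)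
  qed
  have "(V k - 1)\<^sup>2 \<le> (2 + sqrt C)\<^sup>2 * ?\<psi> k" if "k < r" for k
  proof -
    let ?s = "sqrt (V k)"
    have s: "?s > 0" "?s * ?s = V k" using pos[OF that] by auto
    have le\<psi>: "(?s - 1)\<^sup>2 \<le> ?\<psi> k" by (rule sqrt_minus_one_square_le[OF pos[OF that]])
    then have "(?s - 1)\<^sup>2 \<le> C" using single[OF that] by simp
    then have "?s - 1 \<le> sqrt C" by (rule real_le_rsqrt)
    then have "(?s + 1)\<^sup>2 \<le> (2 + sqrt C)\<^sup>2" using s by (intro power_mono) auto
    then have "(?s + 1)\<^sup>2 * (?s - 1)\<^sup>2 \<le> (2 + sqrt C)\<^sup>2 * ?\<psi> k"
      using le\<psi> by (intro mult_mono) auto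
    moreover have "(?s + 1)\<^sup>2 * (?s - 1)\<^sup>2 = (V k - 1)\<^sup>2"
      unfolding power_mult_distrib[symmetric] using s by (simp add: algebra_simps)
    ultimately show ?thesis by simp
  qed
  then have "(\<Sum>k<r. (V k - 1)\<^sup>2) \<le> (\<Sum>k<r. (2 + sqrt C)\<^sup>2 * ?\<psi> k)" by (intro sum_mono) auto
  also have "\<dots> = (2 + sqrt C)\<^sup>2 * (\<Sum>k<r. ?\<psi> k)" by (rule sum_distrib_left[symmetric])
  also have "\<dots> \<le> (2 + sqrt C)\<^sup>2 * C" using le S by (intro mult_left_mono) auto
  finally show "(\<Sum>k<r. (V k - 1)\<^sup>2) \<le> (2 + sqrt C)\<^sup>2 * C" .
qed

section \<open>Relative entropy of the standard Gaussian with respect to the projected one\<close>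

lemma dot_sum_right: "dot d x (\<lambda>i. \<Sum>k<r. c k * D k i) = (\<Sum>k<r. c k * dot d x (D k))"
proof -
  have "dot d x (\<lambda>i. \<Sum>k<r. c k * D k i) = (\<Sum>i<d. \<Sum>k<r. c k * (x i * D k i))"
    by (simp add: dot_def sum_distrib_left mult_ac)
  also have "\<dots> = (\<Sum>k<r. \<Sum>i<d. c k * (x i * D k i))" by (rule sum.swap)
  finally show ?thesis by (simp add: dot_def sum_distrib_left)
qed

text \<open>Controls sums over all directions by a norm without a factor r. This serves for the mean
  and later for the error of the empirical mean.\<close>

lemma bessel_inequality:
  assumes "orthonormal_family d r D"
  shows "(\<Sum>k<r. (dot d m (D k))\<^sup>2) \<le> dot d m m"
proof -
  let ?c = "\<lambda>k. dot d m (D k)"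
  let ?q = "\<lambda>i. \<Sum>k<r. ?c k * D k i"
  have mq: "dot d m ?q = (\<Sum>k<r. (?c k)\<^sup>2)"
    by (simp add: dot_sum_right power2_eq_square)
  have "dot d ?q (D l) = ?c l" if "l < r" for l
  proof -
    have "dot d ?q (D l) = (\<Sum>k<r. ?c k * dot d (D l) (D k))"
      by (subst dot_commute) (rule dot_sum_right)
    also have "\<dots> = (\<Sum>k<r. if k = l then ?c k else 0)"
      using assms that by (intro sum.cong refl) (auto simp: orthonormal_family_dot)
    finally show ?thesis using that by simp
  qed
  then have "dot d ?q ?q = (\<Sum>k<r. (?c k)\<^sup>2)"
    by (subst dot_sum_right) (simp add: power2_eq_square)
  with mq dot_self_nonneg[of d "\<lambda>i. m i - ?q i"] show ?thesis
    unfolding dot_diff_self by simp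
qed

text \<open>This integral is the relative entropy of \<open>f\<close> with respect to g. The linear
  term integrates to zero, and a unit direction has mean 0 and variance 1 under
  \<open>f\<close>.\<close>

lemma integral_std_gauss_log_lik_ratio:
  assumes on: "orthonormal_family d r D"
  shows "integrable (std_gauss_measure d) (log_lik_ratio d r D m v)"
    and "(LINT x|std_gauss_measure d. log_lik_ratio d r D m v x)
      = ((\<Sum>k<r. ln (v k)) + dot d m m + (\<Sum>k<r. (1 / v k - 1) * (1 + (dot d m (D k))\<^sup>2))) / 2"
proof -
  interpret prob_space "std_gauss_measure d" by (rule prob_space_std_gauss_measure)
  have one: "measure (std_gauss_measure d) (space (Rd d)) = 1" using prob_space by simp
  have sq: "(\<lambda>x. (dot d x u - c)\<^sup>2) = (\<lambda>x. (dot d x u)\<^sup>2 - 2 * c * dot d x u + c\<^sup>2)" for u c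
    by (simp add: power2_eq_square algebra_simps)
  have int: "integrable (std_gauss_measure d) (\<lambda>x. (dot d x u - c)\<^sup>2)" for u c
    unfolding sq using std_gauss_square(1)[of d u] std_gauss_linear(1)[of d u] by simp
  have val: "(LINT x|std_gauss_measure d. (dot d x (D k) - c)\<^sup>2) = 1 + c\<^sup>2" if "k < r" for k c
    unfolding sq using std_gauss_square[of d "D k"] std_gauss_linear[of d "D k"] on that
    by (simp add: one orthonormal_family_dot)
  show "integrable (std_gauss_measure d) (log_lik_ratio d r D m v)"
    unfolding log_lik_ratio_def using int std_gauss_linear(1)
    by (intro integrable_divide Bochner_Integration.integrable_add Bochner_Integration.integrable_diff
        Bochner_Integration.integrable_sum integrable_mult_right integrable_const) auto
  have int2: "integrable (std_gauss_measure d) (\<lambda>x. (1 / v k - 1) * (dot d x (D k) - dot d m (D k))\<^sup>2)" for k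
    using int by simp
  have "(LINT x|std_gauss_measure d. log_lik_ratio d r D m v x)
      = ((\<Sum>k<r. ln (v k)) + dot d m m
        + (\<Sum>k<r. (1 / v k - 1) * (LINT x|std_gauss_measure d. (dot d x (D k) - dot d m (D k))\<^sup>2))) / 2"
    unfolding log_lik_ratio_def
    using std_gauss_linear[of d m] int2
    by (simp add: one Bochner_Integration.integral_sum
        Bochner_Integration.integrable_sum Bochner_Integration.integral_add
        Bochner_Integration.integral_diff)
  then show "(LINT x|std_gauss_measure d. log_lik_ratio d r D m v x)
      = ((\<Sum>k<r. ln (v k)) + dot d m m + (\<Sum>k<r. (1 / v k - 1) * (1 + (dot d m (D k))\<^sup>2))) / 2"
    by (simp add: val)
qed

text \<open>Since ln v <= v - 1, the first-order terms cancel: ln v + 1 / v - 1 <= (v - 1)^2 / v <=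
  (v - 1)^2 / a. The squares coming from the mean are weighted by at most 1 / a and summed by
  Bessel's inequality.\<close>

lemma relative_entropy_bound:
  assumes on: "orthonormal_family d r D" and a: "a > 0" and v: "\<And>k. k < r \<Longrightarrow> a \<le> v k"
    and vB: "(\<Sum>k<r. (v k - 1)\<^sup>2) \<le> B" and mB: "dot d m m \<le> B"
  shows "(LINT x|std_gauss_measure d. log_lik_ratio d r D m v x) \<le> B / a + B / 2"
proof -
  have "(\<Sum>k<r. ln (v k)) + (\<Sum>k<r. (1 / v k - 1) * (1 + (dot d m (D k))\<^sup>2))
    = (\<Sum>k<r. ln (v k) + (1 / v k - 1) + (1 / v k - 1) * (dot d m (D k))\<^sup>2)"
    unfolding sum.distrib[symmetric] by (intro sum.cong refl) (simp add: algebra_simps)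
  also have "\<dots> \<le> (\<Sum>k<r. (v k - 1)\<^sup>2 / a + (dot d m (D k))\<^sup>2 / a)"
  proof (rule sum_mono)
    fix k assume "k \<in> {..<r}"
    then have vk: "a \<le> v k" "v k > 0" using v[of k] a by auto
    have "ln (v k) + (1 / v k - 1) \<le> (v k - 1) + (1 / v k - 1)"
      using ln_le_minus_one[OF vk(2)] by simp
    also have "\<dots> = (v k - 1)\<^sup>2 / v k" using vk by (simp add: field_simps power2_eq_square)
    also have "\<dots> \<le> (v k - 1)\<^sup>2 / a" using vk a by (intro divide_left_mono) auto
    finally have 1: "ln (v k) + (1 / v k - 1) \<le> (v k - 1)\<^sup>2 / a" .
    have "1 / v k \<le> 1 / a" using vk a by (intro divide_left_mono) auto
    then have "(1 / v k - 1) * (dot d m (D k))\<^sup>2 \<le> 1 / a * (dot d m (D k))\<^sup>2"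
      by (intro mult_right_mono) auto
    with 1 show "ln (v k) + (1 / v k - 1) + (1 / v k - 1) * (dot d m (D k))\<^sup>2
      \<le> (v k - 1)\<^sup>2 / a + (dot d m (D k))\<^sup>2 / a" by simp
  qed
  also have "\<dots> = (\<Sum>k<r. (v k - 1)\<^sup>2) / a + (\<Sum>k<r. (dot d m (D k))\<^sup>2) / a"
    by (simp add: sum.distrib sum_divide_distrib)
  also have "\<dots> \<le> B / a + B / a"
    using vB bessel_inequality[OF on, of m] mB a by (intro add_mono divide_right_mono) auto
  finally have le: "(\<Sum>k<r. ln (v k)) + (\<Sum>k<r. (1 / v k - 1) * (1 + (dot d m (D k))\<^sup>2)) \<le> B / a + B / a" .
  have aux: "x + y \<le> b + b \<Longrightarrow> z \<le> c \<Longrightarrow> (x + z + y) / 2 \<le> b + c / 2" for x y z b c :: real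
    by simp
  show ?thesis unfolding integral_std_gauss_log_lik_ratio(2)[OF on] by (rule aux[OF le mB])
qed

text \<open>Markov's inequality for L + exp (- L), which is at least 1 everywhere and at least ln K
  on the tail. Under \<open>f\<close> the mean of exp (- L) is the total mass of g, hence the
  summand 1.\<close>

lemma log_lik_ratio_tail:
  assumes on: "orthonormal_family d r D" and v: "\<And>k. k < r \<Longrightarrow> v k > 0" and K: "K > 1"
    and C: "(LINT x|std_gauss_measure d. log_lik_ratio d r D m v x) \<le> C"
  shows "measure (std_gauss_measure d) {x \<in> space (Rd d). exp (log_lik_ratio d r D m v x) > K} \<le> (C + 1) / ln K"
proof -
  let ?G = "std_gauss_measure d" and ?L = "log_lik_ratio d r D m v"
  interpret prob_space ?G by (rule prob_space_std_gauss_measure)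
  let ?E = "{x \<in> space (Rd d). exp (?L x) > K}"
  have E [measurable]: "?E \<in> sets (Rd d)" by measurable
  have intL: "integrable ?G ?L" by (rule integral_std_gauss_log_lik_ratio[OF on])
  have eq: "std_gauss d x * exp (- ?L x) = proj_gauss_density d r D m v x" for x
    by (subst std_gauss_eq_exp_mult_proj[where r=r and D=D and v=v and m=m])
       (use v in \<open>auto simp: exp_minus\<close>)
  have inte: "integrable ?G (\<lambda>x. exp (- ?L x))"
    by (subst integrable_real_density)
       (use integral_proj_gauss_density(1)[OF on v] in \<open>auto simp: std_gauss_nonneg eq\<close>)
  have vale: "(LINT x|?G. exp (- ?L x)) = 1"
    by (subst integral_real_density)
       (use integral_proj_gauss_density(2)[OF on v] in \<open>auto simp: std_gauss_nonneg eq\<close>)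
  have "ln K * measure ?G ?E = (LINT x|?G. ln K * indicator ?E x)" by simp
  also have "\<dots> \<le> (LINT x|?G. ?L x + exp (- ?L x))"
  proof (rule integral_mono)
    show "ln K * indicator ?E x \<le> ?L x + exp (- ?L x)" for x
    proof (cases "x \<in> ?E")
      case True
      then have "ln K \<le> ln (exp (?L x))" using K by (intro ln_mono) auto
      then have "ln K \<le> ?L x + exp (- ?L x)" by (intro add_increasing2) auto
      then show ?thesis using True by simp
    next
      case False
      then show ?thesis using exp_ge_add_one_self[of "- ?L x"] by simp
    qed
    have "integrable ?G (indicator ?E :: _ \<Rightarrow> real)"
      by (rule integrable_real_indicator) (use E in \<open>auto simp: less_top[symmetric]\<close>)
    then show "integrable ?G (\<lambda>x. ln K * indicator ?E x)" by (rule integrable_mult_right)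
    show "integrable ?G (\<lambda>x. ?L x + exp (- ?L x))"
      by (rule Bochner_Integration.integrable_add[OF intL inte])
  qed
  also have "\<dots> = (LINT x|?G. ?L x) + (LINT x|?G. exp (- ?L x))"
    by (rule Bochner_Integration.integral_add[OF intL inte])
  also have "\<dots> \<le> C + 1" using C vale by linarith
  finally have "measure ?G ?E * ln K \<le> C + 1" by (simp only: mult.commute)
  then show ?thesis using K by (subst pos_le_divide_eq) auto
qed

text \<open>The truncated part has variance at most K, because its square is at most K l and l has
  mean at most 1. The rest contributes at most \<open>\<delta>\<close> through the sample and
  \<open>\<delta>\<close> through its mean. The set B is free so that both the event A and the whole
  space can be inserted.\<close>

lemma (in prob_space) truncated_weak_law:
  fixes l :: "'a \<Rightarrow> real"
  assumes l [measurable]: "l \<in> borel_measurable M" and nonneg: "\<And>x. 0 \<le> l x"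
    and int: "integrable M l" and one: "(LINT x|M. l x) \<le> 1"
    and B [measurable]: "B \<in> sets M" and n: "n > 0" and K: "K > 0" and \<eta>: "\<eta> > 0"
    and tail: "(LINT x|M. l x * indicator {x. l x > K} x) \<le> \<delta>"
  shows "integrable (Pi\<^sub>M {..<n} (\<lambda>_. M))
      (\<lambda>y. \<bar>(\<Sum>i<n. l (y i) * indicator B (y i)) / real n - (LINT x|M. l x * indicator B x)\<bar>)"
    and "(LINT y|Pi\<^sub>M {..<n} (\<lambda>_. M).
      \<bar>(\<Sum>i<n. l (y i) * indicator B (y i)) / real n - (LINT x|M. l x * indicator B x)\<bar>)
    \<le> 2 * \<delta> + \<eta> + K / (real n * \<eta>)"
proof -
  let ?P = "Pi\<^sub>M {..<n} (\<lambda>_. M)"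
  interpret P: prob_space ?P by (rule prob_space_PiM) (rule prob_space_axioms)
  have comp: "integrable ?P (\<lambda>y. g (y i))" "(LINT y|?P. g (y i)) = (LINT t|M. g t)"
    if "i < n" "integrable M g" for i and g :: "'a \<Rightarrow> real"
    using integral_PiM_component[OF prob_space_axioms, of i "{..<n}" g] that by auto
  define g1 where "g1 x = l x * indicator B x * indicator {x. l x \<le> K} x" for x
  define g2 where "g2 x = l x * indicator B x * indicator {x. l x > K} x" for x
  have [measurable]: "g1 \<in> borel_measurable M" "g2 \<in> borel_measurable M"
    unfolding g1_def g2_def by measurable
  have split: "l x * indicator B x = g1 x + g2 x" for x
    by (auto simp: g1_def g2_def indicator_def)
  have g1: "0 \<le> g1 x" "g1 x \<le> l x" "g1 x \<le> K" "g1 x * g1 x \<le> K * l x" for x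
    using nonneg[of x] K by (auto simp: g1_def indicator_def intro!: mult_right_mono)
  have g2: "0 \<le> g2 x" "g2 x \<le> l x * indicator {x. l x > K} x" "g2 x \<le> l x" for x
    using nonneg[of x] by (auto simp: g2_def indicator_def)
  have int1: "integrable M g1" and int2: "integrable M g2"
    by (rule Bochner_Integration.integrable_bound[OF int]; use g1 g2 nonneg in \<open>auto intro!: AE_I2\<close>)+
  have intsq: "integrable M (\<lambda>x. g1 x * g1 x)"
    by (rule Bochner_Integration.integrable_bound[OF integrable_mult_right[OF int, of K]])
       (use g1(4) nonneg K in \<open>auto intro!: AE_I2\<close>)
  have inttail: "integrable M (\<lambda>x. l x * indicator {x. l x > K} x)"
    by (rule Bochner_Integration.integrable_bound[OF int])
       (use nonneg in \<open>auto intro!: AE_I2 simp: indicator_def\<close>)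
  define e1 where "e1 = (LINT x|M. g1 x)"
  define e2 where "e2 = (LINT x|M. g2 x)"
  have e: "(LINT x|M. l x * indicator B x) = e1 + e2"
    unfolding split e1_def e2_def using int1 int2 by simp
  have e2: "0 \<le> e2" "e2 \<le> \<delta>"
  proof -
    show "0 \<le> e2" unfolding e2_def using g2 by simp
    have "e2 \<le> (LINT x|M. l x * indicator {x. l x > K} x)"
      unfolding e2_def by (rule integral_mono[OF int2 inttail]) (rule g2)
    then show "e2 \<le> \<delta>" using tail by simp
  qed
  let ?Z = "\<lambda>i y. g1 (y i) - e1"
  let ?z = "\<lambda>t. g1 t - e1"
  have intz: "integrable M ?z" "(LINT t|M. ?z t) = 0" using int1 by (auto simp: e1_def prob_space)
  have zz: "(\<lambda>t. ?z t * ?z t) = (\<lambda>t. g1 t * g1 t - 2 * e1 * g1 t + e1 * e1)"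
    by (simp add: algebra_simps)
  have intzz: "integrable M (\<lambda>t. ?z t * ?z t)" unfolding zz using intsq int1 by simp
  have "(LINT t|M. ?z t * ?z t) = (LINT t|M. g1 t * g1 t) - e1 * e1"
    unfolding zz using intsq int1 by (simp add: e1_def[symmetric] prob_space)
  also have "\<dots> \<le> (LINT t|M. g1 t * g1 t)" by simp
  also have "\<dots> \<le> (LINT t|M. K * l t)"
    by (rule integral_mono[OF intsq]) (use int g1 in auto)
  also have "\<dots> \<le> K" using one K int by (simp add: mult_left_le)
  finally have varz: "(LINT t|M. ?z t * ?z t) \<le> K" .
  have intZZ: "integrable ?P (\<lambda>y. ?Z i y * ?Z j y)" if "i < n" "j < n" for i j
  proof (cases "i = j")
    case True
    then show ?thesis using comp(1)[OF that(1) intzz] by simp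
  next
    case False
    then show ?thesis
      using integral_PiM_two_components(1)[OF prob_space_axioms _ _ _ False intz(1) intz(1), of "{..<n}"] that
      by simp
  qed
  have orth: "(LINT y|?P. ?Z i y * ?Z j y) = 0" if "i < n" "j < n" "i \<noteq> j" for i j
    using integral_PiM_two_components(2)[OF prob_space_axioms _ _ _ that(3) intz(1) intz(1), of "{..<n}"] that intz(2)
    by simp
  have bnd: "(LINT y|?P. ?Z i y * ?Z i y) \<le> K" if "i < n" for i
    using comp(2)[OF that intzz] varz by simp
  note sm = P.second_moment_uncorrelated_sum[of n ?Z, OF intZZ orth bnd]
  let ?R = "\<lambda>y. \<eta> + (\<Sum>i<n. ?Z i y)\<^sup>2 / ((real n)\<^sup>2 * \<eta>) + (\<Sum>i<n. g2 (y i)) / real n + e2"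
  let ?F = "\<lambda>y. \<bar>(\<Sum>i<n. l (y i) * indicator B (y i)) / real n - (e1 + e2)\<bar>"
  \<comment> \<open>Replaces the passage from second to first moment by a bound linear in the
    square, with \<open>\<eta>\<close> left to be optimised.\<close>
  have young: "\<bar>t\<bar> \<le> \<eta> + t\<^sup>2 / \<eta>" for t
  proof -
    have "0 \<le> (\<bar>t\<bar> - \<eta>)\<^sup>2 + \<eta> * \<bar>t\<bar>" using \<eta> by simp
    also have "\<dots> = t\<^sup>2 + \<eta>\<^sup>2 - \<eta> * \<bar>t\<bar>" by (simp add: power2_diff)
    finally have "\<eta> * \<bar>t\<bar> \<le> \<eta> * (\<eta> + t\<^sup>2 / \<eta>)" using \<eta> by (simp add: algebra_simps power2_eq_square)
    then show ?thesis using \<eta> by simp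
  qed
  have FR: "?F y \<le> ?R y" for y
  proof -
    have "(\<Sum>i<n. l (y i) * indicator B (y i)) / real n - (e1 + e2)
        = (\<Sum>i<n. ?Z i y) / real n + (\<Sum>i<n. g2 (y i)) / real n - e2"
      using n by (simp add: split sum.distrib sum_subtractf field_simps)
    moreover have "(\<Sum>i<n. g2 (y i)) / real n \<ge> 0" using g2 by (intro divide_nonneg_nonneg sum_nonneg) auto
    moreover have "((\<Sum>i<n. ?Z i y) / real n)\<^sup>2 / \<eta> = (\<Sum>i<n. ?Z i y)\<^sup>2 / ((real n)\<^sup>2 * \<eta>)"
      by (simp add: power_divide)
    ultimately show ?thesis using young[of "(\<Sum>i<n. ?Z i y) / real n"] e2(1) by linarith
  qed
  have intg2: "integrable ?P (\<lambda>y. \<Sum>i<n. g2 (y i))"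
    using comp(1)[OF _ int2] by (intro Bochner_Integration.integrable_sum) auto
  have intR: "integrable ?P ?R" using sm(1) intg2 by simp
  have measF: "?F \<in> borel_measurable ?P" by measurable
  show "integrable ?P (\<lambda>y. \<bar>(\<Sum>i<n. l (y i) * indicator B (y i)) / real n - (LINT x|M. l x * indicator B x)\<bar>)"
    unfolding e
  proof (rule Bochner_Integration.integrable_bound[OF intR measF], rule AE_I2)
    show "norm (?F y) \<le> norm (?R y)" for y unfolding real_norm_def using FR[of y] by linarith
  qed
  have "(LINT y|?P. ?F y) \<le> (LINT y|?P. ?R y)"
    by (rule integral_mono'[OF intR FR order_trans[OF abs_ge_zero FR]])
  also have "\<dots> = \<eta> + (LINT y|?P. (\<Sum>i<n. ?Z i y)\<^sup>2) / ((real n)\<^sup>2 * \<eta>) + (LINT y|?P. (\<Sum>i<n. g2 (y i))) / real n + e2"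
    using sm(1) intg2 by (simp add: P.prob_space)
  also have "(LINT y|?P. (\<Sum>i<n. g2 (y i))) = real n * e2"
    using comp[OF _ int2] by (subst Bochner_Integration.integral_sum) (auto simp: e2_def)
  also have "\<eta> + (LINT y|?P. (\<Sum>i<n. ?Z i y)\<^sup>2) / ((real n)\<^sup>2 * \<eta>) + real n * e2 / real n + e2
    \<le> \<eta> + (real n * K) / ((real n)\<^sup>2 * \<eta>) + 2 * e2"
    using sm(2) n \<eta> by (simp add: divide_right_mono)
  also have "(real n * K) / ((real n)\<^sup>2 * \<eta>) = K / (real n * \<eta>)" using n by (simp add: power2_eq_square)
  finally show "(LINT y|?P. \<bar>(\<Sum>i<n. l (y i) * indicator B (y i)) / real n - (LINT x|M. l x * indicator B x)\<bar>)
    \<le> 2 * \<delta> + \<eta> + K / (real n * \<eta>)"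
    unfolding e using e2 by linarith
qed

text \<open>If the sum S is at least n / 2, the ratio is at most 2 / n times the maximum, and the
  maximum is at most K plus the sum of all values beyond K. Otherwise the ratio is at most 1, which
  2 |S / n - 1| dominates, and the weak law applies.\<close>

lemma (in prob_space) truncated_max_over_sum:
  fixes l :: "'a \<Rightarrow> real"
  assumes l [measurable]: "l \<in> borel_measurable M" and nonneg: "\<And>x. 0 \<le> l x"
    and int: "integrable M l" and one: "(LINT x|M. l x) = 1"
    and n: "n > 0" and K: "K > 0" and \<eta>: "\<eta> > 0"
    and tail: "(LINT x|M. l x * indicator {x. l x > K} x) \<le> \<delta>"
  shows "\<bar>LINT y|Pi\<^sub>M {..<n} (\<lambda>_. M). (MAX i\<in>{..<n}. l (y i)) / (\<Sum>i<n. l (y i))\<bar>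
    \<le> 2 * (2 * \<delta> + \<eta> + K / (real n * \<eta>)) + 2 * K / real n + 2 * \<delta>"
proof -
  let ?P = "Pi\<^sub>M {..<n} (\<lambda>_. M)"
  interpret P: prob_space ?P by (rule prob_space_PiM) (rule prob_space_axioms)
  have wl: "integrable ?P (\<lambda>y. \<bar>(\<Sum>i<n. l (y i) * indicator (space M) (y i)) / real n - 1\<bar>)"
    "(LINT y|?P. \<bar>(\<Sum>i<n. l (y i) * indicator (space M) (y i)) / real n - 1\<bar>) \<le> 2 * \<delta> + \<eta> + K / (real n * \<eta>)"
  proof -
    have "(LINT x|M. l x * indicator (space M) x) = (LINT x|M. l x)"
      by (rule Bochner_Integration.integral_cong) auto
    with truncated_weak_law[OF l nonneg int _ sets.top n K \<eta> tail] one
    show "integrable ?P (\<lambda>y. \<bar>(\<Sum>i<n. l (y i) * indicator (space M) (y i)) / real n - 1\<bar>)"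
      "(LINT y|?P. \<bar>(\<Sum>i<n. l (y i) * indicator (space M) (y i)) / real n - 1\<bar>) \<le> 2 * \<delta> + \<eta> + K / (real n * \<eta>)"
      by simp_all
  qed
  define g2 where "g2 x = l x * indicator {x. l x > K} x" for x
  have g2: "0 \<le> g2 x" "l x \<le> K + g2 x" for x
    using nonneg[of x] K by (auto simp: g2_def indicator_def)
  have int2: "integrable M g2"
    unfolding g2_def by (rule Bochner_Integration.integrable_bound[OF int])
       (use nonneg in \<open>auto intro!: AE_I2 simp: indicator_def\<close>)
  have comp: "integrable ?P (\<lambda>y. g2 (y i))" "(LINT y|?P. g2 (y i)) = (LINT t|M. g2 t)" if "i < n" for i
    using integral_PiM_component[OF prob_space_axioms _ int2, of i "{..<n}"] that by auto
  have intg2: "integrable ?P (\<lambda>y. \<Sum>i<n. g2 (y i))"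
    using comp(1) by (intro Bochner_Integration.integrable_sum) auto
  have valg2: "(LINT y|?P. (\<Sum>i<n. g2 (y i))) \<le> real n * \<delta>"
    using comp tail by (subst Bochner_Integration.integral_sum) (auto simp: g2_def intro!: mult_left_mono)
  let ?F = "\<lambda>y. (MAX i\<in>{..<n}. l (y i)) / (\<Sum>i<n. l (y i))"
  let ?R = "\<lambda>y. 2 * \<bar>(\<Sum>i<n. l (y i) * indicator (space M) (y i)) / real n - 1\<bar>
      + 2 * K / real n + 2 / real n * (\<Sum>i<n. g2 (y i))"
  have ne: "(\<lambda>i. l (y i)) ` {..<n} \<noteq> {}" for y :: "nat \<Rightarrow> 'a" using n by auto
  have max0: "0 \<le> (MAX i\<in>{..<n}. l (y i))" for y
  proof -
    have "l (y 0) \<le> (MAX i\<in>{..<n}. l (y i))" using n by (intro Max_ge) auto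
    then show ?thesis using nonneg[of "y 0"] by linarith
  qed
  have F0: "0 \<le> ?F y" for y using max0 nonneg by (intro divide_nonneg_nonneg sum_nonneg) auto
  have FR: "?F y \<le> ?R y" if y: "y \<in> space ?P" for y
  proof -
    let ?S = "\<Sum>i<n. l (y i)" and ?m = "MAX i\<in>{..<n}. l (y i)"
    have "(\<Sum>i<n. l (y i) * indicator (space M) (y i)) = ?S"
      using y by (intro sum.cong refl) (auto simp: space_PiM PiE_def Pi_iff)
    then have R: "?R y = 2 * \<bar>?S / real n - 1\<bar> + 2 * K / real n + 2 / real n * (\<Sum>i<n. g2 (y i))" by simp
    have g2sum: "0 \<le> (\<Sum>i<n. g2 (y i))" using g2 by (intro sum_nonneg) auto
    have m1: "?m \<le> K + (\<Sum>i<n. g2 (y i))"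
    proof (rule Max.boundedI)
      fix t assume "t \<in> (\<lambda>i. l (y i)) ` {..<n}"
      then obtain i where i: "i < n" "t = l (y i)" by auto
      have "g2 (y i) \<le> (\<Sum>i<n. g2 (y i))" using i g2 by (intro member_le_sum) auto
      then show "t \<le> K + (\<Sum>i<n. g2 (y i))" using g2(2)[of "y i"] i by linarith
    qed (use ne in auto)
    have m2: "?m \<le> ?S"
    proof (rule Max.boundedI)
      fix t assume "t \<in> (\<lambda>i. l (y i)) ` {..<n}"
      then obtain i where i: "i < n" "t = l (y i)" by auto
      show "t \<le> ?S" unfolding i(2) using i(1) nonneg by (intro member_le_sum) auto
    qed (use ne in auto)
    show ?thesis
    proof (cases "?S / real n \<ge> 1 / 2")
      case True
      then have S: "?S \<ge> real n / 2" "?S > 0" using n by (auto simp: field_simps)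
      have "?F y \<le> ?m / (real n / 2)" using S n max0[of y] by (intro divide_left_mono) auto
      also have "\<dots> \<le> (K + (\<Sum>i<n. g2 (y i))) / (real n / 2)" using m1 n by (intro divide_right_mono) auto
      also have "\<dots> = 2 * K / real n + 2 / real n * (\<Sum>i<n. g2 (y i))" by (simp add: field_simps add_divide_distrib)
      finally have "?F y \<le> 2 * K / real n + 2 / real n * (\<Sum>i<n. g2 (y i))" .
      moreover have "0 \<le> 2 * \<bar>?S / real n - 1\<bar>" by simp
      ultimately show ?thesis unfolding R by linarith
    next
      case False
      have aux: "\<not> 1 / 2 \<le> t \<Longrightarrow> 1 \<le> 2 * \<bar>t - 1\<bar>" for t :: real
        by (simp add: abs_if)
      have "1 \<le> 2 * \<bar>?S / real n - 1\<bar>" by (rule aux[OF False])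
      moreover have "?F y \<le> 1"
      \<comment> \<open>If every value vanishes, the quotient is 0 by the convention for division by
        zero.\<close>
      proof (cases "?S = 0")
        case True
        show ?thesis unfolding True by simp
      next
        case False
        have "0 \<le> ?S" by (intro sum_nonneg nonneg)
        then have "?S > 0" using False by linarith
        then show ?thesis using m2 by (subst divide_le_eq_1_pos)
      qed
      moreover have "0 \<le> 2 * K / real n" using K by simp
      moreover have "0 \<le> 2 / real n * (\<Sum>i<n. g2 (y i))" by (rule mult_nonneg_nonneg[OF _ g2sum]) simp
      ultimately show ?thesis unfolding R by linarith
    qed
  qed
  have intR: "integrable ?P ?R" using wl(1) intg2 by simp
  have "(LINT y|?P. ?F y) \<le> (LINT y|?P. ?R y)"
    by (rule integral_mono'[OF intR FR order_trans[OF F0 FR]])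
  also have "\<dots> = 2 * (LINT y|?P. \<bar>(\<Sum>i<n. l (y i) * indicator (space M) (y i)) / real n - 1\<bar>)
      + 2 * K / real n + 2 / real n * (LINT y|?P. (\<Sum>i<n. g2 (y i)))"
    using wl(1) intg2 by (simp add: P.prob_space)
  also have "\<dots> \<le> 2 * (2 * \<delta> + \<eta> + K / (real n * \<eta>)) + 2 * K / real n + 2 / real n * (real n * \<delta>)"
    using wl(2) valg2 by (intro add_mono mult_left_mono) auto
  also have "\<dots> = 2 * (2 * \<delta> + \<eta> + K / (real n * \<eta>)) + 2 * K / real n + 2 * \<delta>" using n by simp
  finally show ?thesis using F0 by (simp add: abs_of_nonneg)
qed

section \<open>Convergence in distribution to the constant 0\<close>

lemma isCont_cdf_return_0_imp_nonzero: "isCont (cdf (return borel (0::real))) x \<Longrightarrow> x \<noteq> 0"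
proof
  assume cont: "isCont (cdf (return borel (0::real))) x" and "x = 0"
  have cdf: "cdf (return borel (0::real)) t = (if 0 \<le> t then 1 else 0)" for t
    by (simp add: cdf_def measure_return)
  have "(\<lambda>n. - (1 / real (Suc n))) \<longlonglongrightarrow> 0"
    using tendsto_minus[OF LIMSEQ_inverse_real_of_nat] by (simp add: inverse_eq_divide)
  then have "(\<lambda>n. cdf (return borel (0::real)) (- (1 / real (Suc n)))) \<longlonglongrightarrow> cdf (return borel 0) 0"
    using cont \<open>x = 0\<close> by (auto intro: isCont_tendsto_compose)
  moreover have "cdf (return borel (0::real)) (- (1 / real (Suc n))) = 0" for n
    unfolding cdf by (simp add: field_simps)
  ultimately have "(\<lambda>n. 0) \<longlonglongrightarrow> (1::real)" by (simp add: cdf)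
  then show False by (simp add: LIMSEQ_const_iff)
qed

text \<open>Convergence in probability to 0 suffices, since only the points x other than 0 are
  continuity points of the limit. The first two premises are required only eventually because
  nothing will be known about the measure at d = 0.\<close>

lemma conv_distr_0I:
  assumes prob: "\<forall>\<^sub>F d in sequentially. prob_space (M d)"
    and meas: "\<forall>\<^sub>F d in sequentially. X d \<in> borel_measurable (M d)"
    and lim: "\<And>\<epsilon>. \<epsilon> > 0 \<Longrightarrow> (\<lambda>d. measure (M d) {w \<in> space (M d). \<epsilon> < \<bar>X d w\<bar>}) \<longlonglongrightarrow> 0"
  shows "conv_distr_0 M X"
  unfolding conv_distr_0_def weak_conv_m_def weak_conv_def
proof (intro allI impI)
  fix x assume "isCont (cdf (return borel (0::real))) x"
  then have x: "x \<noteq> 0" by (rule isCont_cdf_return_0_imp_nonzero)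
  have target: "cdf (return borel (0::real)) x = (if 0 \<le> x then 1 else 0)"
    by (simp add: cdf_def measure_return)
  \<comment> \<open>Halving |x| keeps the inequality strict also when x < 0 and X = x.\<close>
  let ?t = "\<lambda>d. measure (M d) {w \<in> space (M d). \<bar>x\<bar> / 2 < \<bar>X d w\<bar>}"
  have "\<forall>\<^sub>F d in sequentially. \<bar>cdf (distr (M d) borel (X d)) x - cdf (return borel 0) x\<bar> \<le> ?t d"
    using prob meas
  proof eventually_elim
    case (elim d)
    interpret prob_space "M d" by fact
    note [measurable] = elim(2)
    have cdf: "cdf (distr (M d) borel (X d)) x = prob {w \<in> space (M d). X d w \<le> x}"
      unfolding cdf_def by (subst measure_distr) (auto intro!: arg_cong[where f=prob])
    show ?case
    proof (cases "x > 0")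
      case True
      have "1 - prob {w \<in> space (M d). X d w \<le> x} = prob {w \<in> space (M d). \<not> X d w \<le> x}"
        by (subst prob_neg) auto
      also have "\<dots> \<le> ?t d" using True by (intro finite_measure_mono) auto
      finally show ?thesis using True by (simp add: target cdf)
    next
      case False
      have "prob {w \<in> space (M d). X d w \<le> x} \<le> ?t d"
        using False x by (intro finite_measure_mono) auto
      then show ?thesis using False x by (simp add: target cdf)
    qed
  qed
  moreover have "?t \<longlonglongrightarrow> 0" using lim[of "\<bar>x\<bar> / 2"] x by simp
  ultimately have "(\<lambda>d. cdf (distr (M d) borel (X d)) x - cdf (return borel 0) x) \<longlonglongrightarrow> 0"
    by (rule Lim_null_comparison[where g="?t" and
        f="\<lambda>d. cdf (distr (M d) borel (X d)) x - cdf (return borel 0) x", unfolded real_norm_def])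
  then show "(\<lambda>d. cdf (distr (M d) borel (X d)) x) \<longlonglongrightarrow> cdf (return borel 0) x"
    by (simp add: LIM_zero_iff)
qed

section \<open>Efficiency of projected Gaussian densities\<close>

text \<open>Here the measure of integration varies with w. Written as a density over one fixed
  sigma-finite product, the integral becomes an ordinary parameter integral.\<close>

lemma borel_measurable_integral_iid_law:
  fixes F :: "'w \<Rightarrow> (nat \<Rightarrow> nat \<Rightarrow> real) \<Rightarrow> real"
  assumes g: "(\<lambda>(w, x). g w x) \<in> borel_measurable (N \<Otimes>\<^sub>M Rd d)"
    and nonneg: "\<And>w x. w \<in> space N \<Longrightarrow> 0 \<le> g w x"
    and prob: "\<And>w. w \<in> space N \<Longrightarrow> (\<integral>\<^sup>+x. ennreal (g w x) \<partial>Rd d) = 1"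
    and F: "(\<lambda>(w, y). F w y) \<in> borel_measurable (N \<Otimes>\<^sub>M Pi\<^sub>M {..<n} (\<lambda>_. Rd d))"
  shows "(\<lambda>w. LINT y|iid_law d n (g w). F w y) \<in> borel_measurable N"
proof -
  let ?P = "Pi\<^sub>M {..<n} (\<lambda>_. Rd d)"
  interpret R: product_sigma_finite "\<lambda>_. Rd d"
    by (simp add: product_sigma_finite_def sigma_finite_Rd)
  interpret P: sigma_finite_measure ?P by (rule R.sigma_finite) simp
  note [measurable] = g F
  have comp [measurable]: "(\<lambda>(w, y). g w (y i)) \<in> borel_measurable (N \<Otimes>\<^sub>M ?P)" if "i < n" for i
  proof -
    have "(\<lambda>z. snd z i) \<in> measurable (N \<Otimes>\<^sub>M ?P) (Rd d)"
      by (rule measurable_compose[OF measurable_snd measurable_component_singleton]) (use that in simp)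
    then have "(\<lambda>z. (fst z, snd z i)) \<in> measurable (N \<Otimes>\<^sub>M ?P) (N \<Otimes>\<^sub>M Rd d)"
      by (rule measurable_Pair[OF measurable_fst])
    from measurable_compose[OF this g] show ?thesis by (simp add: split_beta)
  qed
  have dens: "(\<lambda>(w, y). (\<Prod>i<n. g w (y i)) * F w y) \<in> borel_measurable (N \<Otimes>\<^sub>M ?P)"
  proof -
    have "(\<lambda>z. \<Prod>i<n. g (fst z) (snd z i)) \<in> borel_measurable (N \<Otimes>\<^sub>M ?P)"
      using comp by (intro borel_measurable_prod) (auto simp: split_beta)
    moreover have "(\<lambda>z. F (fst z) (snd z)) \<in> borel_measurable (N \<Otimes>\<^sub>M ?P)"
      using F by (simp add: split_beta)
    ultimately show ?thesis by (simp add: split_beta)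
  qed
  have "(LINT y|iid_law d n (g w). F w y) = (LINT y|?P. (\<Prod>i<n. g w (y i)) * F w y)"
    if w: "w \<in> space N" for w
  proof -
    have gw [measurable]: "g w \<in> borel_measurable (Rd d)"
      using measurable_Pair2[OF g w] by simp
    have Fw: "F w \<in> borel_measurable ?P" using measurable_Pair2[OF F w] by simp
    have "prob_space (density (Rd d) (\<lambda>x. ennreal (g w x)))"
      by (rule prob_spaceI) (simp add: emeasure_density prob[OF w])
    then have "iid_law d n (g w) = density ?P (\<lambda>y. \<Prod>i<n. ennreal (g w (y i)))"
      unfolding iid_law_def by (intro PiM_density) (auto simp: sigma_finite_Rd)
    also have "\<dots> = density ?P (\<lambda>y. ennreal (\<Prod>i<n. g w (y i)))"
      using nonneg[OF w] by (simp add: prod_ennreal)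
    finally have *: "iid_law d n (g w) = density ?P (\<lambda>y. ennreal (\<Prod>i<n. g w (y i)))" .
    show ?thesis unfolding *
    proof (rule integral_real_density)
      show "(\<lambda>y. \<Prod>i<n. g w (y i)) \<in> borel_measurable ?P" by (intro borel_measurable_prod) measurable
    qed (use Fw nonneg[OF w] in \<open>auto intro!: prod_nonneg\<close>)
  qed
  moreover have "(\<lambda>w. LINT y|?P. (\<Prod>i<n. g w (y i)) * F w y) \<in> borel_measurable N"
    by (rule P.borel_measurable_lebesgue_integral) (rule dens)
  ultimately show ?thesis by (simp cong: measurable_cong)
qed

text \<open>The bounds involve a, B, c, K, \<open>\<eta>\<close> and n, but not d, r, m or v. The
  two truncated estimates are applied under g: l has mean 1 there, l times the indicator of A has
  mean p, and the l-weighted tail beyond K is the tail probability under \<open>f\<close>, bounded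
  by \<open>\<delta>\<close>.\<close>

lemma proj_gauss_efficiency_bounds:
  assumes on: "orthonormal_family d r D" and a: "a > 0" and v: "\<And>k. k < r \<Longrightarrow> a \<le> v k"
    and vB: "(\<Sum>k<r. (v k - 1)\<^sup>2) \<le> B" and mB: "dot d m m \<le> B"
    and A [measurable]: "A \<in> sets (Rd d)" and c: "0 < c" "c \<le> p_f d A"
    and n: "n > 0" and K: "K > 1" and \<eta>: "\<eta> > 0"
  defines "g \<equiv> proj_gauss_density d r D m v" and "\<delta> \<equiv> (B / a + B / 2 + 1) / ln K"
  shows "\<bar>LINT y|iid_law d n g. (MAX i\<in>{..<n}. lik_ratio d g (y i)) / (\<Sum>i<n. lik_ratio d g (y i))\<bar>
      \<le> 2 * (2 * \<delta> + \<eta> + K / (real n * \<eta>)) + 2 * K / real n + 2 * \<delta>"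
    and "\<bar>LINT y|iid_law d n g. \<bar>1 / (p_f d A * real n)
          * (\<Sum>i<n. lik_ratio d g (y i) * indicator A (y i)) - 1\<bar>\<bar>
      \<le> (2 * \<delta> + \<eta> + K / (real n * \<eta>)) / c"
proof -
  let ?l = "lik_ratio d g" and ?L = "log_lik_ratio d r D m v"
  define Q where "Q = density (Rd d) (\<lambda>x. ennreal (g x))"
  have vpos: "v k > 0" if "k < r" for k using v[OF that] a by linarith
  have gpos: "g x > 0" for x unfolding g_def using vpos by (rule proj_gauss_density_pos)
  have [measurable]: "g \<in> borel_measurable (Rd d)" unfolding g_def by measurable
  have sets_Q [measurable_cong]: "sets Q = sets (Rd d)" and space_Q: "space Q = space (Rd d)"
    by (auto simp: Q_def)
  interpret Q: prob_space Q unfolding Q_def g_def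
    by (rule prob_spaceI)
       (simp add: emeasure_density nn_integral_proj_gauss_density[OF on vpos])
  have iid: "iid_law d n g = Pi\<^sub>M {..<n} (\<lambda>_. Q)" by (simp add: iid_law_def Q_def)
  have gl: "g x * ?l x = std_gauss d x" for x using gpos[of x] by (simp add: lik_ratio_def)
  have l_exp: "?l x = exp (?L x)" for x
    using std_gauss_eq_exp_mult_proj[OF vpos, where x=x and D=D and m=m and d=d] gpos[of x]
    by (simp add: lik_ratio_def g_def)
  have l_meas [measurable]: "?l \<in> borel_measurable (Rd d)" unfolding lik_ratio_def by measurable
  then have lQ: "?l \<in> borel_measurable Q" by measurable
  have l_nonneg: "0 \<le> ?l x" for x by (simp add: l_exp)
  have intQ: "integrable Q h \<longleftrightarrow> integrable (Rd d) (\<lambda>x. g x * h x)"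
    "(LINT x|Q. h x) = (LINT x|Rd d. g x * h x)" if [measurable]: "h \<in> borel_measurable (Rd d)" for h :: "_ \<Rightarrow> real"
    unfolding Q_def
    by (subst integrable_real_density integral_real_density; use gpos less_imp_le in auto)+
  have intl: "integrable Q ?l" by (simp add: intQ gl integrable_std_gauss)
  have "has_bochner_integral (Rd d) (std_gauss d) 1"
    by (rule has_bochner_integral_nn_integral) (auto simp: std_gauss_nonneg nn_integral_std_gauss)
  then have onel: "(LINT x|Q. ?l x) = 1" by (simp add: intQ gl has_bochner_integral_iff)
  have tail: "(LINT x|Q. ?l x * indicator {x. ?l x > K} x) \<le> \<delta>"
  proof -
    let ?E = "{x \<in> space (Rd d). exp (?L x) > K}"
    have [measurable]: "?E \<in> sets (Rd d)" by measurable
    have "(LINT x|Q. ?l x * indicator {x. ?l x > K} x) = (LINT x|Rd d. g x * (?l x * indicator {x. ?l x > K} x))"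
      by (rule intQ) measurable
    also have "\<dots> = (LINT x|Rd d. std_gauss d x * indicator ?E x)"
      by (rule Bochner_Integration.integral_cong) (auto simp: gl l_exp[symmetric] mult.assoc[symmetric] indicator_def)
    also have "\<dots> = (LINT x|std_gauss_measure d. indicator ?E x)"
      by (rule integral_real_density[symmetric]) (auto simp: std_gauss_nonneg)
    also have "\<dots> = measure (std_gauss_measure d) ?E" by simp
    also have "\<dots> \<le> \<delta>" unfolding \<delta>_def
      by (rule log_lik_ratio_tail[OF on vpos K relative_entropy_bound[OF on a v vB mB]])
    finally show ?thesis .
  qed
  have AQ: "A \<in> sets Q" using A by (simp add: sets_Q)
  show "\<bar>LINT y|iid_law d n g. (MAX i\<in>{..<n}. ?l (y i)) / (\<Sum>i<n. ?l (y i))\<bar>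
      \<le> 2 * (2 * \<delta> + \<eta> + K / (real n * \<eta>)) + 2 * K / real n + 2 * \<delta>"
    unfolding iid using Q.truncated_max_over_sum[OF lQ l_nonneg intl onel n _ \<eta> tail] K by simp
  have p: "(LINT x|Q. ?l x * indicator A x) = p_f d A"
  proof -
    have "(LINT x|Q. ?l x * indicator A x) = (LINT x|Rd d. g x * (?l x * indicator A x))"
      by (rule intQ) measurable
    also have "\<dots> = p_f d A"
      by (simp add: gl p_f_def set_lebesgue_integral_def mult.assoc[symmetric] mult.commute)
    finally show ?thesis .
  qed
  let ?p = "p_f d A" and ?\<beta> = "2 * \<delta> + \<eta> + K / (real n * \<eta>)"
  have wl: "(LINT y|Pi\<^sub>M {..<n} (\<lambda>_. Q). \<bar>(\<Sum>i<n. ?l (y i) * indicator A (y i)) / real n - ?p\<bar>) \<le> ?\<beta>"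
    using Q.truncated_weak_law(2)[OF lQ l_nonneg intl _ AQ n _ \<eta> tail] onel K by (simp add: p)
  have ppos: "?p > 0" using c by simp
  have "\<bar>1 / (?p * real n) * s - 1\<bar> = \<bar>s / real n - ?p\<bar> / ?p" for s
  proof -
    have "1 / (?p * real n) * s - 1 = (s / real n - ?p) / ?p" using ppos by (simp add: field_simps)
    then show ?thesis using ppos by simp
  qed
  then have "(LINT y|iid_law d n g. \<bar>1 / (?p * real n) * (\<Sum>i<n. ?l (y i) * indicator A (y i)) - 1\<bar>)
    = (LINT y|Pi\<^sub>M {..<n} (\<lambda>_. Q). \<bar>(\<Sum>i<n. ?l (y i) * indicator A (y i)) / real n - ?p\<bar>) / ?p"
    unfolding iid by simp
  also have "\<dots> \<le> ?\<beta> / ?p" using wl ppos by (intro divide_right_mono) auto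
  also have "\<dots> \<le> ?\<beta> / c"
  proof (rule divide_left_mono)
    have "0 \<le> (LINT y|Pi\<^sub>M {..<n} (\<lambda>_. Q). \<bar>(\<Sum>i<n. ?l (y i) * indicator A (y i)) / real n - ?p\<bar>)" by simp
    then show "0 \<le> ?\<beta>" using wl by linarith
  qed (use c ppos in auto)
  finally show "\<bar>LINT y|iid_law d n g. \<bar>1 / (?p * real n) * (\<Sum>i<n. ?l (y i) * indicator A (y i)) - 1\<bar>\<bar>
      \<le> ?\<beta> / c" by simp
qed

text \<open>Transfer to random parameters. Positive variances on the whole space make every
  realisation of g a density, which gives measurability; the uniform bounds are needed only on the
  events \<open>G d\<close>, since the complements have vanishing probability.\<close>

lemma efficient_proj_gauss:
  fixes M :: "nat \<Rightarrow> 'w measure" and D :: "nat \<Rightarrow> nat \<Rightarrow> 'w \<Rightarrow> nat \<Rightarrow> real"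
    and m v :: "nat \<Rightarrow> 'w \<Rightarrow> nat \<Rightarrow> real"
  assumes A: "\<And>d. d \<ge> 1 \<Longrightarrow> A d \<in> sets (Rd d)" and c: "c > 0" "\<And>d. d \<ge> 1 \<Longrightarrow> c \<le> p_f d (A d)"
    and M: "\<And>d. d \<ge> 1 \<Longrightarrow> prob_space (M d)"
    and D: "\<And>d k. d \<ge> 1 \<Longrightarrow> k < r d \<Longrightarrow> D d k \<in> measurable (M d) (Rd d)"
    and on: "\<And>d w. d \<ge> 1 \<Longrightarrow> w \<in> space (M d) \<Longrightarrow> orthonormal_family d (r d) (\<lambda>k. D d k w)"
    and v: "\<And>d k. d \<ge> 1 \<Longrightarrow> k < r d \<Longrightarrow> (\<lambda>w. v d w k) \<in> borel_measurable (M d)"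
    and m: "\<And>d i. d \<ge> 1 \<Longrightarrow> i < d \<Longrightarrow> (\<lambda>w. m d w i) \<in> borel_measurable (M d)"
    and vpos: "\<And>d w k. d \<ge> 1 \<Longrightarrow> w \<in> space (M d) \<Longrightarrow> k < r d \<Longrightarrow> v d w k > 0"
    and g: "\<And>d w. d \<ge> 1 \<Longrightarrow> w \<in> space (M d) \<Longrightarrow>
        g d w = proj_gauss_density d (r d) (\<lambda>k. D d k w) (m d w) (v d w)"
    and a: "a > 0"
    and good: "\<And>d w. d \<ge> 1 \<Longrightarrow> w \<in> space (M d) \<Longrightarrow> w \<in> G d \<Longrightarrow>
        (\<forall>k<r d. a \<le> v d w k) \<and> (\<Sum>k<r d. (v d w k - 1)\<^sup>2) \<le> B \<and> dot d (m d w) (m d w) \<le> B"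
    and G: "\<And>d. d \<ge> 1 \<Longrightarrow> G d \<in> sets (M d)"
    and Glim: "(\<lambda>d. measure (M d) (space (M d) - G d)) \<longlonglongrightarrow> 0"
  shows "efficient M g A"
  unfolding efficient_def
proof (intro allI impI conjI)
  fix n :: "nat \<Rightarrow> nat" assume n: "filterlim n at_top sequentially"
  let ?\<Phi>1 = "\<lambda>d w. LINT y|iid_law d (n d) (g d w).
            (MAX i\<in>{..<n d}. lik_ratio d (g d w) (y i)) / (\<Sum>i<n d. lik_ratio d (g d w) (y i))"
  let ?\<Phi>2 = "\<lambda>d w. LINT y|iid_law d (n d) (g d w).
            \<bar>1 / (p_f d (A d) * real (n d))
               * (\<Sum>i<n d. lik_ratio d (g d w) (y i) * indicator (A d) (y i)) - 1\<bar>"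
  let ?g = "\<lambda>d w. proj_gauss_density d (r d) (\<lambda>k. D d k w) (m d w) (v d w)"
  have ev: "\<forall>\<^sub>F d in sequentially. d \<ge> 1 \<and> n d > 0"
    using eventually_ge_at_top[of 1] filterlim_at_top[THEN iffD1, OF n, rule_format, of 1]
    by eventually_elim auto
  have prob: "\<forall>\<^sub>F d in sequentially. prob_space (M d)"
    using eventually_ge_at_top[of 1] by eventually_elim (rule M)
  have g_meas: "(\<lambda>z. ?g d (fst z) (x z)) \<in> borel_measurable N"
    if "d \<ge> 1" and [measurable]: "fst \<in> measurable N (M d)" "x \<in> measurable N (Rd d)" for d N and x :: "'w \<times> 'z \<Rightarrow> nat \<Rightarrow> real"
  proof (rule borel_measurable_proj_gauss_density_comp)
    show "(\<lambda>z. m d (fst z) i) \<in> borel_measurable N" if "i < d" for i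
      using measurable_compose[OF _ m[OF \<open>d \<ge> 1\<close> that]] by measurable
    show "(\<lambda>z. x z i) \<in> borel_measurable N" if "i < d" for i
      using that by measurable
    show "(\<lambda>z. v d (fst z) k) \<in> borel_measurable N" if "k < r d" for k
      using measurable_compose[OF _ v[OF \<open>d \<ge> 1\<close> that]] by measurable
    show "(\<lambda>z. D d k (fst z) i) \<in> borel_measurable N" if "k < r d" "i < d" for k i
    proof -
      have "(\<lambda>z. D d k (fst z)) \<in> measurable N (Rd d)"
        using measurable_compose[OF _ D[OF \<open>d \<ge> 1\<close> that(1)]] by measurable
      then show ?thesis using that(2) by measurable
    qed
  qed
  have meas: "(\<lambda>w. LINT y|iid_law d (n d) (g d w). F w y) \<in> borel_measurable (M d)"
    if d: "d \<ge> 1" and F: "(\<lambda>(w, y). F w y) \<in> borel_measurable (M d \<Otimes>\<^sub>M Pi\<^sub>M {..<n d} (\<lambda>_. Rd d))"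
    for d and F :: "'w \<Rightarrow> (nat \<Rightarrow> nat \<Rightarrow> real) \<Rightarrow> real"
  proof -
    have "(\<lambda>w. LINT y|iid_law d (n d) (?g d w). F w y) \<in> borel_measurable (M d)"
    proof (rule borel_measurable_integral_iid_law[OF _ _ _ F])
      show "(\<lambda>(w, x). ?g d w x) \<in> borel_measurable (M d \<Otimes>\<^sub>M Rd d)"
        unfolding split_beta by (rule g_meas[OF d]) measurable
      show "0 \<le> ?g d w x" if "w \<in> space (M d)" for w x
        by (intro less_imp_le proj_gauss_density_pos vpos d that)
      show "(\<integral>\<^sup>+x. ennreal (?g d w x) \<partial>Rd d) = 1" if "w \<in> space (M d)" for w
        by (intro nn_integral_proj_gauss_density on vpos d that)
    qed
    then show ?thesis using g[OF d] by (simp cong: measurable_cong)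
  qed
  have lik_meas: "(\<lambda>z. lik_ratio d (g d (fst z)) (snd z i))
      \<in> borel_measurable (M d \<Otimes>\<^sub>M Pi\<^sub>M {..<n d} (\<lambda>_. Rd d))" if d: "d \<ge> 1" and i: "i < n d" for d i
  proof -
    have sn: "(\<lambda>z. snd z i) \<in> measurable (M d \<Otimes>\<^sub>M Pi\<^sub>M {..<n d} (\<lambda>_. Rd d)) (Rd d)"
      by (rule measurable_compose[OF measurable_snd measurable_component_singleton]) (use i in simp)
    have "(\<lambda>z. std_gauss d (snd z i) / ?g d (fst z) (snd z i))
      \<in> borel_measurable (M d \<Otimes>\<^sub>M Pi\<^sub>M {..<n d} (\<lambda>_. Rd d))"
      by (intro borel_measurable_divide measurable_compose[OF sn borel_measurable_std_gauss]
        g_meas[OF d _ sn]) measurable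
    then show ?thesis
      by (rule measurable_cong[THEN iffD2, rotated]) (auto simp: space_pair_measure lik_ratio_def g[OF d])
  qed
  have meas1: "\<forall>\<^sub>F d in sequentially. ?\<Phi>1 d \<in> borel_measurable (M d)"
    using eventually_ge_at_top[of 1]
  proof eventually_elim
    case (elim d)
    note [measurable] = lik_meas[OF elim]
    show ?case
      by (rule meas[OF elim], unfold split_beta,
          intro borel_measurable_divide borel_measurable_Max borel_measurable_sum) (auto intro: lik_meas[OF elim])
  qed
  have meas2: "\<forall>\<^sub>F d in sequentially. ?\<Phi>2 d \<in> borel_measurable (M d)"
    using eventually_ge_at_top[of 1]
  proof eventually_elim
    case (elim d)
    have ind: "(\<lambda>z. indicator (A d) (snd z i) :: real) \<in> borel_measurable (M d \<Otimes>\<^sub>M Pi\<^sub>M {..<n d} (\<lambda>_. Rd d))"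
      if "i < n d" for i
    proof -
      have "(\<lambda>z. snd z i) \<in> measurable (M d \<Otimes>\<^sub>M Pi\<^sub>M {..<n d} (\<lambda>_. Rd d)) (Rd d)"
        by (rule measurable_compose[OF measurable_snd measurable_component_singleton]) (use that in simp)
      then show ?thesis by (rule measurable_compose) (use A[OF elim] in measurable)
    qed
    show ?case
      by (rule meas[OF elim], unfold split_beta,
          intro borel_measurable_abs borel_measurable_diff borel_measurable_times borel_measurable_sum
            borel_measurable_const) (auto intro: lik_meas[OF elim] ind)
  qed
  have bound: "\<forall>\<^sub>F d in sequentially. \<forall>w\<in>space (M d). w \<in> G d \<longrightarrow> \<bar>?\<Phi>1 d w\<bar> \<le> \<epsilon> \<and> \<bar>?\<Phi>2 d w\<bar> \<le> \<epsilon>"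
    if \<epsilon>: "\<epsilon> > 0" for \<epsilon>
  proof -
    \<comment> \<open>The second quantity carries a factor 1 / c, so the common bound must also be
      small compared with c.\<close>
    define \<epsilon>' where "\<epsilon>' = min \<epsilon> (\<epsilon> * c)"
    have \<epsilon>': "\<epsilon>' > 0" "\<epsilon>' \<le> \<epsilon>" "\<epsilon>' \<le> \<epsilon> * c" using \<epsilon> c by (auto simp: \<epsilon>'_def)
    define C where "C = \<bar>B / a + B / 2 + 1\<bar>"
    \<comment> \<open>Chosen before d so that ln K exceeds 24 C / \<open>\<epsilon>'\<close>: then 6
      \<open>\<delta>\<close>, 2 \<open>\<eta>\<close> and the terms that vanish with n each take at
      most a quarter of \<open>\<epsilon>'\<close>. The summand 1 gives K > 1 even for C =
      0.\<close>
    define K where "K = exp (24 * C / \<epsilon>' + 1)"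
    define \<eta> where "\<eta> = \<epsilon>' / 8"
    define \<delta> where "\<delta> = (B / a + B / 2 + 1) / ln K"
    have lnK: "ln K = 24 * C / \<epsilon>' + 1" by (simp add: K_def)
    have q: "0 \<le> 24 * C / \<epsilon>'" using \<epsilon>' by (simp add: C_def)
    have K: "K > 1" unfolding K_def using q by (simp add: add_nonneg_pos)
    have \<eta>: "\<eta> > 0" using \<epsilon>' by (simp add: \<eta>_def)
    have \<delta>: "24 * \<delta> \<le> \<epsilon>'"
    proof -
      have pos: "ln K > 0" using lnK q by linarith
      have CK: "24 * C \<le> \<epsilon>' * ln K" unfolding lnK using \<epsilon>' by (simp add: field_simps)
      have "B / a + B / 2 + 1 \<le> C" unfolding C_def by (rule abs_ge_self)
      then have "24 * (B / a + B / 2 + 1) \<le> 24 * C" by (rule mult_left_mono) simp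
      from this CK have "24 * (B / a + B / 2 + 1) \<le> \<epsilon>' * ln K" by (rule order_trans)
      then have "24 * (B / a + B / 2 + 1) / ln K \<le> \<epsilon>'" using pos by (subst pos_divide_le_eq) auto
      then show ?thesis by (simp only: \<delta>_def times_divide_eq_right)
    qed
    let ?t = "\<lambda>n. 2 * K / (real n * \<eta>) + 2 * K / real n"
    have "?t \<longlonglongrightarrow> 0"
      using tendsto_mult[OF tendsto_const[of "2 * K / \<eta> + 2 * K"] lim_1_over_n]
      by (simp add: field_simps add_divide_distrib)
    then have "(\<lambda>d. ?t (n d)) \<longlonglongrightarrow> 0" by (rule filterlim_compose[OF _ n])
    then have "\<forall>\<^sub>F d in sequentially. ?t (n d) < \<epsilon>' / 4"
      by (rule order_tendstoD) (use \<epsilon>' in simp)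
    then show ?thesis using ev
    proof eventually_elim
      case (elim d)
      show ?case
      proof (intro ballI impI)
        fix w assume w: "w \<in> space (M d)" "w \<in> G d"
        have d: "d \<ge> 1" "n d > 0" using elim by auto
        note gd = good[OF d(1) w]
        note bds = proj_gauss_efficiency_bounds[OF on[OF d(1) w(1)] a _ _ _ A[OF d(1)] c(1) c(2)[OF d(1)] d(2) K \<eta>,
            of "v d w" B "m d w", folded g[OF d(1) w(1)] \<delta>_def]
        let ?\<beta> = "2 * \<delta> + \<eta> + K / (real (n d) * \<eta>)"
        have Kn: "0 \<le> K / (real (n d) * \<eta>)" "0 \<le> K / real (n d)" using K \<eta> by auto
        have t: "2 * (K / (real (n d) * \<eta>)) + 2 * (K / real (n d)) < \<epsilon>' / 4" using elim(1) by simp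
        have small: "2 * ?\<beta> + 2 * K / real (n d) + 2 * \<delta> \<le> \<epsilon>'"
        proof -
          have "2 * ?\<beta> + 2 * K / real (n d) + 2 * \<delta>
            = 6 * \<delta> + 2 * \<eta> + (2 * (K / (real (n d) * \<eta>)) + 2 * (K / real (n d)))" by simp
          then show ?thesis using t \<delta> \<epsilon>'(1) unfolding \<eta>_def by linarith
        qed
        have small2: "?\<beta> \<le> \<epsilon>'" using t \<delta> \<epsilon>'(1) Kn unfolding \<eta>_def by linarith
        have "\<bar>?\<Phi>1 d w\<bar> \<le> \<epsilon>" using bds(1) gd small \<epsilon>'(2) by auto
        moreover have "\<bar>?\<Phi>2 d w\<bar> \<le> ?\<beta> / c" using bds(2) gd by auto
        moreover have "?\<beta> / c \<le> \<epsilon>" using small2 \<epsilon>'(3) c(1) by (simp add: pos_divide_le_eq)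
        ultimately show "\<bar>?\<Phi>1 d w\<bar> \<le> \<epsilon> \<and> \<bar>?\<Phi>2 d w\<bar> \<le> \<epsilon>" by linarith
      qed
    qed
  qed
  have lim: "(\<lambda>d. measure (M d) {w \<in> space (M d). \<epsilon> < \<bar>X d w\<bar>}) \<longlonglongrightarrow> 0"
    if X: "\<forall>\<^sub>F d in sequentially. \<forall>w\<in>space (M d). w \<in> G d \<longrightarrow> \<bar>X d w\<bar> \<le> \<epsilon>" for \<epsilon> and X :: "nat \<Rightarrow> 'w \<Rightarrow> real"
  proof (rule Lim_null_comparison[OF _ Glim])
    show "\<forall>\<^sub>F d in sequentially. norm (measure (M d) {w \<in> space (M d). \<epsilon> < \<bar>X d w\<bar>}) \<le> measure (M d) (space (M d) - G d)"
      using X ev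
    proof eventually_elim
      case (elim d)
      interpret prob_space "M d" using M elim by blast
      have "prob {w \<in> space (M d). \<epsilon> < \<bar>X d w\<bar>} \<le> prob (space (M d) - G d)"
        using elim G[of d] by (intro finite_measure_mono) force+
      then show ?case by simp
    qed
  qed
  show "conv_distr_0 M ?\<Phi>1"
    by (rule conv_distr_0I[OF prob meas1], rule lim, use bound in \<open>fast elim: eventually_mono\<close>)
  show "conv_distr_0 M ?\<Phi>2"
    by (rule conv_distr_0I[OF prob meas2], rule lim, use bound in \<open>fast elim: eventually_mono\<close>)
qed

section \<open>Empirical mean and projected variances\<close>

lemma power4_diff_le: "((t - s)\<^sup>2)\<^sup>2 \<le> 8 * (t ^ 4 + s ^ 4)" for s t :: real
proof -
  have sq: "(x + y)\<^sup>2 \<le> 2 * (x\<^sup>2 + y\<^sup>2)" for x y :: real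
    using sum_squares_bound[of x y] by (simp add: power2_sum)
  have "(t - s)\<^sup>2 \<le> 2 * (t\<^sup>2 + s\<^sup>2)" using sq[of t "- s"] by simp
  then have "((t - s)\<^sup>2)\<^sup>2 \<le> (2 * (t\<^sup>2 + s\<^sup>2))\<^sup>2" by (intro power_mono) auto
  also have "\<dots> = 4 * (t\<^sup>2 + s\<^sup>2)\<^sup>2" by (simp only: power_mult_distrib) simp
  also have "\<dots> \<le> 4 * (2 * ((t\<^sup>2)\<^sup>2 + (s\<^sup>2)\<^sup>2))" using sq[of "t\<^sup>2" "s\<^sup>2"] by (intro mult_left_mono) auto
  finally show ?thesis by simp
qed

context conditioned_gauss
begin

text \<open>Centred at the exact mean and variance, so that it integrates to zero under the
  conditioned law and sample averages of it are sums of independent centred terms.\<close>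

definition centered_square :: "(nat \<Rightarrow> real) \<Rightarrow> (nat \<Rightarrow> real) \<Rightarrow> real" where
  "centered_square u x = (dot d x u - dot d \<mu> u)\<^sup>2 - quad_form d (cov_A d A) u"

lemma borel_measurable_centered_square [measurable]: "centered_square u \<in> borel_measurable (Rd d)"
  unfolding centered_square_def by (measurable; simp)

text \<open>The entropy bound for the empty family of directions.\<close>

lemma mean_A_bound: "dot d \<mu> \<mu> \<le> - 2 * ln p"
  using cond_moments_entropy_bound[of 0 "\<lambda>_ _. 0"] by (simp add: orthonormal_family_dot)

text \<open>The variance of the centred square is at most the fourth moment about the mean, hence 8
  times the sum of the raw fourth moment and the fourth power of the mean along u. The latter is at
  most (2 ln p)^2, by Bessel's inequality for u alone and the bound on |mu|^2.\<close>

lemma centered_square_moments: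
  assumes u: "dot d u u = 1"
  shows "integrable (cond_law d A) (centered_square u)" "(LINT x|cond_law d A. centered_square u x) = 0"
    and "integrable (cond_law d A) (\<lambda>x. centered_square u x * centered_square u x)"
    and "(LINT x|cond_law d A. centered_square u x * centered_square u x)
      \<le> 8 * (512 * exp (1 / 2) / p + (2 * ln p)\<^sup>2)"
proof -
  interpret prob_space "cond_law d A" by (rule prob_space_cond_law)
  let ?q = "\<lambda>x. (dot d x u - dot d \<mu> u)\<^sup>2" and ?V = "quad_form d (cov_A d A) u"
  have one: "measure (cond_law d A) (space (cond_law d A)) = 1" by (rule prob_space)
  have intq: "integrable (cond_law d A) ?q" by (rule integrable_cond_dot_square)
  have q: "(LINT x|cond_law d A. ?q x) = ?V" by (rule quad_form_cov_A[symmetric])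
  show "integrable (cond_law d A) (centered_square u)"
    unfolding centered_square_def using intq by simp
  show "(LINT x|cond_law d A. centered_square u x) = 0"
    unfolding centered_square_def using intq q one by simp
  let ?b = "\<lambda>x. 8 * ((dot d x u) ^ 4 + (dot d \<mu> u) ^ 4)"
  have intb: "integrable (cond_law d A) ?b" using cond_fourth_moment(1)[OF u] by simp
  have q2: "(?q x)\<^sup>2 \<le> ?b x" for x by (rule power4_diff_le)
  have meas: "(\<lambda>x. (?q x)\<^sup>2) \<in> borel_measurable (cond_law d A)"
    using borel_measurable_integrable[OF intq] by (rule borel_measurable_power)
  have intq2: "integrable (cond_law d A) (\<lambda>x. (?q x)\<^sup>2)"
  proof (rule Bochner_Integration.integrable_bound[OF intb meas], rule AE_I2)
    show "norm ((?q x)\<^sup>2) \<le> norm (?b x)" for x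
      using order_trans[OF q2 abs_ge_self, of x] by (simp only: real_norm_def abs_power2)
  qed
  have sq: "centered_square u x * centered_square u x = (?q x)\<^sup>2 - 2 * ?V * ?q x + ?V * ?V" for x
    by (simp add: centered_square_def power2_diff power2_eq_square[of "centered_square u x"]
        flip: power2_eq_square)
  show "integrable (cond_law d A) (\<lambda>x. centered_square u x * centered_square u x)"
    unfolding sq using intq2 intq by simp
  have mu: "(dot d \<mu> u) ^ 4 \<le> (2 * ln p)\<^sup>2"
  proof -
    have "orthonormal_family d 1 (\<lambda>_. u)" using u by (simp add: orthonormal_family_dot)
    from bessel_inequality[OF this, of \<mu>] have "(dot d \<mu> u)\<^sup>2 \<le> - 2 * ln p" using mean_A_bound by simp
    then have "((dot d \<mu> u)\<^sup>2)\<^sup>2 \<le> (- 2 * ln p)\<^sup>2" by (intro power_mono) auto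
    then show ?thesis by (simp flip: power_mult)
  qed
  have "(LINT x|cond_law d A. centered_square u x * centered_square u x)
    = (LINT x|cond_law d A. (?q x)\<^sup>2) - ?V * ?V"
    unfolding sq using intq2 intq q one by simp
  also have "\<dots> \<le> (LINT x|cond_law d A. (?q x)\<^sup>2)" by simp
  also have "\<dots> \<le> (LINT x|cond_law d A. ?b x)" by (rule integral_mono[OF intq2 intb q2])
  also have "\<dots> = 8 * ((LINT x|cond_law d A. (dot d x u) ^ 4) + (dot d \<mu> u) ^ 4)"
    using cond_fourth_moment(1)[OF u] one by simp
  also have "\<dots> \<le> 8 * (512 * exp (1 / 2) / p + (2 * ln p)\<^sup>2)"
    using cond_fourth_moment(2)[OF u] mu by (intro mult_left_mono add_mono) auto
  finally show "(LINT x|cond_law d A. centered_square u x * centered_square u x)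
      \<le> 8 * (512 * exp (1 / 2) / p + (2 * ln p)\<^sup>2)" .
qed

lemma centered_coordinate_moments:
  assumes j: "j < d"
  shows "integrable (cond_law d A) (\<lambda>x. x j - \<mu> j)" "(LINT x|cond_law d A. x j - \<mu> j) = 0"
    and "integrable (cond_law d A) (\<lambda>x. (x j - \<mu> j) * (x j - \<mu> j))"
    and "(LINT x|cond_law d A. (x j - \<mu> j) * (x j - \<mu> j)) \<le> 1 / p"
proof -
  interpret prob_space "cond_law d A" by (rule prob_space_cond_law)
  have one: "measure (cond_law d A) (space (cond_law d A)) = 1" by (rule prob_space)
  note int = integrable_cond_coordinates[OF j j] and mean = mean_A_eq[OF j, symmetric]
  show "integrable (cond_law d A) (\<lambda>x. x j - \<mu> j)" using int(1) by simp
  show "(LINT x|cond_law d A. x j - \<mu> j) = 0" using int(1) mean one by simp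
  have sq: "(x j - \<mu> j) * (x j - \<mu> j) = x j * x j - 2 * \<mu> j * x j + \<mu> j * \<mu> j" for x
    by (simp add: algebra_simps)
  show "integrable (cond_law d A) (\<lambda>x. (x j - \<mu> j) * (x j - \<mu> j))"
    unfolding sq using int by simp
  have "(LINT x|cond_law d A. (x j - \<mu> j) * (x j - \<mu> j)) = (LINT x|cond_law d A. x j * x j) - \<mu> j * \<mu> j"
    unfolding sq using int mean one by simp
  also have "\<dots> \<le> (LINT x|cond_law d A. x j * x j)" by simp
  also have "\<dots> \<le> (LINT x|std_gauss_measure d. x j * x j) / p"
    by (rule integral_cond_law_le) (use std_gauss_moments(3)[OF j j] in auto)
  also have "\<dots> = 1 / p" using std_gauss_moments(4)[OF j j] by simp
  finally show "(LINT x|cond_law d A. (x j - \<mu> j) * (x j - \<mu> j)) \<le> 1 / p" .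
qed

end

text \<open>Stated as a nonnegative integral, so that summing over directions or coordinates and
  integrating out random directions raise no question of integrability.\<close>

lemma (in prob_space) sample_mean_second_moment:
  fixes Y :: "nat \<Rightarrow> 'a \<Rightarrow> 'b" and h :: "'b \<Rightarrow> real"
  assumes indep: "indep_vars (\<lambda>_. S) Y UNIV" and law: "\<And>i. distr M S (Y i) = Q"
    and h: "integrable Q h" "(LINT x|Q. h x) = 0"
    and h2: "integrable Q (\<lambda>x. h x * h x)" "(LINT x|Q. h x * h x) \<le> C"
    and n: "n > 0"
  shows "(\<integral>\<^sup>+w. ennreal (((\<Sum>i<n. h (Y i w)) / real n)\<^sup>2) \<partial>M) \<le> ennreal (C / real n)"
proof -
  have Y [measurable]: "Y i \<in> measurable M S" for i using indep by (simp add: indep_vars_def)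
  have sets_Q: "sets Q = sets S" using law[of 0] by (metis sets_distr)
  have hS [measurable]: "h \<in> borel_measurable S"
    using borel_measurable_integrable[OF h(1)] by (simp add: measurable_cong_sets[OF sets_Q refl])
  have trans: "integrable M (\<lambda>w. g (Y i w))" "(LINT w|M. g (Y i w)) = (LINT x|Q. g x)"
    if "integrable Q g" for i and g :: "'b \<Rightarrow> real"
  proof -
    have g [measurable]: "g \<in> borel_measurable S"
      using borel_measurable_integrable[OF that] by (simp add: measurable_cong_sets[OF sets_Q refl])
    show "integrable M (\<lambda>w. g (Y i w))" using integrable_distr[OF Y, of i g] that by (simp add: law)
    show "(LINT w|M. g (Y i w)) = (LINT x|Q. g x)" using integral_distr[OF Y g, of i] by (simp add: law)
  qed
  have two: "integrable M (\<lambda>w. h (Y i w) * h (Y j w)) \<and> (LINT w|M. h (Y i w) * h (Y j w)) = 0"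
    if "i \<noteq> j" for i j
  proof -
    have "indep_vars (\<lambda>_. borel) (\<lambda>i w. h (Y i w)) {i, j}"
      by (rule indep_vars_subset[OF indep_vars_compose2[OF indep]]) auto
    note iv = this trans(1)[OF h(1)]
    have "integrable M (\<lambda>w. \<Prod>k\<in>{i, j}. h (Y k w))"
      by (rule indep_vars_integrable) (use iv in auto)
    moreover have "(LINT w|M. (\<Prod>k\<in>{i, j}. h (Y k w))) = (\<Prod>k\<in>{i, j}. LINT w|M. h (Y k w))"
      by (rule indep_vars_lebesgue_integral) (use iv in auto)
    ultimately show ?thesis using that trans(2)[OF h(1)] h(2) by simp
  qed
  have int: "integrable M (\<lambda>w. h (Y i w) * h (Y j w))" for i j
    using two[of i j] trans(1)[OF h2(1), of i] by (cases "i = j") auto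
  have bound: "(LINT w|M. h (Y i w) * h (Y i w)) \<le> C" for i
    using trans(2)[OF h2(1), of i] h2(2) by simp
  note sm = second_moment_uncorrelated_sum[of n "\<lambda>i w. h (Y i w)" C, OF int _ bound]
  have "integrable M (\<lambda>w. (\<Sum>i<n. h (Y i w))\<^sup>2 / (real n)\<^sup>2)" using sm(1) two by simp
  then have "(\<integral>\<^sup>+w. ennreal ((\<Sum>i<n. h (Y i w))\<^sup>2 / (real n)\<^sup>2) \<partial>M)
    = ennreal (LINT w|M. (\<Sum>i<n. h (Y i w))\<^sup>2 / (real n)\<^sup>2)"
    by (intro nn_integral_eq_integral) auto
  also have "(LINT w|M. (\<Sum>i<n. h (Y i w))\<^sup>2 / (real n)\<^sup>2) \<le> real n * C / (real n)\<^sup>2"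
    using sm(2) two by (simp add: divide_right_mono)
  also have "real n * C / (real n)\<^sup>2 = C / real n" using n by (simp add: power2_eq_square)
  finally show ?thesis by (simp add: power_divide ennreal_leI)
qed

text \<open>Conditioning on X in elementary form: under independence the joint law is a product, and
  Tonelli's theorem freezes X. A bound for every fixed family of directions thereby passes to random
  ones.\<close>

lemma (in prob_space) nn_integral_indep_le:
  assumes indep: "indep_var S X T Y" and F: "F \<in> borel_measurable (S \<Otimes>\<^sub>M T)"
    and le: "\<And>w. w \<in> space M \<Longrightarrow> (\<integral>\<^sup>+w'. F (X w, Y w') \<partial>M) \<le> b"
  shows "(\<integral>\<^sup>+w. F (X w, Y w) \<partial>M) \<le> b"
proof -
  have X [measurable]: "X \<in> measurable M S" and Y [measurable]: "Y \<in> measurable M T"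
    using indep by (auto dest: indep_var_rv1 indep_var_rv2)
  note [measurable] = F
  interpret T: prob_space "distr M T Y" by (rule prob_space_distr) fact
  have F': "F \<in> borel_measurable (distr M S X \<Otimes>\<^sub>M distr M T Y)"
    using F by (simp cong: measurable_cong_sets)
  have "(\<integral>\<^sup>+w. F (X w, Y w) \<partial>M) = (\<integral>\<^sup>+z. F z \<partial>distr M (S \<Otimes>\<^sub>M T) (\<lambda>w. (X w, Y w)))"
    by (simp add: nn_integral_distr)
  also have "\<dots> = (\<integral>\<^sup>+z. F z \<partial>(distr M S X \<Otimes>\<^sub>M distr M T Y))"
    using indep by (simp add: indep_var_distribution_eq)
  also have "\<dots> = (\<integral>\<^sup>+x. \<integral>\<^sup>+y. F (x, y) \<partial>distr M T Y \<partial>distr M S X)"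
    by (rule T.nn_integral_fst[OF F', symmetric])
  also have "\<dots> = (\<integral>\<^sup>+w. \<integral>\<^sup>+y. F (X w, y) \<partial>distr M T Y \<partial>M)"
  proof (rule nn_integral_distr[OF X])
    show "(\<lambda>x. \<integral>\<^sup>+y. F (x, y) \<partial>distr M T Y) \<in> borel_measurable (distr M S X)"
      by (rule T.borel_measurable_nn_integral_fst[OF F'])
  qed
  also have "\<dots> = (\<integral>\<^sup>+w. \<integral>\<^sup>+w'. F (X w, Y w') \<partial>M \<partial>M)"
  proof (rule nn_integral_cong)
    fix w assume "w \<in> space M"
    then have "X w \<in> space S" using X by (rule measurable_space[rotated])
    then have "(\<lambda>y. F (X w, y)) \<in> borel_measurable T" using F by (rule measurable_Pair2[rotated])
    then have "(\<lambda>y. F (X w, y)) \<in> borel_measurable (distr M T Y)" by simp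
    then show "(\<integral>\<^sup>+y. F (X w, y) \<partial>distr M T Y) = (\<integral>\<^sup>+w'. F (X w, Y w') \<partial>M)"
      by (rule nn_integral_distr[OF Y])
  qed
  also have "\<dots> \<le> (\<integral>\<^sup>+w. b \<partial>M)" by (rule nn_integral_mono) (rule le)
  also have "\<dots> = b" by (simp add: emeasure_space_1)
  finally show ?thesis .
qed

lemma (in prob_space) prob_gt_le:
  fixes X :: "'a \<Rightarrow> real"
  assumes [measurable]: "X \<in> borel_measurable M"
    and le: "(\<integral>\<^sup>+w. ennreal (X w) \<partial>M) \<le> ennreal b" and b: "0 \<le> b" and \<eta>: "\<eta> > 0"
  shows "prob {w \<in> space M. X w > \<eta>} \<le> b / \<eta>"
proof -
  let ?E = "{w \<in> space M. X w > \<eta>}"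
  have "ennreal \<eta> * emeasure M ?E = (\<integral>\<^sup>+w. ennreal \<eta> * indicator ?E w \<partial>M)"
    by (simp add: nn_integral_cmult_indicator)
  also have "\<dots> \<le> (\<integral>\<^sup>+w. ennreal (X w) \<partial>M)"
    by (rule nn_integral_mono) (auto simp: indicator_def intro!: ennreal_leI)
  also note le
  finally have "ennreal (\<eta> * prob ?E) \<le> ennreal b"
    using \<eta> by (simp add: emeasure_eq_measure ennreal_mult)
  then have "\<eta> * prob ?E \<le> b" using b by (simp add: ennreal_le_iff)
  then show ?thesis using \<eta> by (simp add: field_simps)
qed

lemma dot_emp_mean: "dot d (emp_mean n Y) u = (\<Sum>i<n. dot d (Y i) u) / real n"
proof -
  have "dot d (emp_mean n Y) u = (\<Sum>j<d. \<Sum>i<n. Y i j * u j) / real n"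
    by (simp add: dot_def emp_mean_def sum_divide_distrib sum_distrib_right)
  also have "(\<Sum>j<d. \<Sum>i<n. Y i j * u j) = (\<Sum>i<n. \<Sum>j<d. Y i j * u j)" by (rule sum.swap)
  finally show ?thesis by (simp add: dot_def)
qed

lemma quad_form_emp_cov:
  "quad_form d (emp_cov d n Y) u = (\<Sum>i<n. (dot d (Y i) u)\<^sup>2) / real n - (dot d (emp_mean n Y) u)\<^sup>2"
proof -
  have "quad_form d (emp_cov d n Y) u = (\<Sum>a<d. \<Sum>b<d. u a * emp_cov d n Y $$ (a, b) * u b)"
    by (rule quad_form_eq_sum) (simp add: emp_cov_def)
  also have "\<dots> = (\<Sum>a<d. \<Sum>b<d. (\<Sum>i<n. u a * u b * (Y i a * Y i b)) / real n
      - u a * u b * (emp_mean n Y a * emp_mean n Y b))"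
    by (intro sum.cong refl) (simp add: emp_cov_def algebra_simps sum_distrib_left)
  also have "\<dots> = (\<Sum>a<d. \<Sum>b<d. \<Sum>i<n. u a * u b * (Y i a * Y i b)) / real n
      - (dot d (emp_mean n Y) u)\<^sup>2"
    by (simp add: sum_subtractf dot_square sum_divide_distrib)
  also have "(\<Sum>a<d. \<Sum>b<d. \<Sum>i<n. u a * u b * (Y i a * Y i b)) = (\<Sum>a<d. \<Sum>i<n. \<Sum>b<d. u a * u b * (Y i a * Y i b))"
    by (intro sum.cong refl sum.swap)
  also have "\<dots> = (\<Sum>i<n. \<Sum>a<d. \<Sum>b<d. u a * u b * (Y i a * Y i b))" by (rule sum.swap)
  finally show ?thesis by (simp add: dot_square)
qed

text \<open>An empirical variance does not change when the data are recentred, so s is arbitrary.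
  With s the exact mean, the error splits into an average of centred terms minus a squared error of
  the mean; with s the empirical mean, nonnegativity becomes visible.\<close>

lemma quad_form_emp_cov_centered:
  assumes "n > 0"
  shows "quad_form d (emp_cov d n Y) u - V
    = (\<Sum>i<n. (dot d (Y i) u - s)\<^sup>2 - V) / real n - (dot d (emp_mean n Y) u - s)\<^sup>2"
proof -
  have "(\<Sum>i<n. (dot d (Y i) u - s)\<^sup>2 - V)
    = (\<Sum>i<n. (dot d (Y i) u)\<^sup>2) - 2 * s * (\<Sum>i<n. dot d (Y i) u) + real n * (s\<^sup>2 - V)"
    by (simp add: power2_diff sum.distrib sum_subtractf sum_distrib_left algebra_simps)
  then have "(\<Sum>i<n. (dot d (Y i) u - s)\<^sup>2 - V) / real n
    = (\<Sum>i<n. (dot d (Y i) u)\<^sup>2) / real n - 2 * s * dot d (emp_mean n Y) u + (s\<^sup>2 - V)"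
    using assms by (simp add: dot_emp_mean add_divide_distrib diff_divide_distrib)
  then show ?thesis by (simp add: quad_form_emp_cov power2_diff)
qed

lemma quad_form_emp_cov_nonneg: "0 \<le> quad_form d (emp_cov d n Y) u"
proof (cases "n = 0")
  case True
  then show ?thesis by (simp add: quad_form_emp_cov dot_emp_mean)
next
  case False
  let ?s = "dot d (emp_mean n Y) u"
  have "quad_form d (emp_cov d n Y) u - 0 = (\<Sum>i<n. (dot d (Y i) u - ?s)\<^sup>2 - 0) / real n - (?s - ?s)\<^sup>2"
    by (rule quad_form_emp_cov_centered) (use False in simp)
  then have "quad_form d (emp_cov d n Y) u = (\<Sum>i<n. (dot d (Y i) u - ?s)\<^sup>2) / real n" by simp
  then show ?thesis by (simp add: sum_nonneg)
qed

section \<open>Fluctuations of the sample and their effect on the parameters\<close>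

context conditioned_gauss
begin

text \<open>Only the independent-average part of the variance errors, summed over all directions;
  the correction for the estimated mean is handled separately, through the error of the
  mean.\<close>

definition variance_fluctuation ::
    "nat \<Rightarrow> nat \<Rightarrow> (nat \<Rightarrow> nat \<Rightarrow> real) \<Rightarrow> (nat \<Rightarrow> nat \<Rightarrow> real) \<Rightarrow> real" where
  "variance_fluctuation r n D Y = (\<Sum>k<r. ((\<Sum>i<n. centered_square (D k) (Y i)) / real n)\<^sup>2)"

text \<open>For n > 0 this is the squared Euclidean distance between the empirical and the exact
  mean.\<close>

definition mean_fluctuation :: "nat \<Rightarrow> (nat \<Rightarrow> nat \<Rightarrow> real) \<Rightarrow> real" where
  "mean_fluctuation n Y = (\<Sum>j<d. ((\<Sum>i<n. Y i j - \<mu> j) / real n)\<^sup>2)"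

definition fourth_moment_const :: real where
  "fourth_moment_const = 8 * (512 * exp (1 / 2) / p + (2 * ln p)\<^sup>2)"

lemma fourth_moment_const_nonneg: "0 \<le> fourth_moment_const"
  using p_pos by (simp add: fourth_moment_const_def)

text \<open>Measurability jointly in the directions and the whole sample, as required to integrate
  out the sample for frozen directions.\<close>

lemma borel_measurable_variance_fluctuation:
  "(\<lambda>z. variance_fluctuation r n (fst z) (snd z))
    \<in> borel_measurable (Pi\<^sub>M {..<r} (\<lambda>_. Rd d) \<Otimes>\<^sub>M Pi\<^sub>M UNIV (\<lambda>_. Rd d))"
proof -
  let ?N = "Pi\<^sub>M {..<r} (\<lambda>_. Rd d) \<Otimes>\<^sub>M Pi\<^sub>M UNIV (\<lambda>_. Rd d)"
  have D: "(\<lambda>z. fst z k j) \<in> borel_measurable ?N" if "k < r" "j < d" for k j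
  proof -
    have "(\<lambda>z. fst z k) \<in> measurable ?N (Rd d)"
      by (rule measurable_compose[OF measurable_fst measurable_component_singleton]) (use that in simp)
    then show ?thesis by (rule measurable_compose[OF _ measurable_Rd_component[OF that(2)]])
  qed
  have Y: "(\<lambda>z. snd z i j) \<in> borel_measurable ?N" if "j < d" for i j
  proof -
    have "(\<lambda>z. snd z i) \<in> measurable ?N (Rd d)"
      by (rule measurable_compose[OF measurable_snd measurable_component_singleton]) simp
    then show ?thesis by (rule measurable_compose[OF _ measurable_Rd_component[OF that]])
  qed
  have q: "(\<lambda>z. quad_form d (cov_A d A) (fst z k)) \<in> borel_measurable ?N" if "k < r" for k
  proof -
    have "cov_A d A \<in> carrier_mat d d" by (simp add: cov_A_def)
    from quad_form_eq_sum[OF this]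
    have eq: "(\<lambda>z. quad_form d (cov_A d A) (fst z k))
      = (\<lambda>z. \<Sum>i<d. \<Sum>j<d. fst z k i * cov_A d A $$ (i, j) * fst z k j)" by simp
    show ?thesis unfolding eq
      by (intro borel_measurable_sum borel_measurable_times D[OF that] borel_measurable_const) auto
  qed
  have cs: "(\<lambda>z. centered_square (fst z k) (snd z i)) \<in> borel_measurable ?N" if k: "k < r" for k i
  proof -
    have 1: "(\<lambda>z. dot d (snd z i) (fst z k)) \<in> borel_measurable ?N"
      by (rule measurable_dot[OF Y D[OF k]])
    have 2: "(\<lambda>z. dot d \<mu> (fst z k)) \<in> borel_measurable ?N"
      by (rule measurable_dot[OF borel_measurable_const D[OF k]])
    show ?thesis unfolding centered_square_def
      by (rule borel_measurable_diff[OF borel_measurable_power[OF borel_measurable_diff[OF 1 2]] q[OF k]])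
  qed
  show ?thesis unfolding variance_fluctuation_def
  proof (rule borel_measurable_sum)
    fix k assume "k \<in> {..<r}"
    then have k: "k < r" by simp
    show "(\<lambda>z. ((\<Sum>i<n. centered_square (fst z k) (snd z i)) / real n)\<^sup>2) \<in> borel_measurable ?N"
      by (rule borel_measurable_power[OF borel_measurable_divide[OF borel_measurable_sum[OF cs[OF k]] borel_measurable_const]])
  qed
qed

context
  fixes M :: "'w measure" and Y :: "nat \<Rightarrow> 'w \<Rightarrow> nat \<Rightarrow> real" and n :: nat
  assumes M: "prob_space M"
    and indep: "prob_space.indep_vars M (\<lambda>_. Rd d) Y UNIV"
    and law: "\<And>i. distributed M (Rd d) (Y i) (\<lambda>x. ennreal (f_cond d A x))"
    and n: "n > 0"
begin

interpretation prob_space M by (rule M)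

lemma distr_sample: "distr M (Rd d) (Y i) = cond_law d A"
  using distributed_distr_eq_density[OF law] by (simp add: cond_law_def)

lemma nn_integral_mean_fluctuation:
  "(\<integral>\<^sup>+w. ennreal (mean_fluctuation n (\<lambda>i. Y i w)) \<partial>M) \<le> ennreal (real d / (p * real n))"
proof -
  have Y [measurable]: "Y i \<in> measurable M (Rd d)" for i using indep by (simp add: indep_vars_def)
  let ?t = "\<lambda>j w. ((\<Sum>i<n. Y i w j - \<mu> j) / real n)\<^sup>2"
  have "(\<integral>\<^sup>+w. ennreal (mean_fluctuation n (\<lambda>i. Y i w)) \<partial>M) = (\<integral>\<^sup>+w. (\<Sum>j<d. ennreal (?t j w)) \<partial>M)"
    by (simp add: mean_fluctuation_def sum_ennreal)
  also have "\<dots> = (\<Sum>j<d. \<integral>\<^sup>+w. ennreal (?t j w) \<partial>M)"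
    by (rule nn_integral_sum) measurable
  also have "\<dots> \<le> (\<Sum>j<d. ennreal (1 / p / real n))"
    by (intro sum_mono sample_mean_second_moment[OF indep distr_sample] centered_coordinate_moments n) auto
  also have "\<dots> = ennreal (\<Sum>j<d. 1 / p / real n)" using p_pos by (intro sum_ennreal) auto
  also have "(\<Sum>j<d. 1 / p / real n) = real d / (p * real n)" by simp
  finally show ?thesis .
qed

lemma nn_integral_variance_fluctuation_fixed:
  assumes "orthonormal_family d r D"
  shows "(\<integral>\<^sup>+w. ennreal (variance_fluctuation r n D (\<lambda>i. Y i w)) \<partial>M)
    \<le> ennreal (real r * fourth_moment_const / real n)"
proof -
  have Y [measurable]: "Y i \<in> measurable M (Rd d)" for i using indep by (simp add: indep_vars_def)
  let ?t = "\<lambda>k w. ((\<Sum>i<n. centered_square (D k) (Y i w)) / real n)\<^sup>2"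
  have unit: "dot d (D k) (D k) = 1" if "k < r" for k
    using assms that by (simp add: orthonormal_family_dot)
  have "(\<integral>\<^sup>+w. ennreal (variance_fluctuation r n D (\<lambda>i. Y i w)) \<partial>M) = (\<integral>\<^sup>+w. (\<Sum>k<r. ennreal (?t k w)) \<partial>M)"
    by (simp add: variance_fluctuation_def sum_ennreal)
  also have "\<dots> = (\<Sum>k<r. \<integral>\<^sup>+w. ennreal (?t k w) \<partial>M)"
    by (rule nn_integral_sum) measurable
  also have "\<dots> \<le> (\<Sum>k<r. ennreal (fourth_moment_const / real n))"
    unfolding fourth_moment_const_def
    by (intro sum_mono sample_mean_second_moment[OF indep distr_sample] centered_square_moments unit n) auto
  also have "\<dots> = ennreal (\<Sum>k<r. fourth_moment_const / real n)"
    using fourth_moment_const_nonneg by (intro sum_ennreal) auto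
  also have "(\<Sum>k<r. fourth_moment_const / real n) = real r * fourth_moment_const / real n" by simp
  finally show ?thesis .
qed

text \<open>Markov's inequality for each fluctuation. The variance part is averaged over the sample
  with frozen directions; the mean part involves no direction.\<close>

lemma fluctuation_event:
  assumes indep_D: "indep_var (Pi\<^sub>M {..<r} (\<lambda>_. Rd d)) (\<lambda>w. \<lambda>k\<in>{..<r}. D k w)
      (Pi\<^sub>M UNIV (\<lambda>_. Rd d)) (\<lambda>w i. Y i w)"
    and on: "\<And>w. w \<in> space M \<Longrightarrow> orthonormal_family d r (\<lambda>k. D k w)" and \<eta>: "\<eta> > 0"
  defines "G \<equiv> {w \<in> space M. variance_fluctuation r n (\<lambda>k. D k w) (\<lambda>i. Y i w) \<le> \<eta>
                \<and> mean_fluctuation n (\<lambda>i. Y i w) \<le> \<eta>}"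
  shows "G \<in> sets M"
    and "prob (space M - G) \<le> (real r * fourth_moment_const / real n + real d / (p * real n)) / \<eta>"
proof -
  have Y [measurable]: "Y i \<in> measurable M (Rd d)" for i using indep by (simp add: indep_vars_def)
  let ?X = "\<lambda>w. \<lambda>k\<in>{..<r}. D k w"
  let ?S1 = "\<lambda>w. variance_fluctuation r n (\<lambda>k. D k w) (\<lambda>i. Y i w)"
  let ?S2 = "\<lambda>w. mean_fluctuation n (\<lambda>i. Y i w)"
  \<comment> \<open>Restriction to the first r indices makes the family a point of the product
    space; the fluctuation only reads those indices.\<close>
  have eq: "variance_fluctuation r n (?X w) y = variance_fluctuation r n (\<lambda>k. D k w) y" for w y
    by (simp add: variance_fluctuation_def)
  have S2 [measurable]: "?S2 \<in> borel_measurable M" unfolding mean_fluctuation_def by measurable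
  have "(\<lambda>w. (?X w, \<lambda>i. Y i w)) \<in> measurable M (Pi\<^sub>M {..<r} (\<lambda>_. Rd d) \<Otimes>\<^sub>M Pi\<^sub>M UNIV (\<lambda>_. Rd d))"
    using indep_D by (intro measurable_Pair) (auto dest: indep_var_rv1 indep_var_rv2)
  from measurable_compose[OF this borel_measurable_variance_fluctuation[of r n]]
  have S1 [measurable]: "?S1 \<in> borel_measurable M" by (simp add: eq)
  show "G \<in> sets M" unfolding G_def by measurable
  have "(\<integral>\<^sup>+w. ennreal (?S1 w) \<partial>M) \<le> ennreal (real r * fourth_moment_const / real n)"
  proof -
    have "(\<integral>\<^sup>+w. ennreal (variance_fluctuation r n (fst (?X w, \<lambda>i. Y i w)) (snd (?X w, \<lambda>i. Y i w))) \<partial>M)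
      \<le> ennreal (real r * fourth_moment_const / real n)"
    proof (rule nn_integral_indep_le[OF indep_D, where F="\<lambda>z. ennreal (variance_fluctuation r n (fst z) (snd z))"])
      show "(\<lambda>z. ennreal (variance_fluctuation r n (fst z) (snd z)))
        \<in> borel_measurable (Pi\<^sub>M {..<r} (\<lambda>_. Rd d) \<Otimes>\<^sub>M Pi\<^sub>M UNIV (\<lambda>_. Rd d))"
        by (rule measurable_compose[OF borel_measurable_variance_fluctuation measurable_ennreal])
      fix w assume "w \<in> space M"
      from nn_integral_variance_fluctuation_fixed[OF on[OF this]]
      show "(\<integral>\<^sup>+w'. ennreal (variance_fluctuation r n (fst (?X w, \<lambda>i. Y i w')) (snd (?X w, \<lambda>i. Y i w'))) \<partial>M)
        \<le> ennreal (real r * fourth_moment_const / real n)" by (simp only: fst_conv snd_conv eq)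
    qed
    then show ?thesis by (simp only: fst_conv snd_conv eq)
  qed
  from prob_gt_le[OF S1 this _ \<eta>]
  have 1: "prob {w \<in> space M. ?S1 w > \<eta>} \<le> real r * fourth_moment_const / real n / \<eta>"
    using fourth_moment_const_nonneg by simp
  from prob_gt_le[OF S2 nn_integral_mean_fluctuation _ \<eta>]
  have 2: "prob {w \<in> space M. ?S2 w > \<eta>} \<le> real d / (p * real n) / \<eta>"
    using p_pos by simp
  have "space M - G = {w \<in> space M. ?S1 w > \<eta>} \<union> {w \<in> space M. ?S2 w > \<eta>}"
    by (auto simp: G_def)
  then have "prob (space M - G) \<le> prob {w \<in> space M. ?S1 w > \<eta>} + prob {w \<in> space M. ?S2 w > \<eta>}"
    by (simp add: measure_Un_le)
  with 1 2 show "prob (space M - G) \<le> (real r * fourth_moment_const / real n + real d / (p * real n)) / \<eta>"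
    by (simp add: add_divide_distrib)
qed

end

text \<open>Purely deterministic. The error of each variance is \<open>?x k\<close> -
  \<open>?y k\<close>, where the squares of the \<open>?x k\<close> sum to at most
  \<open>\<eta>\<close> by assumption and those of the \<open>?y k\<close> by Bessel's inequality.
  This gives a total squared error of at most 4 \<open>\<eta>\<close>, from which all constants
  follow.\<close>

lemma empirical_parameter_bounds:
  fixes Y :: "nat \<Rightarrow> nat \<Rightarrow> real"
  assumes on: "orthonormal_family d r D" and n: "n > 0" and a: "a > 0"
    and V: "\<And>k. k < r \<Longrightarrow> a \<le> quad_form d (cov_A d A) (D k)"
    and VB: "(\<Sum>k<r. (quad_form d (cov_A d A) (D k) - 1)\<^sup>2) \<le> B"
    and \<eta>: "\<eta> \<le> 1" "16 * \<eta> \<le> a\<^sup>2"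
    and S1: "variance_fluctuation r n D Y \<le> \<eta>" and S2: "mean_fluctuation n Y \<le> \<eta>"
  shows "\<And>k. k < r \<Longrightarrow> a / 2 \<le> quad_form d (emp_cov d n Y) (D k)"
    and "(\<Sum>k<r. (quad_form d (emp_cov d n Y) (D k) - 1)\<^sup>2) \<le> 8 + 2 * B"
    and "dot d (emp_mean n Y) (emp_mean n Y) \<le> 2 + 2 * dot d \<mu> \<mu>"
proof -
  let ?V = "\<lambda>k. quad_form d (cov_A d A) (D k)" and ?W = "\<lambda>k. quad_form d (emp_cov d n Y) (D k)"
  let ?e = "\<lambda>i. emp_mean n Y i - \<mu> i"
  have sq: "(x - y)\<^sup>2 \<le> 2 * x\<^sup>2 + 2 * y\<^sup>2" for x y :: real
    using sum_squares_bound[of x "- y"] by (simp add: power2_diff)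
  have \<eta>0: "0 \<le> \<eta>"
    using S2 by (rule order_trans[rotated]) (simp add: mean_fluctuation_def sum_nonneg)
  have e: "dot d ?e ?e \<le> \<eta>"
  proof -
    have "(\<Sum>i<n. Y i j - \<mu> j) / real n = ?e j" for j
      using n by (simp add: emp_mean_def sum_subtractf diff_divide_distrib)
    then have "mean_fluctuation n Y = dot d ?e ?e"
      by (simp add: mean_fluctuation_def dot_def power2_eq_square)
    then show ?thesis using S2 by simp
  qed
  let ?x = "\<lambda>k. (\<Sum>i<n. centered_square (D k) (Y i)) / real n" and ?y = "\<lambda>k. (dot d ?e (D k))\<^sup>2"
  have W: "?W k - ?V k = ?x k - ?y k" for k
    unfolding centered_square_def dot_diff_left by (rule quad_form_emp_cov_centered[OF n])
  have y: "(\<Sum>k<r. ?y k) \<le> \<eta>" using bessel_inequality[OF on, of ?e] e by linarith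
  have yk: "?y k \<le> \<eta>" if "k < r" for k
  proof -
    have "?y k \<le> (\<Sum>k<r. ?y k)" using that by (intro member_le_sum) auto
    then show ?thesis using y by linarith
  qed
  \<comment> \<open>Each \<open>?y k\<close> is at most \<open>\<eta>\<close> <= 1, so squaring it
    does not enlarge the sum.\<close>
  have "(\<Sum>k<r. (?y k)\<^sup>2) \<le> (\<Sum>k<r. \<eta> * ?y k)"
  proof (rule sum_mono)
    fix k assume "k \<in> {..<r}"
    then have "?y k * ?y k \<le> \<eta> * ?y k" by (intro mult_right_mono yk) auto
    then show "(?y k)\<^sup>2 \<le> \<eta> * ?y k" by (simp only: power2_eq_square[of "?y k"])
  qed
  also have "\<dots> = \<eta> * (\<Sum>k<r. ?y k)" by (rule sum_distrib_left[symmetric])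
  also have "\<dots> \<le> 1 * \<eta>" using y \<eta>(1) \<eta>0 by (intro mult_mono) (auto intro: sum_nonneg)
  finally have y2: "(\<Sum>k<r. (?y k)\<^sup>2) \<le> \<eta>" by simp
  have "(\<Sum>k<r. (?W k - ?V k)\<^sup>2) \<le> (\<Sum>k<r. 2 * (?x k)\<^sup>2 + 2 * (?y k)\<^sup>2)"
    unfolding W by (rule sum_mono) (rule sq)
  also have "\<dots> = 2 * (\<Sum>k<r. (?x k)\<^sup>2) + 2 * (\<Sum>k<r. (?y k)\<^sup>2)"
    by (simp add: sum.distrib sum_distrib_left)
  also have "\<dots> \<le> 4 * \<eta>" using S1 y2 unfolding variance_fluctuation_def by linarith
  finally have diff: "(\<Sum>k<r. (?W k - ?V k)\<^sup>2) \<le> 4 * \<eta>" .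
  show "a / 2 \<le> ?W k" if k: "k < r" for k
  proof -
    \<comment> \<open>One squared error is at most the total 4 \<open>\<eta>\<close>, which 16
      \<open>\<eta>\<close> <= a^2 turns into (a / 2)^2.\<close>
    have "(?V k - ?W k)\<^sup>2 \<le> (\<Sum>k<r. (?W k - ?V k)\<^sup>2)"
      unfolding power2_commute[of "?V k"] using k by (intro member_le_sum) auto
    then have "(?V k - ?W k)\<^sup>2 \<le> (a / 2)\<^sup>2" using diff \<eta>(2) by (simp add: power_divide)
    then have "?V k - ?W k \<le> a / 2" by (rule power2_le_imp_le) (use a in simp)
    then show ?thesis using V[OF k] by linarith
  qed
  have "(?W k - 1)\<^sup>2 \<le> 2 * (?W k - ?V k)\<^sup>2 + 2 * (?V k - 1)\<^sup>2" for k
    using sq[of "?W k - ?V k" "1 - ?V k"] by (simp add: power2_commute[of 1])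
  then have "(\<Sum>k<r. (?W k - 1)\<^sup>2) \<le> (\<Sum>k<r. 2 * (?W k - ?V k)\<^sup>2 + 2 * (?V k - 1)\<^sup>2)"
    by (intro sum_mono)
  also have "\<dots> = 2 * (\<Sum>k<r. (?W k - ?V k)\<^sup>2) + 2 * (\<Sum>k<r. (?V k - 1)\<^sup>2)"
    by (simp add: sum.distrib sum_distrib_left)
  finally show "(\<Sum>k<r. (?W k - 1)\<^sup>2) \<le> 8 + 2 * B" using diff VB \<eta>(1) by linarith
  have "dot d (emp_mean n Y) (emp_mean n Y) \<le> (\<Sum>i<d. 2 * (?e i * ?e i) + 2 * (\<mu> i * \<mu> i))"
    unfolding dot_def
  proof (rule sum_mono)
    fix i
    show "emp_mean n Y i * emp_mean n Y i \<le> 2 * (?e i * ?e i) + 2 * (\<mu> i * \<mu> i)"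
      using sq[of "?e i" "- \<mu> i"] by (simp flip: power2_eq_square)
  qed
  also have "\<dots> = 2 * dot d ?e ?e + 2 * dot d \<mu> \<mu>"
    by (simp add: dot_def sum.distrib sum_distrib_left)
  finally show "dot d (emp_mean n Y) (emp_mean n Y) \<le> 2 + 2 * dot d \<mu> \<mu>" using e \<eta>(1) by linarith
qed

text \<open>C need only dominate - 2 ln p, so that a single C obtained from the infimum of the
  probabilities serves all dimensions.\<close>

lemma cond_parameter_bounds:
  assumes on: "orthonormal_family d r D" and C: "- 2 * ln p \<le> C"
  shows "\<And>k. k < r \<Longrightarrow> 0 < quad_form d (cov_A d A) (D k)"
    and "\<And>k. k < r \<Longrightarrow> exp (- (C + 1)) \<le> quad_form d (cov_A d A) (D k)"
    and "(\<Sum>k<r. (quad_form d (cov_A d A) (D k) - 1)\<^sup>2) \<le> (2 + sqrt C)\<^sup>2 * C"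
    and "dot d \<mu> \<mu> \<le> C"
proof -
  show pos: "0 < quad_form d (cov_A d A) (D k)" if "k < r" for k
    using on that by (intro cond_variance_pos) (simp add: orthonormal_family_dot)
  have le: "dot d \<mu> \<mu> + (\<Sum>k<r. quad_form d (cov_A d A) (D k) - 1 - ln (quad_form d (cov_A d A) (D k))) \<le> C"
    using cond_moments_entropy_bound[OF on] C by linarith
  note b = entropy_bound_imp_parameter_bounds[of r "\<lambda>k. quad_form d (cov_A d A) (D k)", OF pos dot_self_nonneg le]
  show "exp (- (C + 1)) \<le> quad_form d (cov_A d A) (D k)" if "k < r" for k by (rule b(2)[OF _ that])
  show "(\<Sum>k<r. (quad_form d (cov_A d A) (D k) - 1)\<^sup>2) \<le> (2 + sqrt C)\<^sup>2 * C" by (rule b(3))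
  show "dot d \<mu> \<mu> \<le> C" by (rule b(1))
qed

end

section \<open>Choice of the constants and of the good events\<close>

lemma sets_Collect_all_nonzero:
  fixes X :: "'a \<Rightarrow> nat \<Rightarrow> real"
  assumes X: "\<And>k. k < r \<Longrightarrow> (\<lambda>w. X w k) \<in> borel_measurable N"
  shows "{w \<in> space N. \<forall>k<r. X w k \<noteq> 0} \<in> sets N"
proof -
  have "Measurable.pred N (\<lambda>w. X w k \<noteq> 0)" if "k < r" for k
    using X[OF that] by measurable
  then have "{w \<in> space N. \<forall>k\<in>{..<r}. X w k \<noteq> 0} \<in> sets N"
    by (intro sets.sets_Collect_finite_All) (auto simp: pred_def)
  then show ?thesis by (simp only: Ball_def lessThan_iff)
qed

theorem theorem2p5:
  fixes A :: "nat \<Rightarrow> (nat \<Rightarrow> real) set"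
    and r :: "nat \<Rightarrow> nat"
    and M :: "nat \<Rightarrow> 'w measure"
    and D :: "nat \<Rightarrow> nat \<Rightarrow> 'w \<Rightarrow> nat \<Rightarrow> real"
  assumes "\<And>d. d \<ge> 1 \<Longrightarrow> A d \<in> sets (Rd d)"
    and "(INF d\<in>{1..}. p_f d (A d)) > 0"
    and "\<And>d. d \<ge> 1 \<Longrightarrow> r d \<in> {1..d}"
    and "\<And>d. d \<ge> 1 \<Longrightarrow> prob_space (M d)"
    and "\<And>d k. d \<ge> 1 \<Longrightarrow> k < r d \<Longrightarrow> D d k \<in> measurable (M d) (Rd d)"
    and "\<And>d w. d \<ge> 1 \<Longrightarrow> w \<in> space (M d) \<Longrightarrow> orthonormal_family d (r d) (\<lambda>k. D d k w)"
  shows "efficient M (\<lambda>d w. g_proj d (A d) (r d) (\<lambda>k. D d k w)) A \<and>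
    (\<forall>(n_g :: nat \<Rightarrow> nat) (Y :: nat \<Rightarrow> nat \<Rightarrow> 'w \<Rightarrow> nat \<Rightarrow> real).
       (\<forall>d\<ge>1. prob_space.indep_vars (M d) (\<lambda>_. Rd d) (Y d) UNIV) \<longrightarrow>
       (\<forall>d\<ge>1. \<forall>i. distributed (M d) (Rd d) (Y d i) (\<lambda>x. ennreal (f_cond d (A d) x))) \<longrightarrow>
       (\<forall>d\<ge>1. prob_space.indep_var (M d)
          (Pi\<^sub>M {..<r d} (\<lambda>_. Rd d)) (\<lambda>w. \<lambda>k\<in>{..<r d}. D d k w)
          (Pi\<^sub>M UNIV (\<lambda>_. Rd d)) (\<lambda>w i. Y d i w)) \<longrightarrow>
       filterlim (\<lambda>d. real (n_g d) / (real (r d) * real d)) at_top sequentially \<longrightarrow>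
       efficient M
         (\<lambda>d w. g_proj_hat d (r d) (\<lambda>k. D d k w) (n_g d) (\<lambda>i. Y d i w)) A)"
proof (intro conjI allI impI)
  let ?c = "INF d\<in>{1..}. p_f d (A d)"
  have c: "?c > 0" by fact
  have c_le: "?c \<le> p_f d (A d)" if "d \<ge> 1" for d
  proof (rule cINF_lower)
    show "bdd_below ((\<lambda>d. p_f d (A d)) ` {1..})"
      by (intro bdd_belowI2[of _ 0])
         (simp add: p_f_def set_lebesgue_integral_def std_gauss_nonneg integral_nonneg)
  qed (use that in simp)
  have cond: "conditioned_gauss d (A d)" if "d \<ge> 1" for d
    using assms(1)[OF that] c_le[OF that] c by unfold_locales auto
  define C where "C = - 2 * ln ?c"
  have C: "- 2 * ln (p_f d (A d)) \<le> C" if "d \<ge> 1" for d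
    using c_le[OF that] c by (simp add: C_def)
  define a where "a = exp (- (C + 1))"
  have a: "a > 0" by (simp add: a_def)
  define B where "B = (2 + sqrt C)\<^sup>2 * C"
  note bounds = conditioned_gauss.cond_parameter_bounds[OF cond assms(6) C]
  show "efficient M (\<lambda>d w. g_proj d (A d) (r d) (\<lambda>k. D d k w)) A"
  \<comment> \<open>The exact parameters obey the bounds for every realisation of the directions, so
    the good event is the whole space.\<close>
  proof (rule efficient_proj_gauss[where r=r and D=D and c="?c" and a=a and B="max B C" and G="\<lambda>d. space (M d)"
        and m="\<lambda>d w. mean_A d (A d)" and v="\<lambda>d w k. quad_form d (cov_A d (A d)) (D d k w)"])
    fix d :: nat assume d: "d \<ge> 1"
    show "(\<lambda>w. quad_form d (cov_A d (A d)) (D d k w)) \<in> borel_measurable (M d)" if k: "k < r d" for k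
    proof -
      have "cov_A d (A d) \<in> carrier_mat d d" by (simp add: cov_A_def)
      note eq = quad_form_eq_sum[OF this]
      have [measurable]: "(\<lambda>w. D d k w i) \<in> borel_measurable (M d)" if "i < d" for i
        by (rule measurable_compose[OF assms(5)[OF d k] measurable_Rd_component[OF that]])
      show ?thesis unfolding eq by measurable
    qed
    fix w assume w: "w \<in> space (M d)"
    show "0 < quad_form d (cov_A d (A d)) (D d k w)" if "k < r d" for k
      using bounds(1)[OF d d w d that] .
    then show "g_proj d (A d) (r d) (\<lambda>k. D d k w) =
        proj_gauss_density d (r d) (\<lambda>k. D d k w) (mean_A d (A d)) (\<lambda>k. quad_form d (cov_A d (A d)) (D d k w))"
      unfolding g_proj_def proj_cov_eq_rank_update
      by (intro gauss_density_rank_update assms(6) d w) force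
    show "(\<forall>k<r d. a \<le> quad_form d (cov_A d (A d)) (D d k w)) \<and>
        (\<Sum>k<r d. (quad_form d (cov_A d (A d)) (D d k w) - 1)\<^sup>2) \<le> max B C \<and>
        dot d (mean_A d (A d)) (mean_A d (A d)) \<le> max B C"
      using bounds(2)[OF d d w d] bounds(3)[OF d d w d] bounds(4)[OF d d w d]
      by (auto simp: a_def B_def)
  qed (use assms c c_le a in auto)
  fix n :: "nat \<Rightarrow> nat" and Y :: "nat \<Rightarrow> nat \<Rightarrow> 'w \<Rightarrow> nat \<Rightarrow> real"
  assume "\<forall>d\<ge>1. prob_space.indep_vars (M d) (\<lambda>_. Rd d) (Y d) UNIV"
    and "\<forall>d\<ge>1. \<forall>i. distributed (M d) (Rd d) (Y d i) (\<lambda>x. ennreal (f_cond d (A d) x))"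
    and "\<forall>d\<ge>1. prob_space.indep_var (M d)
          (Pi\<^sub>M {..<r d} (\<lambda>_. Rd d)) (\<lambda>w. \<lambda>k\<in>{..<r d}. D d k w)
          (Pi\<^sub>M UNIV (\<lambda>_. Rd d)) (\<lambda>w i. Y d i w)"
    and n_lim: "filterlim (\<lambda>d. real (n d) / (real (r d) * real d)) at_top sequentially"
  then have indep: "prob_space.indep_vars (M d) (\<lambda>_. Rd d) (Y d) UNIV"
    and law: "distributed (M d) (Rd d) (Y d i) (\<lambda>x. ennreal (f_cond d (A d) x))"
    and indep_D: "prob_space.indep_var (M d)
          (Pi\<^sub>M {..<r d} (\<lambda>_. Rd d)) (\<lambda>w. \<lambda>k\<in>{..<r d}. D d k w)
          (Pi\<^sub>M UNIV (\<lambda>_. Rd d)) (\<lambda>w i. Y d i w)" if "d \<ge> 1" for d i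
    using that by blast+
  have Y: "Y d i \<in> measurable (M d) (Rd d)" if "d \<ge> 1" for d i
    using distributed_measurable[OF law[OF that]] .
  \<comment> \<open>The two entries of the minimum are the two smallness conditions of
    \<open>empirical_parameter_bounds\<close>.\<close>
  define \<eta> where "\<eta> = min 1 (a\<^sup>2 / 16)"
  have \<eta>: "\<eta> > 0" "\<eta> \<le> 1" "16 * \<eta> \<le> a\<^sup>2" using a by (auto simp: \<eta>_def)
  let ?V = "\<lambda>d w k. quad_form d (emp_cov d (n d) (\<lambda>i. Y d i w)) (D d k w)"
  let ?m = "\<lambda>d w. emp_mean (n d) (\<lambda>i. Y d i w)"
  let ?reg = "\<lambda>d w. \<forall>k<r d. ?V d w k \<noteq> 0"
  let ?S1 = "\<lambda>d w. conditioned_gauss.variance_fluctuation d (A d) (r d) (n d) (\<lambda>k. D d k w) (\<lambda>i. Y d i w)"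
  let ?S2 = "\<lambda>d w. conditioned_gauss.mean_fluctuation d (A d) (n d) (\<lambda>i. Y d i w)"
  \<comment> \<open>An empty sample gives no information, so the event is then empty; since n d / (r
    d * d) tends to infinity, this concerns only finitely many d.\<close>
  define G where "G d = (if n d > 0 then {w \<in> space (M d). ?S1 d w \<le> \<eta> \<and> ?S2 d w \<le> \<eta>} else {})" for d
  have V_meas: "(\<lambda>w. ?V d w k) \<in> borel_measurable (M d)" and m_meas: "i < d \<Longrightarrow> (\<lambda>w. ?m d w i) \<in> borel_measurable (M d)"
    if d: "d \<ge> 1" and k: "k < r d" for d k i
  proof -
    have Dm [measurable]: "(\<lambda>w. D d k w i) \<in> borel_measurable (M d)" if "i < d" for i
      by (rule measurable_compose[OF assms(5)[OF d k] measurable_Rd_component[OF that]])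
    have Ym [measurable]: "(\<lambda>w. Y d j w i) \<in> borel_measurable (M d)" if "i < d" for i j
      by (rule measurable_compose[OF Y[OF d] measurable_Rd_component[OF that]])
    have mm: "(\<lambda>w. ?m d w i) \<in> borel_measurable (M d)" if "i < d" for i
      unfolding emp_mean_def using that by measurable
    then show "i < d \<Longrightarrow> (\<lambda>w. ?m d w i) \<in> borel_measurable (M d)" .
    show "(\<lambda>w. ?V d w k) \<in> borel_measurable (M d)"
      unfolding quad_form_emp_cov
      by (intro borel_measurable_diff borel_measurable_divide borel_measurable_sum borel_measurable_power
          measurable_dot Dm Ym mm borel_measurable_const)
  qed
  have reg_sets: "{w \<in> space (M d). ?reg d w} \<in> sets (M d)" if d: "d \<ge> 1" for d
    by (rule sets_Collect_all_nonzero) (rule V_meas[OF d])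
  show "efficient M (\<lambda>d w. g_proj_hat d (r d) (\<lambda>k. D d k w) (n d) (\<lambda>i. Y d i w)) A"
  \<comment> \<open>Where the empirical matrix is singular, mean 0 and variances 1 represent the
    conventional density \<open>f\<close>. On \<open>G\<close> all empirical variances are at least
    a / 2 > 0, so this case does not occur there.\<close>
  proof (rule efficient_proj_gauss[where r=r and D=D and c="?c" and a="a / 2" and B="max (8 + 2 * B) (2 + 2 * C)"
        and G=G and m="\<lambda>d w i. if ?reg d w then ?m d w i else 0" and v="\<lambda>d w k. if ?reg d w then ?V d w k else 1"])
    fix d :: nat assume d: "d \<ge> 1"
    interpret conditioned_gauss d "A d" by (rule cond[OF d])
    have r: "0 < r d" using assms(3)[OF d] by simp
    show "(\<lambda>w. if ?reg d w then ?V d w k else 1) \<in> borel_measurable (M d)" if "k < r d" for k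
      by (rule measurable_If[OF V_meas[OF d that] borel_measurable_const reg_sets[OF d]])
    show "(\<lambda>w. if ?reg d w then ?m d w i else 0) \<in> borel_measurable (M d)" if "i < d" for i
      by (rule measurable_If[OF m_meas[OF d r that] borel_measurable_const reg_sets[OF d]])
    show "G d \<in> sets (M d)"
    proof (cases "n d > 0")
      case True
      show ?thesis unfolding G_def if_P[OF True]
        by (rule fluctuation_event(1)[OF assms(4)[OF d] indep[OF d] law[OF d] True indep_D[OF d] assms(6)[OF d] \<eta>(1)])
    next
      case False
      then show ?thesis by (simp only: G_def if_False sets.empty_sets)
    qed
    fix w assume w: "w \<in> space (M d)"
    note on = assms(6)[OF d w]
    show "0 < (if ?reg d w then ?V d w k else 1)" if "k < r d" for k
      using that quad_form_emp_cov_nonneg[of d "n d" "\<lambda>i. Y d i w" "D d k w"] by (auto simp: less_le)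
    show "g_proj_hat d (r d) (\<lambda>k. D d k w) (n d) (\<lambda>i. Y d i w) =
        proj_gauss_density d (r d) (\<lambda>k. D d k w) (\<lambda>i. if ?reg d w then ?m d w i else 0)
          (\<lambda>k. if ?reg d w then ?V d w k else 1)"
    proof -
      let ?S = "proj_cov d (r d) (\<lambda>k. D d k w) (emp_cov d (n d) (\<lambda>i. Y d i w))"
      have S: "?S = rank_update d (r d) (\<lambda>k. D d k w) (\<lambda>k. ?V d w k - 1)"
        by (rule proj_cov_eq_rank_update)
      have inv: "invertible_mat ?S \<longleftrightarrow> ?reg d w"
        unfolding S by (rule invertible_rank_update_iff[OF on])
      show ?thesis
      proof (cases "?reg d w")
        case True
        show ?thesis
          unfolding g_proj_hat_def Let_def if_P[OF True] if_P[OF inv[THEN iffD2, OF True]]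
          unfolding S by (rule gauss_density_rank_update[OF on]) (use True in blast)
      next
        case False
        then have "\<not> invertible_mat ?S" by (simp only: inv not_False_eq_True)
        then show ?thesis
          unfolding g_proj_hat_def Let_def if_not_P[OF False]
          by (subst if_not_P) (assumption, rule std_gauss_eq_proj_gauss_density)
      qed
    qed
    assume wG: "w \<in> G d"
    have nd: "n d > 0"
    proof (rule ccontr)
      assume "\<not> n d > 0"
      with wG show False by (simp only: G_def if_False empty_iff)
    qed
    have S: "?S1 d w \<le> \<eta>" "?S2 d w \<le> \<eta>"
      using wG unfolding G_def if_P[OF nd] by blast+
    have Va: "a \<le> quad_form d (cov_A d (A d)) (D d k w)" if "k < r d" for k
      using bounds(2)[OF d d w d that] by (simp add: a_def)
    have VB: "(\<Sum>k<r d. (quad_form d (cov_A d (A d)) (D d k w) - 1)\<^sup>2) \<le> B"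
      using bounds(3)[OF d d w d] by (simp add: B_def)
    note emp = empirical_parameter_bounds[OF on nd a Va VB \<eta>(2,3) S]
    have emp1: "a / 2 \<le> ?V d w k" if "k < r d" for k by (rule emp(1)[OF _ that])
    have emp2: "(\<Sum>k<r d. (?V d w k - 1)\<^sup>2) \<le> 8 + 2 * B" by (rule emp(2))
    have emp3: "dot d (?m d w) (?m d w) \<le> 2 + 2 * C"
    proof -
      have "dot d (?m d w) (?m d w) \<le> 2 + 2 * dot d (mean_A d (A d)) (mean_A d (A d))" by (rule emp(3))
      also have "\<dots> \<le> 2 + 2 * C" using bounds(4)[OF d d w d] by simp
      finally show ?thesis .
    qed
    have reg: "?reg d w"
    proof (intro allI impI)
      fix k assume "k < r d"
      have "0 < a / 2" using a by simp
      also note emp1[OF \<open>k < r d\<close>]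
      finally show "?V d w k \<noteq> 0" by (rule less_imp_neq[THEN not_sym])
    qed
    show "(\<forall>k<r d. a / 2 \<le> (if ?reg d w then ?V d w k else 1)) \<and>
        (\<Sum>k<r d. ((if ?reg d w then ?V d w k else 1) - 1)\<^sup>2) \<le> max (8 + 2 * B) (2 + 2 * C) \<and>
        dot d (\<lambda>i. if ?reg d w then ?m d w i else 0) (\<lambda>i. if ?reg d w then ?m d w i else 0)
          \<le> max (8 + 2 * B) (2 + 2 * C)"
      unfolding if_P[OF reg]
      by (intro conjI allI impI emp1 max.coboundedI1[OF emp2] max.coboundedI2[OF emp3])
  next
    \<comment> \<open>The first summand bounds \<open>fourth_moment_const\<close> and the second one
      1 / p, both uniformly in d; dividing by \<open>\<eta>\<close> is Markov's inequality.\<close>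
    define K where "K = (8 * (512 * exp (1 / 2) / ?c + C\<^sup>2) + 1 / ?c) / \<eta>"
    show "(\<lambda>d. measure (M d) (space (M d) - G d)) \<longlonglongrightarrow> 0"
    proof (rule Lim_null_comparison)
      show "(\<lambda>d. K * inverse (real (n d) / (real (r d) * real d))) \<longlonglongrightarrow> 0"
        using tendsto_mult[OF tendsto_const tendsto_inverse_0_at_top[OF n_lim]] by simp
      \<comment> \<open>The value 1 only serves to exclude n d = 0, for which the quotient would be
        0.\<close>
      have "\<forall>\<^sub>F d in sequentially. 1 \<le> real (n d) / (real (r d) * real d)"
        using n_lim by (simp add: filterlim_at_top)
      then show "\<forall>\<^sub>F d in sequentially. norm (measure (M d) (space (M d) - G d))
          \<le> K * inverse (real (n d) / (real (r d) * real d))"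
        using eventually_ge_at_top[of 1]
      proof eventually_elim
        case (elim d)
        have d: "d \<ge> 1" by (rule elim(2))
        have nd: "n d > 0" by (rule gr0I) (use elim(1) in simp)
        interpret conditioned_gauss d "A d" by (rule cond[OF d])
        have r: "r d \<ge> 1" using assms(3)[OF d] by simp
        let ?p = "p_f d (A d)" and ?rd = "real (r d) * real d"
        \<comment> \<open>The errors have orders r / n and d / n; as r and d are at least 1, both
          are at most r d / n.\<close>
        have rd: "real (r d) \<le> ?rd" "real d \<le> ?rd" 
          using mult_left_mono[of 1 "real d" "real (r d)"] mult_right_mono[of 1 "real (r d)" "real d"] r d by auto
        have inv: "1 / ?p \<le> 1 / ?c" using c_le[OF d] c by (intro divide_left_mono) auto
        have lnp: "0 \<le> - 2 * ln ?p" by (rule order_trans[OF dot_self_nonneg mean_A_bound])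
        have F: "fourth_moment_const \<le> 8 * (512 * exp (1 / 2) / ?c + C\<^sup>2)"
        proof -
          have "(2 * ln ?p)\<^sup>2 \<le> C\<^sup>2" using power_mono[OF C[OF d] lnp, of 2] by simp
          moreover have "512 * exp (1 / 2) * (1 / ?p) \<le> 512 * exp (1 / 2) * (1 / ?c)"
            by (rule mult_left_mono[OF inv]) simp
          ultimately show ?thesis unfolding fourth_moment_const_def by simp
        qed
        have "measure (M d) (space (M d) - G d)
            \<le> (real (r d) * fourth_moment_const / real (n d) + real d / (?p * real (n d))) / \<eta>"
          unfolding G_def if_P[OF nd]
          by (rule fluctuation_event(2)[OF assms(4)[OF d] indep[OF d] law[OF d] nd indep_D[OF d] assms(6)[OF d] \<eta>(1)])
        also have "\<dots> \<le> (?rd * (8 * (512 * exp (1 / 2) / ?c + C\<^sup>2)) / real (n d) + ?rd * (1 / ?c) / real (n d)) / \<eta>"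
        proof (intro divide_right_mono add_mono)
          show "real (r d) * fourth_moment_const \<le> ?rd * (8 * (512 * exp (1 / 2) / ?c + C\<^sup>2))"
            by (rule mult_mono[OF rd(1) F _ fourth_moment_const_nonneg]) simp
          have "real d * (1 / ?p) \<le> ?rd * (1 / ?c)"
            by (rule mult_mono[OF rd(2) inv]) (use p_pos in auto)
          then have "real d * (1 / ?p) / real (n d) \<le> ?rd * (1 / ?c) / real (n d)"
            by (rule divide_right_mono) simp
          moreover have "real d / (?p * real (n d)) = real d * (1 / ?p) / real (n d)" by simp
          ultimately show "real d / (?p * real (n d)) \<le> ?rd * (1 / ?c) / real (n d)" by (simp only:)
        qed (use \<eta>(1) in auto)
        also have "\<dots> = K * inverse (real (n d) / ?rd)"
          unfolding K_def by (simp add: inverse_eq_divide add_divide_distrib algebra_simps)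
        finally show ?case by simp
      qed
    qed
  qed (use assms c c_le a in auto)
qed

end
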